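(* Let $S=\langle n_1,n_2,n_3,n_4\rangle$ be a $4$-generated pseudo-symmetric numerical semigroup, with generators $n_1,\dots,n_4$ written in terms of integers $\alpha_1,\alpha_2,\alpha_3,\alpha_4,\alpha_{21}$ as in the context, and suppose that the tangent cone ring $gr_{\mathfrak m}(R_S)\cong A/I_S^*$ is Cohen-Macaulay. Then the Betti sequence $\beta(A/I_S^* )=(\beta_0,\beta_1,\beta_2,\beta_3)$ of the tangent cone satisfies: \begin{itemize} \item if $n_1$ is the multiplicity, then $\beta(A/I_S^* )=(1,5,6,2)$; \item if $n_2$ is the multiplicity and $\alpha_1=\alpha_4$, then $\beta(A/I_S^* )=(1,5,6,2)$; \item if $n_2$ is the multiplicity and $\alpha_1<\alpha_4$, then $\beta(A/I_S^* )=(1,5,7,3)$; \item if $n_2$ is the multiplicity and $\alpha_1>\alpha_4$, then $\beta(A/I_S^* )=(1,6,9,4)$; \item if $n_3$ is the multiplicity and $\alpha_2=\alpha_{21}+1$, then $\beta(A/I_S^* )=(1,5,6,2)$; \item if $n_3$ is the multiplicity and $\alpha_2<\alpha_{21}+1$, then $\beta(A/I_S^* )=(1,6,8,3)$; \item if $n_4$ is the multiplicity and $\alpha_3=\alpha_1-\alpha_{21}$, then $\beta(A/I_S^* )=(1,5,6,2)$; \item if $n_4$ is the multiplicity and $\alpha_3<\alpha_1-\alpha_{21}$, then $\beta(A/I_S^* )=(1,5,7,3)$. \end{itemize}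
   Context: A numerical semigroup is $S=\langle n_1,\dots,n_k\rangle=\{u_1n_1+\cdots+u_kn_k : u_i\in\mathbb N\}$ with $n_i$ positive integers and $\gcd(n_1,\dots,n_k)=1$; it is $k$-generated if $n_1,\dots,n_k$ is its minimal generating set. The multiplicity is the smallest minimal generator of $S$. Pseudo-symmetric $4$-generated semigroups (Komeda's parametrization, fixing the order of the generators): $S=\langle n_1,n_2,n_3,n_4\rangle$ (with $\gcd(n_1,n_2,n_3,n_4)=1$ and the $n_i$ minimal generators) such that there are integers $\alpha_i>1$ for $1\le i\le 4$ and $\alpha_{21}$ with $0<\alpha_{21}<\alpha_1-1$ satisfying $$n_1=\alpha_2\alpha_3(\alpha_4-1)+1,$$ $$n_2=\alpha_{21}\alpha_3\alpha_4+(\alpha_1-\alpha_{21}-1)(\alpha_3-1)+\alpha_3,$$ $$n_3=\alpha_1\alpha_4+(\alpha_1-\alpha_{21}-1)(\alpha_2-1)(\alpha_4-1)-\alpha_4+1,$$ $$n_4=\alpha_1\alpha_2(\alpha_3-1)+\alpha_{21}(\alpha_2-1)+\alpha_2.$$ The parameters $\alpha_i,\alpha_{21}$ in the claim are these. Let $K$ be a field, $A=K[X_1,X_2,X_3,X_4]$, and let $I_S$ be the kernel of the $K$-algebra map $A\to K[t]$, $X_i\mapsto t^{n_i}$, so $K[S]:=K[t^{n_1},\dots,t^{n_4}]\cong A/I_S$. The toric ideal is $I_S=\langle f_1,\dots,f_5\rangle$ with $f_1=X_1^{\alpha_1}-X_3X_4^{\alpha_4-1}$, $f_2=X_2^{\alpha_2}-X_1^{\alpha_{21}}X_4$,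 $f_3=X_3^{\alpha_3}-X_1^{\alpha_1-\alpha_{21}-1}X_2$, $f_4=X_4^{\alpha_4}-X_1X_2^{\alpha_2-1}X_3^{\alpha_3-1}$, $f_5=X_1^{\alpha_{21}+1}X_3^{\alpha_3-1}-X_2X_4^{\alpha_4-1}$. Let $R_S=K[[t^{n_1},\dots,t^{n_4}]]$ with maximal ideal $\mathfrak m=\langle t^{n_1},\dots,t^{n_4}\rangle$. Then $gr_{\mathfrak m}(R_S)=\bigoplus_{i\ge 0}\mathfrak m^i/\mathfrak m^{i+1}\cong A/I_S^*$, where $I_S^*=\langle f^* : f\in I_S\rangle$ and $f^*$ is the nonzero homogeneous summand of $f$ of least (standard) degree. "The tangent cone is Cohen-Macaulay" means that this ring is Cohen-Macaulay. The Betti sequence $\beta(M)=(\beta_0,\beta_1,\beta_2,\beta_3)$ of a finitely generated graded $A$-module $M$ is the sequence of ranks of the free modules in a minimal graded free resolution $0\to A^{\beta_3}\to A^{\beta_2}\to A^{\beta_1}\to A^{\beta_0}$ of $M$ over $A$. *)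

theory Defs
  imports
    "HOL-Library.Poly_Mapping"
    "HOL-Library.Extended_Nat"
    "HOL-Library.Numeral_Type"
    "HOL-Computational_Algebra.Polynomial"
    "HOL-Algebra.QuotRing"
    "HOL-Algebra.Ring_Divisibility"
    "HOL-Algebra.Algebraic_Closure_Type"
    "Jordan_Normal_Form.Matrix_Kernel"
begin

section \<open>Numerical semigroups\<close>

definition semigroup_span :: "'i set \<Rightarrow> ('i \<Rightarrow> nat) \<Rightarrow> nat set" where
  "semigroup_span J n = {\<Sum>i\<in>J. u i * n i | u. True}"

text \<open>The family \<open>n\<close> is the minimal generating set of a numerical semigroup: no proper subfamily
  generates the same semigroup (in particular \<open>n\<close> is injective).\<close>

definition minimally_generates_numerical_semigroup :: "('i::finite \<Rightarrow> nat) \<Rightarrow> bool" where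
  "minimally_generates_numerical_semigroup n \<longleftrightarrow>
     (\<forall>i. 0 < n i) \<and> Gcd (range n) = 1 \<and>
     (\<forall>J. J \<noteq> UNIV \<longrightarrow> semigroup_span J n \<noteq> semigroup_span UNIV n)"

definition semigroup_multiplicity :: "('i::finite \<Rightarrow> nat) \<Rightarrow> nat" where
  "semigroup_multiplicity n = Min (range n)"

text \<open>Komeda's parametrization of the 4-generated pseudo-symmetric numerical semigroups.
  The index type \<open>4\<close> has the four elements \<open>1, 2, 3, 4\<close> (where \<open>4 = 0\<close>).\<close>

definition pseudo_symmetric_4_generated ::
    "(4 \<Rightarrow> nat) \<Rightarrow> int \<Rightarrow> int \<Rightarrow> int \<Rightarrow> int \<Rightarrow> int \<Rightarrow> bool" where
  "pseudo_symmetric_4_generated n \<alpha>\<^sub>1 \<alpha>\<^sub>2 \<alpha>\<^sub>3 \<alpha>\<^sub>4 \<alpha>\<^sub>2\<^sub>1 \<longleftrightarrow>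
     minimally_generates_numerical_semigroup n \<and>
     1 < \<alpha>\<^sub>1 \<and> 1 < \<alpha>\<^sub>2 \<and> 1 < \<alpha>\<^sub>3 \<and> 1 < \<alpha>\<^sub>4 \<and> 0 < \<alpha>\<^sub>2\<^sub>1 \<and> \<alpha>\<^sub>2\<^sub>1 < \<alpha>\<^sub>1 - 1 \<and>
     int (n 1) = \<alpha>\<^sub>2 * \<alpha>\<^sub>3 * (\<alpha>\<^sub>4 - 1) + 1 \<and>
     int (n 2) = \<alpha>\<^sub>2\<^sub>1 * \<alpha>\<^sub>3 * \<alpha>\<^sub>4 + (\<alpha>\<^sub>1 - \<alpha>\<^sub>2\<^sub>1 - 1) * (\<alpha>\<^sub>3 - 1) + \<alpha>\<^sub>3 \<and>
     int (n 3) = \<alpha>\<^sub>1 * \<alpha>\<^sub>4 + (\<alpha>\<^sub>1 - \<alpha>\<^sub>2\<^sub>1 - 1) * (\<alpha>\<^sub>2 - 1) * (\<alpha>\<^sub>4 - 1) - \<alpha>\<^sub>4 + 1 \<and>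
     int (n 4) = \<alpha>\<^sub>1 * \<alpha>\<^sub>2 * (\<alpha>\<^sub>3 - 1) + \<alpha>\<^sub>2\<^sub>1 * (\<alpha>\<^sub>2 - 1) + \<alpha>\<^sub>2"


section \<open>Polynomial rings and the tangent cone ideal\<close>

text \<open>Polynomials over \<open>'k\<close> in variables indexed by \<open>'v\<close>, as finitely supported functions from
  exponent vectors to coefficients; multiplication is convolution.\<close>

type_synonym ('v, 'k) mpol = "('v \<Rightarrow>\<^sub>0 nat) \<Rightarrow>\<^sub>0 'k"

abbreviation mpol_ring :: "('v, 'k::comm_ring_1) mpol ring" where
  "mpol_ring \<equiv> ring_of_type_algebra"

definition mdeg :: "('v::finite \<Rightarrow>\<^sub>0 nat) \<Rightarrow> nat" where
  "mdeg m = (\<Sum>i\<in>UNIV. Poly_Mapping.lookup m i)"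

text \<open>Degrees are integers so that degree shifts can be subtracted; the polynomial \<open>0\<close> is
  homogeneous of every degree, and it is the only one of negative degree.\<close>

definition homogeneous :: "int \<Rightarrow> ('v::finite, 'k::zero) mpol \<Rightarrow> bool" where
  "homogeneous d f \<longleftrightarrow> (\<forall>m\<in>Poly_Mapping.keys f. int (mdeg m) = d)"

definition homogeneous_component :: "nat \<Rightarrow> ('v::finite, 'k::comm_monoid_add) mpol \<Rightarrow> ('v, 'k) mpol"
  where "homogeneous_component d f =
     (\<Sum>m\<in>{m \<in> Poly_Mapping.keys f. mdeg m = d}. Poly_Mapping.single m (Poly_Mapping.lookup f m))"

text \<open>The form \<open>f\<^sup>*\<close>; meaningful for \<open>f \<noteq> 0\<close>.\<close>

definition initial_form :: "('v::finite, 'k::comm_monoid_add) mpol \<Rightarrow> ('v, 'k) mpol" where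
  "initial_form f = homogeneous_component (Min (mdeg ` Poly_Mapping.keys f)) f"

text \<open>The \<open>'k\<close>-algebra map into \<open>'k[t]\<close> sending the variable \<open>X\<^sub>i\<close> to \<open>t\<close> to the power \<open>n i\<close>.\<close>

definition toric_map :: "('v::finite \<Rightarrow> nat) \<Rightarrow> ('v, 'k::comm_ring_1) mpol \<Rightarrow> 'k poly" where
  "toric_map n f =
     (\<Sum>m\<in>Poly_Mapping.keys f. Polynomial.smult (Poly_Mapping.lookup f m)
        (\<Prod>i\<in>UNIV. (Polynomial.monom 1 (n i)) ^ Poly_Mapping.lookup m i))"

definition toric_ideal :: "('v::finite \<Rightarrow> nat) \<Rightarrow> ('v, 'k::comm_ring_1) mpol set" where
  "toric_ideal n = {f. toric_map n f = 0}"

definition tangent_cone_ideal :: "('v::finite \<Rightarrow> nat) \<Rightarrow> ('v, 'k::comm_ring_1) mpol set" where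
  "tangent_cone_ideal n = Idl\<^bsub>mpol_ring\<^esub> (initial_form ` (toric_ideal n - {0}))"


section \<open>Cohen-Macaulay rings\<close>

definition height :: "('a, 'b) ring_scheme \<Rightarrow> 'a set \<Rightarrow> enat" where
  "height R P = (SUP k\<in>{k. \<exists>Q::nat \<Rightarrow> 'a set.
       (\<forall>i\<le>k. primeideal (Q i) R) \<and> (\<forall>i<k. Q i \<subset> Q (Suc i)) \<and> Q k = P}. enat k)"

text \<open>\<open>xs ! i\<close> is a nonzerodivisor modulo the ideal generated by the preceding elements.\<close>

definition regular_sequence :: "('a, 'b) ring_scheme \<Rightarrow> 'a list \<Rightarrow> bool" where
  "regular_sequence R xs \<longleftrightarrow>
     set xs \<subseteq> carrier R \<and> Idl\<^bsub>R\<^esub> (set xs) \<noteq> carrier R \<and>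
     (\<forall>i<length xs. \<forall>r\<in>carrier R.
        xs ! i \<otimes>\<^bsub>R\<^esub> r \<in> Idl\<^bsub>R\<^esub> (set (take i xs)) \<longrightarrow> r \<in> Idl\<^bsub>R\<^esub> (set (take i xs)))"

definition depth :: "('a, 'b) ring_scheme \<Rightarrow> 'a set \<Rightarrow> enat" where
  "depth R P = (SUP xs\<in>{xs. regular_sequence R xs \<and> set xs \<subseteq> P}. enat (length xs))"

text \<open>The definition of Kaplansky and Eisenbud. For a maximal ideal \<open>P\<close> of a Noetherian ring,
  the depth of \<open>P\<close> on \<open>R\<close> is the depth of the localization at \<open>P\<close>, and the height of \<open>P\<close> is its
  dimension, so this says that all localizations at maximal ideals are Cohen-Macaulay.\<close>

definition cohen_macaulay :: "('a, 'b) ring_scheme \<Rightarrow> bool" where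
  "cohen_macaulay R \<longleftrightarrow> cring R \<and> noetherian_ring R \<and>
     (\<forall>P. maximalideal P R \<longrightarrow> depth R P = height R P)"


section \<open>Graded modules and Betti sequences\<close>

definition quotient_module :: "('a, 'b) ring_scheme \<Rightarrow> 'a set \<Rightarrow> ('a, 'a set) module" where
  "quotient_module R I =
     \<lparr>carrier = carrier (R Quot I), monoid.mult = monoid.mult (R Quot I), one = monoid.one (R Quot I),
      zero = ring.zero (R Quot I), add = ring.add (R Quot I),
      module.smult = (\<lambda>a C. (I +>\<^bsub>R\<^esub> a) \<otimes>\<^bsub>R Quot I\<^esub> C)\<rparr>"

lemma module_quotient_module:
  fixes R (structure)
  assumes "cring R" "ideal I R"
  shows "Module.module R (quotient_module R I)"
proof -
  interpret cring R by fact
  interpret I: ideal I R by fact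
  interpret Q: cring "R Quot I" by (rule I.quotient_is_cring) (rule assms(1))
  have *: "(I +> a) \<in> carrier (R Quot I)" if "a \<in> carrier R" for a
    using that by (auto simp: FactRing_def A_RCOSETS_def')
  have ab: "abelian_group (quotient_module R I)"
  proof (rule abelian_groupI, goal_cases)
    case (6 x)
    then show ?case
      by (intro bexI[of _ "\<ominus>\<^bsub>R Quot I\<^esub> x"]) (simp_all add: quotient_module_def Q.l_neg)
  qed (simp_all add: quotient_module_def Q.a_ac)
  show ?thesis
  proof (rule moduleI[OF assms(1) ab], goal_cases)
    case (1 a x)
    then show ?case using * by (simp add: quotient_module_def)
  next
    case (2 a b x)
    have "I +> (a \<oplus> b) = (I +> a) \<oplus>\<^bsub>R Quot I\<^esub> (I +> b)"
      using 2 I.rcos_ring_hom ring_hom_add by fastforce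
    then show ?case using * 2 by (simp add: quotient_module_def Q.l_distr)
  next
    case (3 a x y)
    then show ?case using * by (simp add: quotient_module_def Q.r_distr)
  next
    case (4 a b x)
    have "I +> (a \<otimes> b) = (I +> a) \<otimes>\<^bsub>R Quot I\<^esub> (I +> b)"
      using 4 I.rcos_ring_hom ring_hom_mult by fastforce
    then show ?case using * 4 by (simp add: quotient_module_def Q.m_assoc)
  next
    case (5 x)
    have "I +> \<one> = \<one>\<^bsub>R Quot I\<^esub>" by (simp add: FactRing_def)
    then show ?case using 5 by (simp add: quotient_module_def)
  qed
qed

text \<open>A grading of a module is given by its family of homogeneous parts. On \<open>A/I\<close>, with \<open>I\<close> a
  homogeneous ideal, it is induced by the standard grading of \<open>A\<close>.\<close>

definition quotient_grading :: "('v::finite, 'k::comm_ring_1) mpol set \<Rightarrow> int \<Rightarrow> ('v, 'k) mpol set set"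
  where "quotient_grading I d = (\<lambda>f. I +>\<^bsub>mpol_ring\<^esub> f) ` {f. homogeneous d f}"

text \<open>A list \<open>d\<close> of degrees stands for the graded free module with a basis of elements of degrees
  \<open>d ! 0, d ! 1, \<dots>\<close>, whose underlying module consists of the vectors of dimension \<open>length d\<close>.
  A matrix is homogeneous from \<open>d\<close> to \<open>e\<close> if it preserves degrees, and minimal if all its
  entries lie in the irrelevant ideal, that is, have constant coefficient \<open>0\<close>.\<close>

definition homogeneous_matrix :: "int list \<Rightarrow> int list \<Rightarrow> ('v::finite, 'k::comm_ring_1) mpol mat \<Rightarrow> bool"
  where "homogeneous_matrix d e D \<longleftrightarrow>
     D \<in> carrier_mat (length e) (length d) \<and>
     (\<forall>i<length e. \<forall>j<length d. homogeneous (d ! j - e ! i) (D $$ (i, j)))"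

definition minimal_matrix :: "('v::finite, 'k::comm_ring_1) mpol mat \<Rightarrow> bool" where
  "minimal_matrix D \<longleftrightarrow> (\<forall>i<dim_row D. \<forall>j<dim_col D. Poly_Mapping.lookup (D $$ (i, j)) 0 = 0)"

definition matrix_range :: "'a::comm_ring_1 mat \<Rightarrow> 'a vec set" where
  "matrix_range D = (\<lambda>v. D *\<^sub>v v) ` carrier_vec (dim_col D)"

text \<open>The linear map from the free module onto \<open>M\<close> sending the \<open>i\<close>-th basis vector to \<open>g i\<close>.\<close>

definition augmentation ::
    "(('v, 'k::comm_ring_1) mpol, 'm) module \<Rightarrow> (nat \<Rightarrow> 'm) \<Rightarrow> ('v, 'k) mpol vec \<Rightarrow> 'm" where
  "augmentation M g v = (\<Oplus>\<^bsub>M\<^esub>i\<in>{..<dim_vec v}. (v $ i) \<odot>\<^bsub>M\<^esub> g i)"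

text \<open>\<open>0 \<rightarrow> F\<^sub>3 \<rightarrow> F\<^sub>2 \<rightarrow> F\<^sub>1 \<rightarrow> F\<^sub>0 \<rightarrow> M \<rightarrow> 0\<close> is a minimal graded free resolution of the module \<open>M\<close>
  with grading \<open>G\<close>, where \<open>F\<^sub>i\<close> has basis degrees \<open>d\<^sub>i\<close>.\<close>

definition minimal_graded_free_resolution ::
    "(('v::finite, 'k::comm_ring_1) mpol, 'm) module \<Rightarrow> (int \<Rightarrow> 'm set) \<Rightarrow>
     int list \<Rightarrow> int list \<Rightarrow> int list \<Rightarrow> int list \<Rightarrow> (nat \<Rightarrow> 'm) \<Rightarrow>
     ('v, 'k) mpol mat \<Rightarrow> ('v, 'k) mpol mat \<Rightarrow> ('v, 'k) mpol mat \<Rightarrow> bool" where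
  "minimal_graded_free_resolution M G d\<^sub>0 d\<^sub>1 d\<^sub>2 d\<^sub>3 g D\<^sub>1 D\<^sub>2 D\<^sub>3 \<longleftrightarrow>
     (\<forall>i<length d\<^sub>0. g i \<in> G (d\<^sub>0 ! i)) \<and>
     homogeneous_matrix d\<^sub>1 d\<^sub>0 D\<^sub>1 \<and> homogeneous_matrix d\<^sub>2 d\<^sub>1 D\<^sub>2 \<and> homogeneous_matrix d\<^sub>3 d\<^sub>2 D\<^sub>3 \<and>
     minimal_matrix D\<^sub>1 \<and> minimal_matrix D\<^sub>2 \<and> minimal_matrix D\<^sub>3 \<and>
     augmentation M g ` carrier_vec (length d\<^sub>0) = carrier M \<and>
     {v \<in> carrier_vec (length d\<^sub>0). augmentation M g v = \<zero>\<^bsub>M\<^esub>} = matrix_range D\<^sub>1 \<and>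
     mat_kernel D\<^sub>1 = matrix_range D\<^sub>2 \<and>
     mat_kernel D\<^sub>2 = matrix_range D\<^sub>3 \<and>
     mat_kernel D\<^sub>3 = {0\<^sub>v (length d\<^sub>3)}"

text \<open>Minimal graded free resolutions are unique up to isomorphism, so \<open>\<beta>\<close> is determined by
  \<open>M\<close> and \<open>G\<close> for graded modules \<open>M\<close> over a polynomial ring over a field.\<close>

definition betti_sequence ::
    "(('v::finite, 'k::comm_ring_1) mpol, 'm) module \<Rightarrow> (int \<Rightarrow> 'm set) \<Rightarrow>
     nat \<times> nat \<times> nat \<times> nat \<Rightarrow> bool" where
  "betti_sequence M G \<beta> \<longleftrightarrow>
     (\<exists>d\<^sub>0 d\<^sub>1 d\<^sub>2 d\<^sub>3 g D\<^sub>1 D\<^sub>2 D\<^sub>3.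
        minimal_graded_free_resolution M G d\<^sub>0 d\<^sub>1 d\<^sub>2 d\<^sub>3 g D\<^sub>1 D\<^sub>2 D\<^sub>3 \<and>
        \<beta> = (length d\<^sub>0, length d\<^sub>1, length d\<^sub>2, length d\<^sub>3))"

abbreviation quotient_betti_sequence ::
    "('v::finite, 'k::comm_ring_1) mpol set \<Rightarrow> nat \<times> nat \<times> nat \<times> nat \<Rightarrow> bool" where
  "quotient_betti_sequence I \<equiv> betti_sequence (quotient_module mpol_ring I) (quotient_grading I)"

end

theory Submission
  imports Defs
begin

text \<open>
  Let \<open>n i\<close> be the multiplicity. The tangent cone has dimension at least one and is integral
  over \<open>k[X\<^sub>i]\<close>, so if it is Cohen-Macaulay then \<open>X\<^sub>i\<close> is
  regular on it. By a maximal degree argument, every monomial whose weight stays in the semigroup after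
  subtraction of \<open>n i\<close> then lies in \<open>I\<^sub>S\<^sup>* + (X\<^sub>i)\<close>.
  Counting the remaining monomials against the \<open>n i\<close> residue classes modulo
  \<open>n i\<close> shows that they represent the Apery set, and determines
  \<open>I\<^sub>S\<^sup>* + (X\<^sub>i)\<close>: it is \<open>J + (X\<^sub>i)\<close> with \<open>J\<close> generated by
  monomials and at most one binomial not involving \<open>X\<^sub>i\<close>. As
  \<open>X\<^sub>i\<close> is regular modulo both ideals, a resolution of \<open>J\<close> lifts to one
  of \<open>I\<^sub>S\<^sup>*\<close> with the same graded ranks. Finally \<open>J\<close> is resolved
  by iterated mapping cones, adding one generator at a time; in two of the cases a unit entry has to be
  cancelled at the end.
\<close>

section \<open>Exact sequences of free modules\<close>

text \<open>The case split is a comparison of degrees. At \<open>X_i = 0\<close> each of f_1, ...,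
  f_5 becomes a monomial, with one exception: f_1 for i = 2, f_2 for i = 3, f_3 for i = 4, and none
  for i = 1. Which term of the exception has the smaller degree decides whether its leading form is
  one term, the other, or the whole binomial. In two cases the other term then needs a bound of its
  own, and this produces a sixth generator. No standard basis of the toric ideal is computed. The
  normal forms are counted instead: their number is literally Komeda's polynomial for
  \<open>n i\<close>, and this alone excludes further elements of I_S^* modulo \<open>X_i\<close>. A
  generator of J need not lie in I_S^*; it does so only up to a multiple of \<open>X_i\<close>.
  Hence the two resolutions agree only modulo \<open>X_i\<close>, and corrections by multiples of
  \<open>X_i\<close> are made degree by degree. They end because homogeneous elements of negative
  degree vanish; this replaces Nakayama's lemma.\<close>

definition relations_exact :: "nat \<Rightarrow> nat \<Rightarrow> nat \<Rightarrow> (nat \<Rightarrow> nat \<Rightarrow> 'a::comm_ring_1) \<Rightarrow> (nat \<Rightarrow> nat \<Rightarrow> 'a) \<Rightarrow> bool" where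
  "relations_exact r n l M N \<longleftrightarrow>
     (\<forall>j<l. \<forall>i<r. (\<Sum>k<n. N j k * M k i) = 0) \<and>
     (\<forall>v. (\<forall>i<r. (\<Sum>k<n. v k * M k i) = 0) \<longrightarrow> (\<exists>t. \<forall>k<n. v k = (\<Sum>j<l. t j * N j k)))"

text \<open>Encodes a complex 0 -> A^|B| -> A^|C| -> A^|G| -> A. The matrices act on row vectors
  from the right, so their rows are the relations. The last clause, a relation module without
  generators, is injectivity of \<open>B\<close>; for \<open>B = []\<close> the clause before it is
  injectivity of \<open>C\<close>.\<close>

definition list_resolution :: "'a::comm_ring_1 list \<Rightarrow> 'a list list \<Rightarrow> 'a list list \<Rightarrow> bool" where
  "list_resolution G C B \<longleftrightarrow>
     (\<forall>c\<in>set C. length c = length G) \<and> (\<forall>b\<in>set B. length b = length C) \<and>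
     relations_exact 1 (length G) (length C) (\<lambda>i _. G ! i) (\<lambda>j i. C ! j ! i) \<and>
     relations_exact (length G) (length C) (length B) (\<lambda>j i. C ! j ! i) (\<lambda>l j. B ! l ! j) \<and>
     relations_exact (length C) (length B) 0 (\<lambda>l j. B ! l ! j) (\<lambda>_ _. 0)"

lemma relations_exact_zero:
  "relations_exact r n l M N \<Longrightarrow> j < l \<Longrightarrow> i < r \<Longrightarrow>
      (\<Sum>k<n. N j k * M k i) = 0"
  by (simp add: relations_exact_def)

lemma relations_exactD:
  assumes "relations_exact r n l M N" "\<And>i. i < r \<Longrightarrow> (\<Sum>k<n. v k * M k i) = 0"
  shows "\<exists>t. \<forall>k<n. v k = (\<Sum>j<l. t j * N j k)"
  using assms unfolding relations_exact_def by blast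

lemma relations_exact_inj:
  assumes "relations_exact r n 0 M N" "\<And>i. i < r \<Longrightarrow> (\<Sum>k<n. v k * M k i) = 0" "k < n"
  shows "v k = 0"
  using relations_exactD[OF assms(1,2)] assms(3) by simp

lemma sum_lessThan_add:
  fixes f :: "nat \<Rightarrow> 'a::comm_monoid_add"
  shows "sum f {..<m + n} = sum f {..<m} + (\<Sum>i<n. f (m + i))"
  by (induction n) (simp_all add: add.assoc)

lemma sum_mult_sum_swap:
  fixes f :: "nat \<Rightarrow> 'a::comm_ring_1"
  shows "(\<Sum>k<n. (\<Sum>l<q. f l * g l k) * h k) = (\<Sum>l<q. f l * (\<Sum>k<n. g l k * h k))"
  by (simp add: sum_distrib_left sum_distrib_right mult.assoc) (rule sum.swap)

text \<open>The mapping cone of multiplication by \<open>m\<close> in 0 -> A/(J : m) -> A/J -> A/(J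
  + (m)) -> 0, where \<open>G\<close> generates J. The lists \<open>a\<close> and \<open>w\<close>
  lift this map to the resolutions, and \<open>lift\<close> and \<open>colon\<close> together say
  that \<open>H\<close> generates J : m. As A/(J : m) has a resolution of length two, the cone has
  length three.\<close>

lemma list_resolution_mapping_cone:
  fixes m :: "'a::comm_ring_1"
  assumes J: "list_resolution G C B" and Q: "list_resolution H R []"
    and la: "length a = length H" "\<forall>x\<in>set a. length x = length G"
    and lw: "length w = length R" "\<forall>x\<in>set w. length x = length C"
    and lift: "\<forall>k<length H. H ! k * m = (\<Sum>i<length G. a ! k ! i * G ! i)"
    and lift2: "\<forall>l<length R. \<forall>i<length G.
        (\<Sum>k<length H. R ! l ! k * a ! k ! i) = (\<Sum>j<length C. w ! l ! j * C ! j ! i)"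
    and colon: "\<And>r v. r * m = (\<Sum>i<length G. v i * G ! i) \<Longrightarrow>
        \<exists>p. r = (\<Sum>k<length H. p k * H ! k)"
  shows "list_resolution (G @ [m])
     (map (\<lambda>c. c @ [0]) C @ map2 (\<lambda>x h. map uminus x @ [h]) a H)
     (map (\<lambda>b. b @ map (\<lambda>_. 0) H) B @ map2 (@) w R)"
proof -
  let ?k1 = "length G" and ?k2 = "length C" and ?k3 = "length B"
  let ?q1 = "length H" and ?q2 = "length R"
  let ?G = "G @ [m]"
  let ?C = "map (\<lambda>c. c @ [0]) C @ map2 (\<lambda>x h. map uminus x @ [h]) a H"
  let ?B = "map (\<lambda>b. b @ map (\<lambda>_. 0) H) B @ map2 (@) w R"
  have lC: "\<forall>c\<in>set C. length c = ?k1" and lB: "\<forall>b\<in>set B. length b = ?k2" and lR: "\<forall>b\<in>set R. length b = ?q1"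
    and J1: "relations_exact 1 ?k1 ?k2 (\<lambda>i _. G ! i) (\<lambda>j i. C ! j ! i)"
    and J2: "relations_exact ?k1 ?k2 ?k3 (\<lambda>j i. C ! j ! i) (\<lambda>l j. B ! l ! j)"
    and J3: "relations_exact ?k2 ?k3 0 (\<lambda>l j. B ! l ! j) (\<lambda>_ _. 0)"
    and Q1: "relations_exact 1 ?q1 ?q2 (\<lambda>i _. H ! i) (\<lambda>j i. R ! j ! i)"
    using J Q by (simp_all add: list_resolution_def)
  have Q2: "relations_exact ?q1 ?q2 0 (\<lambda>j i. R ! j ! i) (\<lambda>_ _. 0)"
    using Q by (simp add: list_resolution_def relations_exact_def)
  have lC': "length ?C = ?k2 + ?q1" and lB': "length ?B = ?k3 + ?q2"
    using la lw by simp_all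
  have C1: "?C ! j ! i = C ! j ! i" if "j < ?k2" "i < ?k1" for i j
    using that lC by (simp add: nth_append)
  have C2: "?C ! j ! ?k1 = 0" if "j < ?k2" for j
    using that lC by (simp add: nth_append)
  have C3: "?C ! (?k2 + k) ! i = - a ! k ! i" if "k < ?q1" "i < ?k1" for i k
    using that la by (simp add: nth_append)
  have C4: "?C ! (?k2 + k) ! ?k1 = H ! k" if "k < ?q1" for k
    using that la by (simp add: nth_append)
  have B1: "?B ! j ! i = B ! j ! i" if "j < ?k3" "i < ?k2" for i j
    using that lB by (simp add: nth_append)
  have B2: "?B ! j ! (?k2 + i) = 0" if "j < ?k3" "i < ?q1" for i j
    using that lB by (simp add: nth_append)
  have B3: "?B ! (?k3 + l) ! i = w ! l ! i" if "l < ?q2" "i < ?k2" for i l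
    using that lw by (simp add: nth_append)
  have B4: "?B ! (?k3 + l) ! (?k2 + i) = R ! l ! i" if "l < ?q2" "i < ?q1" for i l
    using that lw by (simp add: nth_append)
  have sG: "(\<Sum>i<Suc ?k1. v i * ?G ! i) = (\<Sum>i<?k1. v i * G ! i) + v ?k1 * m" for v
    by (simp add: nth_append)
  have sC: "(\<Sum>j<?k2+?q1. t j * ?C ! j ! i) = (\<Sum>j<?k2. t j * C ! j ! i) - (\<Sum>k<?q1. t (?k2 + k) * a ! k ! i)"
    if "i < ?k1" for t i
    using that by (simp add: sum_lessThan_add C1 C3 sum_negf)
  have sC': "(\<Sum>j<?k2+?q1. t j * ?C ! j ! ?k1) = (\<Sum>k<?q1. t (?k2 + k) * H ! k)" for t
    by (simp add: sum_lessThan_add C2 C4)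
  have sB: "(\<Sum>j<?k3+?q2. t j * ?B ! j ! i) = (\<Sum>j<?k3. t j * B ! j ! i) + (\<Sum>l<?q2. t (?k3 + l) * w ! l ! i)"
    if "i < ?k2" for t i
    using that by (simp add: sum_lessThan_add B1 B3)
  have sB': "(\<Sum>j<?k3+?q2. t j * ?B ! j ! (?k2 + i)) = (\<Sum>l<?q2. t (?k3 + l) * R ! l ! i)"
    if "i < ?q1" for t i
    using that by (simp add: sum_lessThan_add B2 B4)
  have "relations_exact 1 (Suc ?k1) (?k2 + ?q1) (\<lambda>i _. ?G ! i) (\<lambda>j i. ?C ! j ! i)"
    unfolding relations_exact_def
  proof (intro conjI allI impI)
    fix j i assume j: "j < ?k2 + ?q1" and "i < (1::nat)"
    show "(\<Sum>k<Suc ?k1. ?C ! j ! k * ?G ! k) = 0"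
    proof (cases "j < ?k2")
      case True
      then have "(\<Sum>i<?k1. C ! j ! i * G ! i) = 0"
        using J1 by (simp add: relations_exact_def)
      then show ?thesis using True by (simp only: sG C2) (simp add: C1)
    next
      case False
      then obtain k where k: "j = ?k2 + k" "k < ?q1" using j
        by (metis add_less_cancel_left le_add_diff_inverse not_less)
      show ?thesis using k lift by (simp only: sG C4) (simp add: C3 sum_negf)
    qed
  next
    fix v assume "\<forall>i<(1::nat). (\<Sum>k<Suc ?k1. v k * ?G ! k) = 0"
    from this[rule_format, of 0]
    have v0: "(\<Sum>i<?k1. v i * G ! i) + v ?k1 * m = 0" unfolding sG by simp
    then have "v ?k1 * m = (\<Sum>i<?k1. (- v i) * G ! i)"
      by (simp add: sum_negf eq_neg_iff_add_eq_0 add.commute)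
    from colon[OF this] obtain p where p: "v ?k1 = (\<Sum>k<?q1. p k * H ! k)" by blast
    \<comment> \<open>The last coefficient of a relation lies in J : m. Adding the matching
      combination of the rows of \<open>a\<close> trades it for a relation of \<open>G\<close>
      alone.\<close>
    define v' where "v' i = v i + (\<Sum>k<?q1. p k * a ! k ! i)" for i
    have "(\<Sum>i<?k1. v' i * G ! i) = (\<Sum>i<?k1. v i * G ! i) + (\<Sum>k<?q1. p k * (\<Sum>i<?k1. a ! k ! i * G ! i))"
      by (simp add: v'_def distrib_right sum.distrib sum_mult_sum_swap)
    also have "\<dots> = (\<Sum>i<?k1. v i * G ! i) + v ?k1 * m"
      using lift by (simp add: p sum_distrib_right mult.assoc)
    finally have "(\<Sum>i<?k1. v' i * G ! i) = 0" using v0 by simp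
    then obtain t where t: "\<And>i. i < ?k1 \<Longrightarrow> v' i = (\<Sum>j<?k2. t j * C ! j ! i)"
      using relations_exactD[OF J1, of v'] by auto
    show "\<exists>t. \<forall>k<Suc ?k1. v k = (\<Sum>j<?k2 + ?q1. t j * ?C ! j ! k)"
    proof (intro exI allI impI)
      let ?t = "\<lambda>j. if j < ?k2 then t j else p (j - ?k2)"
      fix i assume "i < Suc ?k1"
      then consider "i < ?k1" | "i = ?k1" by linarith
      then show "v i = (\<Sum>j<?k2 + ?q1. ?t j * ?C ! j ! i)"
      proof cases
        case 1
        have "v i = (\<Sum>j<?k2. t j * C ! j ! i) - (\<Sum>k<?q1. p k * a ! k ! i)"
          using t 1 by (simp add: v'_def eq_diff_eq)
        then show ?thesis by (simp only: sC[OF 1]) simp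
      next
        case 2 then show ?thesis by (simp only: sC') (simp add: p)
      qed
    qed
  qed
  moreover have "relations_exact (Suc ?k1) (?k2 + ?q1) (?k3 + ?q2) (\<lambda>j i. ?C ! j ! i) (\<lambda>l j. ?B ! l ! j)"
    unfolding relations_exact_def
  proof (intro conjI allI impI)
    fix j i assume j: "j < ?k3 + ?q2" and i: "i < Suc ?k1"
    then consider "i < ?k1" | "i = ?k1" by linarith
    then show "(\<Sum>k<?k2+?q1. ?B ! j ! k * ?C ! k ! i) = 0"
    proof cases
      case 1
      show ?thesis
      proof (cases "j < ?k3")
        case True
        then have "(\<Sum>k<?k2. B ! j ! k * C ! k ! i) = 0"
          using J2 1 by (simp add: relations_exact_def)
        then show ?thesis using True by (simp only: sC[OF 1]) (simp add: B1 B2)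
      next
        case False
        then obtain l where l: "j = ?k3 + l" "l < ?q2" using j
          by (metis add_less_cancel_left le_add_diff_inverse not_less)
        show ?thesis using l lift2 1 by (simp only: sC[OF 1]) (simp add: B3 B4)
      qed
    next
      case 2
      show ?thesis
      proof (cases "j < ?k3")
        case True
        then show ?thesis using 2 by (simp only: sC') (simp add: B2)
      next
        case False
        then obtain l where l: "j = ?k3 + l" "l < ?q2" using j
          by (metis add_less_cancel_left le_add_diff_inverse not_less)
        then have "(\<Sum>k<?q1. R ! l ! k * H ! k) = 0"
          using Q1 by (simp add: relations_exact_def)
        then show ?thesis using l 2 by (simp only: sC') (simp add: B4)
      qed
    qed
  next
    fix t assume t0: "\<forall>i<Suc ?k1. (\<Sum>k<?k2+?q1. t k * ?C ! k ! i) = 0"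
    have "(\<Sum>k<?q1. t (?k2 + k) * H ! k) = 0"
      using t0[rule_format, OF lessI] unfolding sC' .
    then obtain s where s: "\<And>k. k < ?q1 \<Longrightarrow> t (?k2 + k) = (\<Sum>l<?q2. s l * R ! l ! k)"
      using relations_exactD[OF Q1, of "\<lambda>k. t (?k2 + k)"] by auto
    \<comment> \<open>The entries of \<open>t\<close> on the new relations are combined from
      \<open>R\<close>. Subtracting the same combination of \<open>w\<close> from the old entries
      leaves a syzygy of \<open>C\<close>.\<close>
    define t' where "t' j = t j - (\<Sum>l<?q2. s l * w ! l ! j)" for j
    have "(\<Sum>j<?k2. t' j * C ! j ! i) = 0" if i: "i < ?k1" for i
    proof -
      have "(\<Sum>j<?k2. t j * C ! j ! i) = (\<Sum>k<?q1. t (?k2 + k) * a ! k ! i)"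
        using t0[rule_format, of i] i by (simp add: sC)
      also have "\<dots> = (\<Sum>l<?q2. s l * (\<Sum>k<?q1. R ! l ! k * a ! k ! i))"
        using s by (simp add: sum_mult_sum_swap)
      also have "\<dots> = (\<Sum>l<?q2. s l * (\<Sum>j<?k2. w ! l ! j * C ! j ! i))"
        using lift2 i by simp
      finally show ?thesis by (simp add: t'_def left_diff_distrib sum_subtractf sum_mult_sum_swap)
    qed
    then obtain u where u: "\<And>j. j < ?k2 \<Longrightarrow> t' j = (\<Sum>l<?k3. u l * B ! l ! j)"
      using relations_exactD[OF J2, of t'] by blast
    show "\<exists>u. \<forall>k<?k2+?q1. t k = (\<Sum>j<?k3+?q2. u j * ?B ! j ! k)"
    proof (intro exI allI impI)
      let ?u = "\<lambda>j. if j < ?k3 then u j else s (j - ?k3)"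
      fix i assume i: "i < ?k2 + ?q1"
      show "t i = (\<Sum>j<?k3+?q2. ?u j * ?B ! j ! i)"
      proof (cases "i < ?k2")
        case True
        have "t i = (\<Sum>l<?k3. u l * B ! l ! i) + (\<Sum>l<?q2. s l * w ! l ! i)"
          unfolding u[OF True, symmetric] by (simp add: t'_def)
        then show ?thesis by (simp only: sB[OF True]) simp
      next
        case False
        then obtain k where k: "i = ?k2 + k" "k < ?q1" using i
          by (metis add_less_cancel_left le_add_diff_inverse not_less)
        show ?thesis using s k by (simp only: k(1) sB'[OF k(2)]) simp
      qed
    qed
  qed
  moreover have "relations_exact (?k2 + ?q1) (?k3 + ?q2) 0 (\<lambda>l j. ?B ! l ! j) (\<lambda>_ _. 0)"
    unfolding relations_exact_def
  proof (intro conjI allI impI)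
    fix t assume t0: "\<forall>i<?k2+?q1. (\<Sum>k<?k3+?q2. t k * ?B ! k ! i) = 0"
    have *: "(\<Sum>l<?q2. t (?k3 + l) * R ! l ! i) = 0" if "i < ?q1" for i
      using t0[rule_format, of "?k2 + i"] that by (simp add: sB')
    have s: "t (?k3 + l) = 0" if "l < ?q2" for l
      using relations_exact_inj[OF Q2, of "\<lambda>l. t (?k3 + l)"] * that by blast
    have *: "(\<Sum>l<?k3. t l * B ! l ! i) = 0" if "i < ?k2" for i
      using t0[rule_format, of i] that s by (simp add: sB)
    have u: "t l = 0" if "l < ?k3" for l
      using relations_exact_inj[OF J3, of t] * that by blast
    have "t k = 0" if "k < ?k3 + ?q2" for k
      using u[of k] s[of "k - ?k3"] that by (cases "k < ?k3") auto
    then show "\<exists>ta. \<forall>k<?k3+?q2. t k = (\<Sum>j<0. ta j * 0)" by simp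
  qed simp
  moreover have "\<forall>c\<in>set ?C. length c = length ?G" "\<forall>b\<in>set ?B. length b = length ?C"
    using lC lB lR la lw by (auto simp: in_set_zip)
  ultimately show ?thesis
    unfolding list_resolution_def lC' lB' by (simp only: length_append_singleton)
qed

lemma list_resolution_single:
  fixes u :: "'a::comm_ring_1"
  assumes "\<And>r. r * u = 0 \<Longrightarrow> r = 0"
  shows "list_resolution [u] [] []"
  using assms by (auto simp: list_resolution_def relations_exact_def)

text \<open>The hypothesis \<open>uv\<close> says that \<open>v\<close> is a nonzerodivisor modulo
  \<open>u\<close>; the resolution is the Koszul complex.\<close>

lemma list_resolution_koszul:
  fixes u v :: "'a::comm_ring_1"
  assumes u: "\<And>r. r * u = 0 \<Longrightarrow> r = 0" and uv: "\<And>r s. r * v = s * u \<Longrightarrow>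
      \<exists>t. r = t * u"
  shows "list_resolution [u, v] [[v, - u]] []"
proof -
  have "\<exists>t. \<forall>k<2. x k = t 0 * [v, - u] ! k" if "x 0 * u + x 1 * v = 0" for x :: "nat \<Rightarrow> 'a"
  proof -
    have "x 1 * v = (- x 0) * u" using that by (simp add: eq_neg_iff_add_eq_0 add.commute)
    from uv[OF this] obtain t where t: "x 1 = t * u" by blast
    then have "(x 0 + t * v) * u = 0" using that by (simp add: algebra_simps)
    then have "x 0 + t * v = 0" by (rule u)
    then have "x 0 = - t * v" by (simp add: eq_neg_iff_add_eq_0)
    then show ?thesis using t by (intro exI[of _ "\<lambda>_. - t"]) (simp add: less_2_cases_iff)
  qed
  moreover have "t = 0" if "t * v = 0" "t * - u = 0" for t :: 'a
    using u[of t] that by simp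
  ultimately show ?thesis
    by (auto simp: list_resolution_def relations_exact_def numeral_2_eq_2 All_less_Suc)
qed

text \<open>Because of the unit entry, the second syzygy \<open>b\<close> expresses relation
  \<open>jj\<close> through the others. Relation \<open>jj\<close> and the row \<open>b\<close>
  cancel, the last relation \<open>c\<close> takes over the slot \<open>jj\<close>, and a multiple
  of \<open>b\<close> is subtracted from every other row to clear its entry at
  \<open>jj\<close>.\<close>

lemma list_resolution_prune:
  fixes C :: "'a::comm_ring_1 list list"
  assumes J: "list_resolution G (C @ [c]) (B @ [b])" and jj: "jj < length C" and unit: "b ! jj = 1"
  shows "list_resolution G (C[jj := c])
     (map (\<lambda>x. (map (\<lambda>j. x ! j - x ! jj * b ! j) [0..<length C])[jj := x ! length C - x ! jj * b ! length C]) B)"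
proof -
  let ?n = "length C" and ?l = "length B" and ?D = "C[jj := c]" and ?E = "C @ [c]" and ?F = "B @ [b]"
  let ?B = "map (\<lambda>x. (map (\<lambda>j. x ! j - x ! jj * b ! j) [0..<?n])[jj := x ! ?n - x ! jj * b ! ?n]) B"
  \<comment> \<open>Sends a position after the cancellation to the corresponding one before it,
    leaving out \<open>jj\<close>.\<close>
  define \<pi> where "\<pi> j = (if j = jj then ?n else j)" for j
  have D: "?D ! j = ?E ! \<pi> j" if "j < ?n" for j
    using that by (auto simp: \<pi>_def nth_append)
  have B: "?B ! l ! j = ?F ! l ! \<pi> j - ?F ! l ! jj * b ! \<pi> j" if "l < ?l" "j < ?n" for l j
    using that by (auto simp: \<pi>_def nth_append)
  have bij: "bij_betw \<pi> {..<?n} ({..<Suc ?n} - {jj})"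
    using jj by (intro bij_betw_byWitness[where f' = "\<lambda>j. if j = ?n then jj else j"]) (auto simp: \<pi>_def)
  have sum_\<pi>: "(\<Sum>k<Suc ?n. f k) = (\<Sum>j<?n. f (\<pi> j)) + f jj" for f :: "nat \<Rightarrow> 'a"
  proof -
    have "(\<Sum>j<?n. f (\<pi> j)) = sum f ({..<Suc ?n} - {jj})"
      by (rule sum.reindex_bij_betw[OF bij])
    then show ?thesis using jj by (simp add: sum.remove[of "{..<Suc ?n}" jj] add.commute del: sum.lessThan_Suc)
  qed
  have len: "\<forall>x\<in>set ?E. length x = length G" 
    and J1: "relations_exact 1 (length G) (Suc ?n) (\<lambda>i _. G ! i) (\<lambda>j i. ?E ! j ! i)"
    and J2: "relations_exact (length G) (Suc ?n) (Suc ?l) (\<lambda>j i. ?E ! j ! i) (\<lambda>l j. ?F ! l ! j)"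
    and J3: "relations_exact (Suc ?n) (Suc ?l) 0 (\<lambda>l j. ?F ! l ! j) (\<lambda>_ _. 0)"
    using J by (simp_all add: list_resolution_def)
  have Fb: "?F ! ?l = b" by simp
  have rel_b: "(\<Sum>j<?n. b ! \<pi> j * ?E ! \<pi> j ! i) = - ?E ! jj ! i" if "i < length G" for i
    using relations_exact_zero[OF J2, of ?l i] that unfolding sum_\<pi> Fb
    by (simp add: unit eq_neg_iff_add_eq_0)
  have "relations_exact 1 (length G) ?n (\<lambda>i _. G ! i) (\<lambda>j i. ?D ! j ! i)"
    unfolding relations_exact_def
  proof (intro conjI allI impI)
    fix j i assume j: "j < ?n" and "i < (1::nat)"
    have "\<pi> j < Suc ?n" using j by (simp add: \<pi>_def)
    from relations_exact_zero[OF J1 this, of 0]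
    show "(\<Sum>k<length G. ?D ! j ! k * G ! k) = 0" using j by (simp add: D)
  next
    fix v assume "\<forall>i<(1::nat). (\<Sum>k<length G. v k * G ! k) = 0"
    then obtain t where t: "\<And>k. k < length G \<Longrightarrow> v k = (\<Sum>j<Suc ?n. t j * ?E ! j ! k)"
      using relations_exactD[OF J1, of v] by meson
    show "\<exists>t. \<forall>k<length G. v k = (\<Sum>j<?n. t j * ?D ! j ! k)"
    proof (intro exI allI impI)
      fix k assume k: "k < length G"
      have "(\<Sum>j<?n. (t (\<pi> j) - t jj * b ! \<pi> j) * ?D ! j ! k) =
        (\<Sum>j<?n. t (\<pi> j) * ?E ! \<pi> j ! k) - t jj * (\<Sum>j<?n. b ! \<pi> j * ?E ! \<pi> j ! k)"
        by (simp add: D left_diff_distrib sum_subtractf sum_distrib_left mult.assoc)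
      also have "\<dots> = v k" using t[OF k] unfolding sum_\<pi> rel_b[OF k] by simp
      finally show "v k = (\<Sum>j<?n. (t (\<pi> j) - t jj * b ! \<pi> j) * ?D ! j ! k)" ..
    qed
  qed
  moreover have "relations_exact (length G) ?n ?l (\<lambda>j i. ?D ! j ! i) (\<lambda>l j. ?B ! l ! j)"
    unfolding relations_exact_def
  proof (intro conjI allI impI)
    fix l i assume l: "l < ?l" and i: "i < length G"
    have z: "(\<Sum>j<?n. ?F ! l ! \<pi> j * ?E ! \<pi> j ! i) = - ?F ! l ! jj * ?E ! jj ! i"
      using relations_exact_zero[OF J2, of l i] l i unfolding sum_\<pi>
      by (simp add: eq_neg_iff_add_eq_0)
    have "(\<Sum>j<?n. ?B ! l ! j * ?D ! j ! i) = 
       (\<Sum>j<?n. ?F ! l ! \<pi> j * ?E ! \<pi> j ! i) - ?F ! l ! jj * (\<Sum>j<?n. b ! \<pi> j * ?E ! \<pi> j ! i)"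
      using l by (simp add: B D left_diff_distrib sum_subtractf sum_distrib_left mult.assoc del: map_append nth_map)
    then show "(\<Sum>j<?n. ?B ! l ! j * ?D ! j ! i) = 0" unfolding z rel_b[OF i] by simp
  next
    fix v assume v0: "\<forall>i<length G. (\<Sum>k<?n. v k * ?D ! k ! i) = 0"
    \<comment> \<open>The vector in the old numbering, with 0 at the cancelled position. This zero
      then determines the coefficient of \<open>b\<close>.\<close>
    define v' where "v' k = (if k = jj then 0 else if k = ?n then v jj else v k)" for k
    have v': "v' (\<pi> j) = v j" if "j < ?n" for j using that jj by (auto simp: v'_def \<pi>_def)
    have "(\<Sum>k<Suc ?n. v' k * ?E ! k ! i) = 0" if "i < length G" for i
      using v0 that unfolding sum_\<pi> by (simp add: v' D) (simp add: v'_def)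
    then obtain t where t: "\<And>k. k < Suc ?n \<Longrightarrow> v' k = (\<Sum>j<Suc ?l. t j * ?F ! j ! k)"
      using relations_exactD[OF J2, of v'] by blast
    have "(\<Sum>j<?l. t j * ?F ! j ! jj) + t ?l = 0"
      using t[of jj] jj by (simp add: v'_def unit)
    then have tl: "t ?l = - (\<Sum>j<?l. t j * ?F ! j ! jj)" by (simp add: eq_neg_iff_add_eq_0 add.commute)
    show "\<exists>t. \<forall>k<?n. v k = (\<Sum>j<?l. t j * ?B ! j ! k)"
    proof (intro exI allI impI)
      fix k assume k: "k < ?n"
      have \<pi>: "\<pi> k < Suc ?n" using k by (simp add: \<pi>_def)
      have "(\<Sum>j<?l. t j * ?B ! j ! k) = (\<Sum>j<?l. t j * ?F ! j ! \<pi> k) - (\<Sum>j<?l. t j * ?F ! j ! jj) * b ! \<pi> k"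
        using k by (simp add: B right_diff_distrib sum_subtractf sum_distrib_right mult.assoc del: map_append nth_map)
      also have "\<dots> = v' (\<pi> k)" using t[OF \<pi>] tl by simp
      finally show "v k = (\<Sum>j<?l. t j * ?B ! j ! k)" using v'[OF k] by simp
    qed
  qed
  moreover have "relations_exact ?n ?l 0 (\<lambda>l j. ?B ! l ! j) (\<lambda>_ _. 0)"
    unfolding relations_exact_def
  proof (intro conjI allI impI)
    fix t assume t0: "\<forall>i<?n. (\<Sum>k<?l. t k * ?B ! k ! i) = 0"
    define t' where "t' k = (if k < ?l then t k else - (\<Sum>j<?l. t j * ?F ! j ! jj))" for k
    have *: "(\<Sum>j<Suc ?l. t' j * ?F ! j ! i) = (\<Sum>j<?l. t j * ?F ! j ! i) - (\<Sum>j<?l. t j * ?F ! j ! jj) * b ! i" for i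
      by (simp add: t'_def)
    have "(\<Sum>j<Suc ?l. t' j * ?F ! j ! i) = 0" if i: "i < Suc ?n" for i
    proof (cases "i = jj")
      case True then show ?thesis unfolding * by (simp add: unit)
    next
      case False
      then obtain k where k: "k < ?n" "i = \<pi> k" using bij i by (auto simp: bij_betw_def)
      have "(\<Sum>j<?l. t j * ?B ! j ! k) = (\<Sum>j<?l. t j * ?F ! j ! \<pi> k) - (\<Sum>j<?l. t j * ?F ! j ! jj) * b ! \<pi> k"
        using k by (simp add: B right_diff_distrib sum_subtractf sum_distrib_right mult.assoc del: map_append nth_map)
      then show ?thesis unfolding * using t0 k by simp
    qed
    then have "t' k = 0" if "k < Suc ?l" for k
      using relations_exact_inj[OF J3, of t'] that by blast
    then have "t k = 0" if "k < ?l" for k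
      using that by (metis less_SucI t'_def)
    then show "\<exists>ta. \<forall>k<?l. t k = (\<Sum>j<0. ta j * 0)" by simp
  qed simp
  moreover have "\<forall>x\<in>set ?D. length x = length G" using len set_update_subset_insert[of C jj c] by auto
  ultimately show ?thesis by (simp add: list_resolution_def del: map_append nth_map)
qed

section \<open>Graded polynomials\<close>

abbreviation lookup where "lookup \<equiv> Poly_Mapping.lookup"
abbreviation keys where "keys \<equiv> Poly_Mapping.keys"
abbreviation single where "single \<equiv> Poly_Mapping.single"

lemma sum_single_keys: "(\<Sum>m\<in>keys f. single m (lookup f m)) = f"
proof (rule poly_mapping_eqI)
  fix k
  have "lookup (\<Sum>m\<in>keys f. single m (lookup f m)) k = (\<Sum>m\<in>keys f. lookup f m when m = k)"
    by (simp add: lookup_sum lookup_single)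
  also have "\<dots> = lookup f k"
    by (cases "k \<in> keys f") (auto simp: when_def in_keys_iff sum.delta')
  finally show "lookup (\<Sum>m\<in>keys f. single m (lookup f m)) k = lookup f k" .
qed

lemma poly_induct [case_names zero single_add]:
  fixes f :: "'a \<Rightarrow>\<^sub>0 'b::comm_monoid_add"
  assumes "P 0" "\<And>m c f. P f \<Longrightarrow> P (single m c + f)"
  shows "P f"
proof -
  have "P (\<Sum>m\<in>A. single m (lookup f m))" if "finite A" for A
    using that by induction (auto intro: assms)
  from this[OF finite_keys, of f] show ?thesis by (simp only: sum_single_keys)
qed

lemma lookup_single_mult:
  fixes q :: "('a::cancel_comm_monoid_add) \<Rightarrow>\<^sub>0 'b::comm_semiring_0"
  shows "lookup (single m c * q) (m + s) = c * lookup q s"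
proof (induction q rule: poly_induct)
  case (single_add k d q)
  then show ?case
    by (simp add: distrib_left mult_single lookup_add lookup_single when_def)
qed simp

lemma lookup_single_mult_eq_0:
  fixes q :: "('a::comm_monoid_add) \<Rightarrow>\<^sub>0 'b::comm_semiring_0"
  assumes "\<And>s. t \<noteq> m + s"
  shows "lookup (single m c * q) t = 0"
proof (induction q rule: poly_induct)
  case (single_add k d q)
  then show ?case using assms[of k]
    by (simp add: distrib_left mult_single lookup_add lookup_single when_def)
qed simp

lemma single_mult_cancel:
  fixes q :: "('a::cancel_comm_monoid_add) \<Rightarrow>\<^sub>0 'b::comm_semiring_1"
  assumes "single m 1 * q = 0" shows "q = 0"
proof (rule poly_mapping_eqI)
  fix s show "lookup q s = lookup 0 s" using lookup_single_mult[of m 1 q s] assms by simp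
qed

lemma mdeg_add: "mdeg (s + t) = mdeg s + mdeg t"
  by (simp add: mdeg_def lookup_add sum.distrib)

lemma mdeg_0 [simp]: "mdeg 0 = 0"
  by (simp add: mdeg_def)

text \<open>The component of degree \<open>d\<close>,
    with integer degrees so that it vanishes for \<open>d < 0\<close>.\<close>

lift_definition degree_part :: "int \<Rightarrow> ('v::finite, 'k::zero) mpol \<Rightarrow> ('v, 'k) mpol" is
  "\<lambda>d f m. if int (mdeg m) = d then f m else 0"
  by (auto elim: rev_finite_subset)

lemma lookup_degree_part: "lookup (degree_part d f) m = (if int (mdeg m) = d then lookup f m else 0)"
  by transfer simp

lemma degree_part_0 [simp]: "degree_part d 0 = 0"
  by (rule poly_mapping_eqI) (simp add: lookup_degree_part)

lemma degree_part_add: "degree_part d (f + g) = degree_part d f + degree_part d g"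
  for f g :: "('v::finite, 'k::comm_monoid_add) mpol"
  by (rule poly_mapping_eqI) (simp add: lookup_degree_part lookup_add)

lemma degree_part_uminus: "degree_part d (- f) = - degree_part d f"
  for f :: "('v::finite, 'k::ab_group_add) mpol"
  by (rule poly_mapping_eqI) (simp add: lookup_degree_part)

lemma degree_part_diff: "degree_part d (f - g) = degree_part d f - degree_part d g"
  for f g :: "('v::finite, 'k::ab_group_add) mpol"
  by (rule poly_mapping_eqI) (simp add: lookup_degree_part lookup_minus)

lemma degree_part_sum: "degree_part d (sum f A) = (\<Sum>x\<in>A. degree_part d (f x))"
  for f :: "_ \<Rightarrow> ('v::finite, 'k::comm_monoid_add) mpol"
  by (rule poly_mapping_eqI) (simp add: lookup_degree_part lookup_sum)

lemma degree_part_single: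
  "degree_part d (single m c) = (if int (mdeg m) = d then single m c else 0)"
  by (rule poly_mapping_eqI) (auto simp: lookup_degree_part lookup_single when_def)

lemma degree_part_neg: "d < 0 \<Longrightarrow> degree_part d f = 0"
  by (rule poly_mapping_eqI) (auto simp: lookup_degree_part)

lemma homogeneous_degree_part [simp]: "homogeneous d (degree_part d f)"
  by (auto simp: homogeneous_def in_keys_iff lookup_degree_part split: if_splits)

lemma degree_part_homogeneous: "homogeneous d f \<Longrightarrow> degree_part e f = (if e = d then f else 0)"
  by (rule poly_mapping_eqI) (auto simp: lookup_degree_part homogeneous_def in_keys_iff)

lemma homogeneous_degree_part_id: "homogeneous d f \<longleftrightarrow> degree_part d f = f"
  using degree_part_homogeneous homogeneous_degree_part by metis

lemma homogeneous_0 [simp]: "homogeneous d 0"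
  by (simp add: homogeneous_def)

lemma homogeneous_diff: "homogeneous d f \<Longrightarrow> homogeneous d g \<Longrightarrow> homogeneous d (f - g)"
  for f g :: "('v::finite, 'k::ab_group_add) mpol"
  by (simp add: homogeneous_degree_part_id degree_part_diff)

lemma homogeneous_uminus: "homogeneous d f \<Longrightarrow> homogeneous d (- f)"
  for f :: "('v::finite, 'k::ab_group_add) mpol"
  by (simp add: homogeneous_degree_part_id degree_part_uminus)

lemma homogeneous_single: "int (mdeg m) = d \<Longrightarrow> homogeneous d (single m c)"
  by (simp add: homogeneous_degree_part_id degree_part_single)

lemma degree_part_single_mult:
  fixes f :: "('v::finite, 'k::comm_ring_1) mpol"
  shows "degree_part d (single m c * f) = single m c * degree_part (d - int (mdeg m)) f"
  by (induction f rule: poly_induct)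
    (auto simp: distrib_left mult_single degree_part_add degree_part_single mdeg_add)

lemma degree_part_mult_homogeneous:
  fixes f g :: "('v::finite, 'k::comm_ring_1) mpol"
  assumes "homogeneous e g"
  shows "degree_part d (f * g) = degree_part (d - e) f * g"
proof -
  have "degree_part d ((\<Sum>m\<in>keys g. single m (lookup g m)) * f) = (\<Sum>m\<in>keys g. single m (lookup g m)) * degree_part (d - e) f"
    using assms by (simp add: sum_distrib_right degree_part_sum degree_part_single_mult homogeneous_def)
  then show ?thesis by (simp only: sum_single_keys mult.commute)
qed

lemma homogeneous_mult:
  fixes f g :: "('v::finite, 'k::comm_ring_1) mpol"
  assumes "homogeneous d f" "homogeneous e g"
  shows "homogeneous (d + e) (f * g)"
  using assms by (simp add: homogeneous_degree_part_id degree_part_mult_homogeneous[OF assms(2)])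

text \<open>Stated for all large \<open>D\<close> and with a shift \<open>c\<close>, so that the
  coordinates of a vector, each with its own shift, can be summed over one common interval of
  degrees.\<close>

lemma degree_part_decomposition:
  fixes f :: "('v::finite, 'k::comm_monoid_add) mpol"
  shows "\<exists>N. \<forall>D\<ge>N. (\<Sum>d\<in>{-D..D}. degree_part (d - c) f) = f"
proof (intro exI allI impI)
  fix D :: int
  assume "(\<Sum>m\<in>keys f. \<bar>int (mdeg m) + c\<bar>) \<le> D"
  then have le: "\<bar>int (mdeg m) + c\<bar> \<le> D" if "m \<in> keys f" for m
    using member_le_sum[OF that, of "\<lambda>m. \<bar>int (mdeg m) + c\<bar>"] by simp
  show "(\<Sum>d\<in>{-D..D}. degree_part (d - c) f) = f"
  proof (rule poly_mapping_eqI)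
    fix m
    show "lookup (\<Sum>d\<in>{-D..D}. degree_part (d - c) f) m = lookup f m"
    proof (cases "m \<in> keys f")
      case True
      have "lookup (\<Sum>d\<in>{-D..D}. degree_part (d - c) f) m = 
          (\<Sum>d\<in>{-D..D}. if d = int (mdeg m) + c then lookup f m else 0)"
        unfolding lookup_sum by (rule sum.cong) (auto simp: lookup_degree_part)
      then show ?thesis using le[OF True] by (simp add: sum.delta abs_le_iff)
    next
      case False
      then have "lookup (degree_part (d - c) f) m = 0" for d
        by (simp add: lookup_degree_part in_keys_iff)
      then show ?thesis using False by (simp add: lookup_sum in_keys_iff)
    qed
  qed
qed

section \<open>Lifting relations modulo a regular element\<close>

text \<open>In other words, \<open>z\<close> is a nonzerodivisor on the cokernel, that is on A^r
  modulo the span of the rows of \<open>M\<close>.\<close>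

definition saturated :: "'a::comm_ring_1 \<Rightarrow> nat \<Rightarrow> nat \<Rightarrow> (nat \<Rightarrow> nat \<Rightarrow> 'a) \<Rightarrow> bool" where
  "saturated z r n M \<longleftrightarrow>
      (\<forall>y v. (\<forall>i<r. z * y i = (\<Sum>k<n. v k * M k i)) \<longrightarrow>
      (\<exists>u. \<forall>i<r. y i = (\<Sum>k<n. u k * M k i)))"

lemma saturatedD:
  assumes "saturated z r n M" "\<And>i. i < r \<Longrightarrow> z * y i = (\<Sum>k<n. v k * M k i)"
  shows "\<exists>u. \<forall>i<r. y i = (\<Sum>k<n. u k * M k i)"
  using assms unfolding saturated_def by blast

text \<open>By exactness the cokernel of \<open>N\<close> embeds through \<open>M\<close> into a
  free module, where \<open>z\<close> is a nonzerodivisor.\<close>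

lemma relations_exact_imp_saturated:
  assumes ex: "relations_exact r n l M N" and z: "\<And>f. z * f = 0 \<Longrightarrow> f = 0"
  shows "saturated z n l N"
  unfolding saturated_def
proof (intro allI impI)
  fix y t assume y: "\<forall>k<n. z * y k = (\<Sum>j<l. t j * N j k)"
  have "(\<Sum>k<n. y k * M k i) = 0" if "i < r" for i
  proof (rule z)
    have "z * (\<Sum>k<n. y k * M k i) = (\<Sum>k<n. (\<Sum>j<l. t j * N j k) * M k i)"
      using y by (simp add: sum_distrib_left flip: mult.assoc)
    then show "z * (\<Sum>k<n. y k * M k i) = 0"
      using that by (simp add: sum_mult_sum_swap relations_exact_zero[OF ex])
  qed
  then show "\<exists>u. \<forall>k<n. y k = (\<Sum>j<l. u j * N j k)" by (rule relations_exactD[OF ex])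
qed

lemma degree_part_times:
  fixes z f :: "('v::finite, 'k::comm_ring_1) mpol"
  assumes "homogeneous 1 z"
  shows "degree_part d (z * f) = z * degree_part (d - 1) f"
  using degree_part_mult_homogeneous[OF assms, of d f] by (simp add: mult.commute)

text \<open>Graded lifting along a regular element: if \<open>M'\<close> agrees with
  \<open>M\<close> modulo \<open>z\<close>, it has relations agreeing with \<open>N\<close> modulo
  \<open>z\<close>. Saturation allows division by \<open>z\<close>, and induction on the degree
  shows that the lifted relations still generate.\<close>

lemma relations_exact_lift:
  fixes M M' N :: "nat \<Rightarrow> nat \<Rightarrow> ('v::finite, 'k::comm_ring_1) mpol"
  assumes z: "\<And>f. z * f = 0 \<Longrightarrow> f = 0" and z1: "homogeneous 1 z"
    and ex: "relations_exact r n l M N"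
    and hM': "\<And>k i. k < n \<Longrightarrow> i < r \<Longrightarrow> homogeneous (dn k - dr i) (M' k i)"
    and hN: "\<And>j k. j < l \<Longrightarrow> k < n \<Longrightarrow> homogeneous (dl j - dn k) (N j k)"
    and cong: "\<And>k i. k < n \<Longrightarrow> i < r \<Longrightarrow> M' k i = M k i + z * P k i"
    and sM: "saturated z r n M" and sM': "saturated z r n M'"
  shows "\<exists>N' Q. (\<forall>j<l. \<forall>k<n. homogeneous (dl j - dn k) (N' j k) \<and> N' j k = N j k + z * Q j k) \<and>
     relations_exact r n l M' N'"
proof -
  have dM': "degree_part d (f * M' k i) = degree_part (d - (dn k - dr i)) f * M' k i" if "k < n" "i < r" for d f k i
    using degree_part_mult_homogeneous[OF hM'[OF that]] .
  have "\<exists>u. (\<forall>k<n. homogeneous (dl j - 1 - dn k) (u k)) \<and>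
      (\<forall>i<r. (\<Sum>k<n. N j k * M' k i) = (\<Sum>k<n. z * u k * M' k i))" if j: "j < l" for j
  proof -
    \<comment> \<open>The relations \<open>N\<close> hold for \<open>M'\<close> up to
      \<open>z\<close> times \<open>N P\<close>. By saturation \<open>N P\<close> lies in the span
      of the rows of \<open>M'\<close>, which yields the correction \<open>u\<close>.\<close>
    have *: "(\<Sum>k<n. N j k * M' k i) = z * (\<Sum>k<n. N j k * P k i)" if "i < r" for i
    proof -
      have "(\<Sum>k<n. N j k * M' k i) = (\<Sum>k<n. N j k * M k i) + (\<Sum>k<n. N j k * (z * P k i))"
        using that by (simp add: cong distrib_left sum.distrib)
      then show ?thesis using relations_exact_zero[OF ex j that]
        by (simp add: sum_distrib_left mult.left_commute)
    qed
    then have "z * (\<Sum>k<n. N j k * P k i) = (\<Sum>k<n. N j k * M' k i)" if "i < r" for i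
      using that by simp
    from saturatedD[OF sM' this]
    obtain u where u: "\<And>i. i < r \<Longrightarrow> (\<Sum>k<n. N j k * P k i) = (\<Sum>k<n. u k * M' k i)" by blast
    \<comment> \<open>Only the homogeneous part of the correction is kept, in degree one less than
      the entry of \<open>N\<close> that it corrects, because \<open>z\<close> has degree
      one.\<close>
    have "(\<Sum>k<n. N j k * M' k i) = (\<Sum>k<n. z * degree_part (dl j - 1 - dn k) (u k) * M' k i)" if i: "i < r" for i
    proof -
      let ?D = "dl j - dr i"
      have "(\<Sum>k<n. N j k * M' k i) = (\<Sum>k<n. degree_part (?D - (dn k - dr i)) (N j k) * M' k i)"
        using degree_part_homogeneous[OF hN[OF j]] by (intro sum.cong) auto
      also have "\<dots> = degree_part ?D (\<Sum>k<n. N j k * M' k i)"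
        using i by (simp add: degree_part_sum dM')
      also have "\<dots> = degree_part ?D (\<Sum>k<n. z * u k * M' k i)"
        using *[OF i] u[OF i] by (simp add: sum_distrib_left mult.assoc)
      also have "\<dots> = (\<Sum>k<n. z * degree_part (dl j - 1 - dn k) (u k) * M' k i)"
        using i by (simp add: degree_part_sum dM' degree_part_times[OF z1]) (simp add: algebra_simps)
      finally show ?thesis .
    qed
    then show ?thesis by (intro exI[of _ "\<lambda>k. degree_part (dl j - 1 - dn k) (u k)"]) auto
  qed
  then have "\<forall>j. \<exists>u. j < l \<longrightarrow> (\<forall>k<n. homogeneous (dl j - 1 - dn k) (u k)) \<and>
      (\<forall>i<r. (\<Sum>k<n. N j k * M' k i) = (\<Sum>k<n. z * u k * M' k i))" by blast
  from choice[OF this] obtain u where u: "\<And>j k. j < l \<Longrightarrow> k < n \<Longrightarrow>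
      homogeneous (dl j - 1 - dn k) (u j k)"
    and u': "\<And>j i. j < l \<Longrightarrow> i < r \<Longrightarrow>
        (\<Sum>k<n. N j k * M' k i) = (\<Sum>k<n. z * u j k * M' k i)"
    by blast
  define N' where "N' j k = N j k - z * u j k" for j k
  have hN': "homogeneous (dl j - dn k) (N' j k)" if "j < l" "k < n" for j k
    using homogeneous_mult[OF z1 u[OF that]] hN[OF that] unfolding N'_def
    by (intro homogeneous_diff) simp_all
  have zero: "(\<Sum>k<n. N' j k * M' k i) = 0" if "j < l" "i < r" for i j
    using u'[OF that] by (simp add: N'_def left_diff_distrib sum_subtractf)
  \<comment> \<open>In total degree below \<open>dmin\<close> every homogeneous vector is zero,
    which starts the induction.\<close>
  obtain dmin where dmin: "\<And>k. k < n \<Longrightarrow> dmin \<le> dn k"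
  proof
    show "Min (insert 0 (dn ` {..<n})) \<le> dn k" if "k < n" for k
      using that by (intro Min_le) auto
  qed
  have graded: "\<exists>t. \<forall>k<n. v k = (\<Sum>j<l. t j * N' j k)"
    if "D < dmin + int m" "\<And>k. k < n \<Longrightarrow>
        homogeneous (D - dn k) (v k)" "\<And>i. i < r \<Longrightarrow> (\<Sum>k<n. v k * M' k i) = 0"
    for D m v
    using that
  proof (induction m arbitrary: D v)
    case 0
    have "v k = 0" if "k < n" for k
      using 0(1) 0(2)[OF that] dmin[OF that] degree_part_neg[of "D - dn k" "v k"]
      by (simp add: homogeneous_degree_part_id)
    then show ?case by (intro exI[of _ "\<lambda>_. 0"]) simp
  next
    case (Suc m)
    have "z * (- (\<Sum>k<n. v k * P k i)) = (\<Sum>k<n. v k * M k i)" if "i < r" for i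
    proof -
      have "(\<Sum>k<n. v k * M k i) + z * (\<Sum>k<n. v k * P k i) = 0"
        using Suc(4)[OF that] cong[OF _ that] by (simp add: distrib_left sum.distrib sum_distrib_left mult.left_commute)
      then show ?thesis by (simp add: eq_neg_iff_add_eq_0 add.commute neg_eq_iff_add_eq_0)
    qed
    note 1 = this
    from saturatedD[OF sM 1] obtain w where w: "\<And>i. i < r \<Longrightarrow>
        - (\<Sum>k<n. v k * P k i) = (\<Sum>k<n. w k * M k i)" by blast
    have "(\<Sum>k<n. (v k - z * w k) * M k i) = 0" if "i < r" for i
      using 1[OF that] unfolding w[OF that] 
      by (simp add: left_diff_distrib sum_subtractf sum_distrib_left mult.assoc)
    from relations_exactD[OF ex this]
    obtain t where t: "\<And>k. k < n \<Longrightarrow> v k - z * w k = (\<Sum>j<l. t j * N j k)" by blast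
    \<comment> \<open>Modulo \<open>z\<close> the vector \<open>v\<close> is a combination of
      \<open>N\<close>. Writing \<open>N\<close> as \<open>N'\<close> plus \<open>z\<close> times
      \<open>u\<close> collects the remainder in \<open>z\<close> times \<open>v'\<close>. As
      \<open>z\<close> is regular, the part of \<open>v'\<close> in degree \<open>D - 1\<close> is
      again a relation of \<open>M'\<close>.\<close>
    define v' where "v' k = w k + (\<Sum>j<l. t j * u j k)" for k
    have v: "v k = z * v' k + (\<Sum>j<l. t j * N' j k)" if "k < n" for k
      using t[OF that] by (simp add: v'_def N'_def right_diff_distrib sum_subtractf distrib_left sum_distrib_left mult.left_commute diff_eq_eq)
    define w' where "w' k = degree_part (D - 1 - dn k) (v' k)" for k
    define s where "s j = degree_part (D - dl j) (t j)" for j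
    have v2: "v k = z * w' k + (\<Sum>j<l. s j * N' j k)" if k: "k < n" for k
    proof -
      have "v k = degree_part (D - dn k) (v k)" using Suc(3)[OF k] by (simp add: homogeneous_degree_part_id)
      also have "\<dots> = z * w' k + (\<Sum>j<l. s j * N' j k)"
        unfolding v[OF k] using degree_part_mult_homogeneous[OF hN'[OF _ k]]
        by (simp add: degree_part_add degree_part_times[OF z1] degree_part_sum w'_def s_def) (simp add: algebra_simps)
      finally show ?thesis .
    qed
    have "(\<Sum>k<n. w' k * M' k i) = 0" if i: "i < r" for i
    proof (rule z)
      have "0 = (\<Sum>k<n. (z * w' k + (\<Sum>j<l. s j * N' j k)) * M' k i)"
        using Suc(4)[OF i] v2 by simp
      also have "\<dots> = z * (\<Sum>k<n. w' k * M' k i) + (\<Sum>j<l. s j * (\<Sum>k<n. N' j k * M' k i))"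
        by (simp add: distrib_right sum.distrib sum_mult_sum_swap sum_distrib_left mult.assoc)
      finally show "z * (\<Sum>k<n. w' k * M' k i) = 0" using zero[OF _ i] by simp
    qed
    moreover have "homogeneous (D - 1 - dn k) (w' k)" for k by (simp add: w'_def)
    ultimately obtain t' where t': "\<And>k. k < n \<Longrightarrow> w' k = (\<Sum>j<l. t' j * N' j k)"
      using Suc.IH[of "D - 1" w'] Suc(2) by auto
    have "v k = (\<Sum>j<l. (z * t' j + s j) * N' j k)" if "k < n" for k
      using v2[OF that] t'[OF that] by (simp add: distrib_right sum.distrib sum_distrib_left mult.assoc)
    then show ?case by (intro exI[of _ "\<lambda>j. z * t' j + s j"]) simp
  qed
  have "relations_exact r n l M' N'"
    unfolding relations_exact_def
  proof (intro conjI allI impI)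
    fix v assume v: "\<forall>i<r. (\<Sum>k<n. v k * M' k i) = 0"
    define part where "part D k = degree_part (D - dn k) (v k)" for D k
    have "\<exists>t. \<forall>k<n. part D k = (\<Sum>j<l. t j * N' j k)" for D
    proof (rule graded)
      show "D < dmin + int (nat (D - dmin + 1))" by simp
      show "homogeneous (D - dn k) (part D k)" for k by (simp add: part_def)
      show "(\<Sum>k<n. part D k * M' k i) = 0" if i: "i < r" for i
      proof -
        have "(\<Sum>k<n. part D k * M' k i) = (\<Sum>k<n. degree_part (D - dr i) (v k * M' k i))"
          using i by (intro sum.cong) (simp_all add: part_def dM')
        then show ?thesis using v i by (simp flip: degree_part_sum)
      qed
    qed
    then obtain t where t: "\<And>D k. k < n \<Longrightarrow> part D k = (\<Sum>j<l. t D j * N' j k)" by metis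
    have "\<forall>k. \<exists>K. \<forall>D\<ge>K. (\<Sum>d\<in>{-D..D}. part d k) = v k"
      unfolding part_def using degree_part_decomposition by blast
    then obtain K where K: "\<And>k D. K k \<le> D \<Longrightarrow> (\<Sum>d\<in>{-D..D}. part d k) = v k" by metis
    \<comment> \<open>Each coordinate has its own range of degrees; \<open>D\<close> covers them
      all.\<close>
    define D where "D = Max (insert 0 (K ` {..<n}))"
    have "v k = (\<Sum>j<l. (\<Sum>d\<in>{-D..D}. t d j) * N' j k)" if "k < n" for k
    proof -
      have "K k \<le> D" unfolding D_def using that by (intro Max_ge) auto
      then have "v k = (\<Sum>d\<in>{-D..D}. \<Sum>j<l. t d j * N' j k)" using K[of k D] by (simp add: t[OF that])
      also have "\<dots> = (\<Sum>j<l. (\<Sum>d\<in>{-D..D}. t d j) * N' j k)"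
        by (subst sum.swap) (simp add: sum_distrib_right)
      finally show ?thesis .
    qed
    then show "\<exists>t. \<forall>k<n. v k = (\<Sum>j<l. t j * N' j k)"
      by (intro exI[of _ "\<lambda>j. \<Sum>d\<in>{-D..D}. t d j"]) simp
  qed (use zero in auto)
  then show ?thesis using hN' by - (rule exI[of _ N'], rule exI[of _ "\<lambda>j k. - u j k"], simp add: N'_def)
qed

section \<open>Quotients of polynomial rings and Betti sequences\<close>

lemma mpol_ring_simps [simp]:
  "carrier (mpol_ring :: ('v, 'k::comm_ring_1) mpol ring) = UNIV"
  "\<zero>\<^bsub>(mpol_ring :: ('v, 'k) mpol ring)\<^esub> = 0" "\<one>\<^bsub>(mpol_ring :: ('v,
      'k) mpol ring)\<^esub> = 1"
  "f \<oplus>\<^bsub>(mpol_ring :: ('v, 'k) mpol ring)\<^esub> g = f + g"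
  "f \<otimes>\<^bsub>(mpol_ring :: ('v, 'k) mpol ring)\<^esub> g = f * g"
  by (simp_all add: ring_of_type_algebra_def)

lemma cring_mpol_ring: "cring (mpol_ring :: ('v, 'k::comm_ring_1) mpol ring)"
  by (rule cring_from_type_algebra)

lemma ideal_mpol_ring_iff:
  fixes I :: "('v, 'k::comm_ring_1) mpol set"
  shows "ideal I mpol_ring \<longleftrightarrow>
      0 \<in> I \<and> (\<forall>f\<in>I. \<forall>g\<in>I. f + g \<in> I) \<and> (\<forall>f\<in>I. \<forall>g. g * f \<in> I)"
proof
  assume I: "ideal I mpol_ring"
  then interpret ideal I mpol_ring .
  show "0 \<in> I \<and> (\<forall>f\<in>I. \<forall>g\<in>I. f + g \<in> I) \<and> (\<forall>f\<in>I. \<forall>g. g * f \<in> I)"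
    using additive_subgroup.zero_closed[OF is_additive_subgroup] I_l_closed additive_subgroup.a_closed[OF is_additive_subgroup]
    by simp
next
  interpret cring "mpol_ring :: ('v, 'k) mpol ring" by (rule cring_mpol_ring)
  assume I: "0 \<in> I \<and> (\<forall>f\<in>I. \<forall>g\<in>I. f + g \<in> I) \<and> (\<forall>f\<in>I. \<forall>g. g * f \<in> I)"
  have inv: "\<ominus>\<^bsub>mpol_ring\<^esub> f = - f" for f :: "('v, 'k) mpol"
    by (rule minus_equality) simp_all
  show "ideal I mpol_ring"
  proof (rule idealI)
    show "subgroup I (add_monoid mpol_ring)"
    proof (rule add.subgroupI)
      show "\<ominus>\<^bsub>mpol_ring\<^esub> f \<in> I" if "f \<in> I" for f
        using I that inv[of f] by (metis mult_minus1)
    qed (use I in auto)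
  qed (use I in \<open>auto simp: mult.commute ring_from_type_algebra\<close>)
qed

lemma
  fixes I :: "('v, 'k::comm_ring_1) mpol set"
  assumes "ideal I mpol_ring"
  shows mpol_ideal_0: "0 \<in> I"
    and mpol_ideal_add: "f \<in> I \<Longrightarrow> g \<in> I \<Longrightarrow> f + g \<in> I"
    and mpol_ideal_mult: "f \<in> I \<Longrightarrow> h * f \<in> I"
    and mpol_ideal_uminus: "f \<in> I \<Longrightarrow> - f \<in> I"
    and mpol_ideal_diff: "f \<in> I \<Longrightarrow> g \<in> I \<Longrightarrow> f - g \<in> I"
proof -
  note I = assms[unfolded ideal_mpol_ring_iff]
  show "0 \<in> I" and add: "f \<in> I \<Longrightarrow> g \<in> I \<Longrightarrow>
      f + g \<in> I" and "f \<in> I \<Longrightarrow> h * f \<in> I" for f g h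
    using I by auto
  show um: "f \<in> I \<Longrightarrow> - f \<in> I" for f using I by (metis mult_minus1)
  show "f \<in> I \<Longrightarrow> g \<in> I \<Longrightarrow> f - g \<in> I" for f g using add[OF _ um,
      of f g] by simp
qed

lemma mpol_ideal_sum:
  fixes I :: "('v, 'k::comm_ring_1) mpol set"
  assumes "ideal I mpol_ring" "\<And>x. x \<in> A \<Longrightarrow> f x \<in> I"
  shows "sum f A \<in> I"
  using assms(2) by (induction A rule: infinite_finite_induct) (auto intro: mpol_ideal_0 mpol_ideal_add assms(1))

lemma mpol_coset: "I +>\<^bsub>mpol_ring\<^esub> f = {g. g - f \<in> I}" for I :: "('v, 'k::comm_ring_1) mpol set"
proof -
  have "(\<exists>h\<in>I. g = h + f) \<longleftrightarrow>
      g - f \<in> I" for g by (metis add_diff_cancel diff_add_cancel)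
  then show ?thesis by (auto simp: a_r_coset_def r_coset_def)
qed

lemma mpol_coset_eq_iff:
  fixes I :: "('v, 'k::comm_ring_1) mpol set"
  assumes "ideal I mpol_ring"
  shows "I +>\<^bsub>mpol_ring\<^esub> f = I +>\<^bsub>mpol_ring\<^esub> g \<longleftrightarrow> f - g \<in> I"
proof
  assume "I +>\<^bsub>mpol_ring\<^esub> f = I +>\<^bsub>mpol_ring\<^esub> g"
  moreover have "f \<in> I +>\<^bsub>mpol_ring\<^esub> f" using mpol_ideal_0[OF assms] by (simp add: mpol_coset)
  ultimately have "f \<in> {h. h - g \<in> I}" unfolding mpol_coset by simp
  then show "f - g \<in> I" by simp
next
  assume fg: "f - g \<in> I"
  have "h - f \<in> I \<longleftrightarrow> h - g \<in> I" for h
    using mpol_ideal_add[OF assms _ fg, of "h - f"] mpol_ideal_diff[OF assms _ fg, of "h - g"] by auto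
  then show "I +>\<^bsub>mpol_ring\<^esub> f = I +>\<^bsub>mpol_ring\<^esub> g" by (auto simp: mpol_coset)
qed

lemma
  fixes I :: "('v, 'k::comm_ring_1) mpol set"
  assumes I: "ideal I mpol_ring"
  shows mpol_coset_add: "(I +>\<^bsub>mpol_ring\<^esub> f) \<oplus>\<^bsub>mpol_ring Quot I\<^esub> (I +>\<^bsub>mpol_ring\<^esub> g) = I +>\<^bsub>mpol_ring\<^esub> (f + g)"
    and mpol_coset_mult: "(I +>\<^bsub>mpol_ring\<^esub> f) \<otimes>\<^bsub>mpol_ring Quot I\<^esub> (I +>\<^bsub>mpol_ring\<^esub> g) = I +>\<^bsub>mpol_ring\<^esub> (f * g)"
  using ring_hom_add[OF ideal.rcos_ring_hom[OF I], of f g] ring_hom_mult[OF ideal.rcos_ring_hom[OF I], of f g]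
  by simp_all

lemma carrier_mpol_quotient:
  "carrier (mpol_ring Quot I) = range (\<lambda>f. I +>\<^bsub>mpol_ring\<^esub> f)" for I :: "('v,
      'k::comm_ring_1) mpol set"
  by (auto simp: FactRing_def A_RCOSETS_def')

lemma zero_mpol_quotient:
  fixes I :: "('v, 'k::comm_ring_1) mpol set"
  shows "\<zero>\<^bsub>mpol_ring Quot I\<^esub> = I +>\<^bsub>mpol_ring\<^esub> 0"
  by (auto simp: FactRing_def mpol_coset)

text \<open>The generators are lifted into \<open>I\<close> first. An element of \<open>I\<close> is
  a combination of the lifts plus \<open>z\<close> times some \<open>h\<close>, and
  \<open>zI\<close> puts \<open>h\<close> into \<open>I\<close> in lower degree, so the lifts
  generate. Then \<open>relations_exact_lift\<close> applies at each remaining place. Its saturation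
  hypotheses hold at the first place because \<open>z\<close> is regular modulo both ideals, and
  later by exactness.\<close>

lemma resolution_lift:
  fixes I :: "('v::finite, 'k::comm_ring_1) mpol set"
  assumes I: "ideal I mpol_ring" and gr: "\<And>f d. f \<in> I \<Longrightarrow> degree_part d f \<in> I"
    and z: "\<And>f. z * f = 0 \<Longrightarrow>
        f = 0" and z1: "homogeneous 1 z" and zI: "\<And>f. z * f \<in> I \<Longrightarrow> f \<in> I"
    and res: "list_resolution G C B"
    and zJ: "\<And>f v. z * f = (\<Sum>i<length G. v i * G ! i) \<Longrightarrow>
        \<exists>u. f = (\<Sum>i<length G. u i * G ! i)"
    and hG: "\<And>i. i < length G \<Longrightarrow> homogeneous (d1 ! i) (G ! i)"
    and hC: "\<And>j i. j < length C \<Longrightarrow> i < length G \<Longrightarrow>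
        homogeneous (d2 ! j - d1 ! i) (C ! j ! i)"
    and hB: "\<And>j i. j < length B \<Longrightarrow> i < length C \<Longrightarrow>
        homogeneous (d3 ! j - d2 ! i) (B ! j ! i)"
    and GI: "\<And>i. i < length G \<Longrightarrow> \<exists>q. G ! i + z * q \<in> I"
    and IG: "\<And>f. f \<in> I \<Longrightarrow> \<exists>v q. f = (\<Sum>i<length G. v i * G ! i) + z * q"
  obtains G' C' B' P Q R where
    "\<And>i. i < length G \<Longrightarrow> homogeneous (d1 ! i) (G' i) \<and> G' i = G ! i + z * P i"
    "\<And>j i. j < length C \<Longrightarrow> i < length G \<Longrightarrow>
        homogeneous (d2 ! j - d1 ! i) (C' j i) \<and> C' j i = C ! j ! i + z * Q j i"
    "\<And>j i. j < length B \<Longrightarrow> i < length C \<Longrightarrow>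
        homogeneous (d3 ! j - d2 ! i) (B' j i) \<and> B' j i = B ! j ! i + z * R j i"
    "I = {f. \<exists>v. f = (\<Sum>i<length G. v i * G' i)}"
    "relations_exact 1 (length G) (length C) (\<lambda>i _. G' i) C'"
    "relations_exact (length G) (length C) (length B) C' B'"
    "relations_exact (length C) (length B) 0 B' (\<lambda>_ _. 0)"
proof -
  let ?k1 = "length G" and ?k2 = "length C" and ?k3 = "length B"
  have J1: "relations_exact 1 ?k1 ?k2 (\<lambda>i _. G ! i) (\<lambda>j i. C ! j ! i)"
    and J2: "relations_exact ?k1 ?k2 ?k3 (\<lambda>j i. C ! j ! i) (\<lambda>l j. B ! l ! j)"
    and J3: "relations_exact ?k2 ?k3 0 (\<lambda>l j. B ! l ! j) (\<lambda>_ _. 0)"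
    using res by (simp_all add: list_resolution_def)
  obtain q where q: "\<And>i. i < ?k1 \<Longrightarrow> G ! i + z * q i \<in> I" using GI by metis
  define P where "P i = degree_part (d1 ! i - 1) (q i)" for i
  define G' where "G' i = G ! i + z * P i" for i
  \<comment> \<open>The lift is the part of degree \<open>d1 ! i\<close> of an element of
    \<open>I\<close>, hence homogeneous, and it stays in \<open>I\<close> because \<open>I\<close>
    is graded.\<close>
  have G'_part: "G' i = degree_part (d1 ! i) (G ! i + z * q i)" if "i < ?k1" for i
    using hG[OF that] by (simp add: G'_def P_def degree_part_add degree_part_times[OF z1] homogeneous_degree_part_id)
  have hG': "homogeneous (d1 ! i) (G' i)" if "i < ?k1" for i
    unfolding G'_part[OF that] by simp
  have G'I: "G' i \<in> I" if "i < ?k1" for i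
    unfolding G'_part[OF that] by (rule gr[OF q[OF that]])
  have G'I_sum: "(\<Sum>i<?k1. v i * G' i) \<in> I" for v
    by (intro mpol_ideal_sum[OF I] mpol_ideal_mult[OF I] G'I) simp
  have gen_homogeneous: "\<exists>v. f = (\<Sum>i<?k1. v i * G' i)" if "f \<in> I" "homogeneous D f" "D < int m" for f D m
    using that
  proof (induction m arbitrary: f D)
    case 0
    then have "f = 0" using degree_part_neg[of D f] by (simp add: homogeneous_degree_part_id)
    then show ?case by (intro exI[of _ "\<lambda>_. 0"]) simp
  next
    case (Suc m)
    obtain v h where f: "f = (\<Sum>i<?k1. v i * G ! i) + z * h" using IG[OF Suc(2)] by blast
    define h' where "h' = h - (\<Sum>i<?k1. v i * P i)"
    have f': "f = (\<Sum>i<?k1. v i * G' i) + z * h'"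
      by (simp add: f G'_def h'_def distrib_left sum.distrib right_diff_distrib sum_distrib_left mult.left_commute)
    have "z * h' = f - (\<Sum>i<?k1. v i * G' i)" by (simp add: f')
    also have "\<dots> \<in> I" by (rule mpol_ideal_diff[OF I Suc(2) G'I_sum])
    finally have "h' \<in> I" by (rule zI)
    from gr[OF this] obtain w where w: "degree_part (D - 1) h' = (\<Sum>i<?k1. w i * G' i)"
      using Suc.IH[of "degree_part (D - 1) h'" "D - 1"] Suc(4) by auto
    have "f = degree_part D f" using Suc(3) by (simp add: homogeneous_degree_part_id)
    also have "\<dots> = (\<Sum>i<?k1. degree_part (D - d1 ! i) (v i) * G' i) + z * degree_part (D - 1) h'"
      unfolding f' by (simp add: degree_part_add degree_part_sum degree_part_times[OF z1] degree_part_mult_homogeneous[OF hG'])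
    also have "\<dots> = (\<Sum>i<?k1. (degree_part (D - d1 ! i) (v i) + z * w i) * G' i)"
      unfolding w by (simp add: distrib_right sum.distrib sum_distrib_left mult.assoc)
    finally show ?case by (intro exI[of _ "\<lambda>i. degree_part (D - d1 ! i) (v i) + z * w i"])
  qed
  have gen: "\<exists>v. f = (\<Sum>i<?k1. v i * G' i)" if "f \<in> I" for f
  proof -
    have "\<exists>v. degree_part D f = (\<Sum>i<?k1. v i * G' i)" for D
      by (rule gen_homogeneous[of _ D "nat (D + 1)"]) (auto intro: gr that)
    then obtain v where v: "\<And>D. degree_part D f = (\<Sum>i<?k1. v D i * G' i)" by metis
    obtain N where "(\<Sum>d\<in>{-N..N}. degree_part (d - 0) f) = f" using degree_part_decomposition[of 0 f] by blast
    then have "f = (\<Sum>d\<in>{-N..N}. \<Sum>i<?k1. v d i * G' i)" by (simp add: v)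
    also have "\<dots> = (\<Sum>i<?k1. (\<Sum>d\<in>{-N..N}. v d i) * G' i)" by (subst sum.swap) (simp add: sum_distrib_right)
    finally show ?thesis by (intro exI[of _ "\<lambda>i. \<Sum>d\<in>{-N..N}. v d i"])
  qed
  have I_eq: "I = {f. \<exists>v. f = (\<Sum>i<?k1. v i * G' i)}" using gen G'I_sum by auto
  have s1: "saturated z 1 ?k1 (\<lambda>i _. G ! i)"
    unfolding saturated_def using zJ by (simp only: One_nat_def All_less_Suc) blast
  have s1': "saturated z 1 ?k1 (\<lambda>i _. G' i)"
    unfolding saturated_def
  proof (intro allI impI)
    fix y :: "nat \<Rightarrow> ('v, 'k) mpol" and v
    assume "\<forall>i<1. z * y i = (\<Sum>k<?k1. v k * G' k)"
    then have "z * y (0::nat) \<in> I" using G'I_sum by simp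
    from gen[OF zI[OF this]] show "\<exists>u. \<forall>i<1. y i = (\<Sum>k<?k1. u k * G' k)" by simp
  qed
  have "\<exists>C' Q. (\<forall>j<?k2. \<forall>k<?k1. homogeneous (d2 ! j - d1 ! k) (C' j k) \<and> C' j k = C ! j ! k + z * Q j k) \<and>
     relations_exact 1 ?k1 ?k2 (\<lambda>i _. G' i) C'"
    by (rule relations_exact_lift[OF z z1 J1, where dr = "\<lambda>_. 0" and P = "\<lambda>i _. P i"])
      (use hG' hC s1 s1' in \<open>simp_all, simp add: G'_def\<close>)
  then obtain C' Q where C': "\<And>j i. j < ?k2 \<Longrightarrow> i < ?k1 \<Longrightarrow>
      homogeneous (d2 ! j - d1 ! i) (C' j i)"
    "\<And>j i. j < ?k2 \<Longrightarrow> i < ?k1 \<Longrightarrow> C' j i = C ! j ! i + z * Q j i"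
    and J1': "relations_exact 1 ?k1 ?k2 (\<lambda>i _. G' i) C'" by blast
  have "\<exists>B' R. (\<forall>j<?k3. \<forall>k<?k2. homogeneous (d3 ! j - d2 ! k) (B' j k) \<and> B' j k = B ! j ! k + z * R j k) \<and>
     relations_exact ?k1 ?k2 ?k3 C' B'"
    by (rule relations_exact_lift[OF z z1 J2 C'(1) hB C'(2)
          relations_exact_imp_saturated[OF J1 z] relations_exact_imp_saturated[OF J1' z]])
  then obtain B' R where B': "\<And>j i. j < ?k3 \<Longrightarrow> i < ?k2 \<Longrightarrow>
      homogeneous (d3 ! j - d2 ! i) (B' j i)"
    "\<And>j i. j < ?k3 \<Longrightarrow> i < ?k2 \<Longrightarrow> B' j i = B ! j ! i + z * R j i"
    and J2': "relations_exact ?k1 ?k2 ?k3 C' B'" by blast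
  \<comment> \<open>With an empty family of relations, lifting is the transfer of injectivity from
    \<open>B\<close> to \<open>B'\<close>.\<close>
  have "\<exists>N' Q. (\<forall>j<0. \<forall>k<?k3. homogeneous (0 - d3 ! k) (N' j k) \<and> N' j k = 0 + z * Q j k) \<and>
     relations_exact ?k2 ?k3 0 B' N'"
    by (rule relations_exact_lift[OF z z1 J3 B'(1) _ B'(2)
          relations_exact_imp_saturated[OF J2 z] relations_exact_imp_saturated[OF J2' z]]) simp_all
  then have J3': "relations_exact ?k2 ?k3 0 B' (\<lambda>_ _. 0)"
    by (auto simp: relations_exact_def)
  show ?thesis
    by (rule that[OF _ _ _ I_eq J1' J2' J3', of P Q R]) (use hG' G'_def C' B' in auto)
qed

text \<open>Rows of relations become columns here, since matrices act on column vectors in the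
  definition of a resolution; hence the exchanged indices.\<close>

lemma mat_kernel_eq_matrix_range:
  fixes M N :: "nat \<Rightarrow> nat \<Rightarrow> 'a::comm_ring_1"
  assumes "relations_exact r n l M N"
  shows "mat_kernel (mat r n (\<lambda>(i, j). M j i)) = matrix_range (mat n l (\<lambda>(i, j). N j i))"
proof -
  have mv: "(mat a b (\<lambda>(i, j). K j i) *\<^sub>v v) $ i = (\<Sum>k<b. v $ k * K k i)"
    if "i < a" "v \<in> carrier_vec b" for a b i v and K :: "nat \<Rightarrow> nat \<Rightarrow> 'a"
    using that by (simp add: scalar_prod_def row_def atLeast0LessThan mult.commute)
  show ?thesis
  proof (intro equalityI subsetI)
    fix v assume "v \<in> mat_kernel (mat r n (\<lambda>(i, j). M j i))"
    then have v: "v \<in> carrier_vec n" and z: "mat r n (\<lambda>(i, j). M j i) *\<^sub>v v = 0\<^sub>v r"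
      by (auto simp: mat_kernel_def)
    have "(\<Sum>k<n. v $ k * M k i) = 0" if "i < r" for i
      using mv[OF that v, of M] that by (simp add: z)
    from relations_exactD[OF assms this] obtain t where t: "\<And>k. k < n \<Longrightarrow>
        v $ k = (\<Sum>j<l. t j * N j k)" by blast
    have "v = mat n l (\<lambda>(i, j). N j i) *\<^sub>v vec l t"
      by (rule eq_vecI) (use v in \<open>simp_all add: mv t del: index_mult_mat_vec\<close>)
    then show "v \<in> matrix_range (mat n l (\<lambda>(i, j). N j i))" by (auto simp: matrix_range_def)
  next
    fix v assume "v \<in> matrix_range (mat n l (\<lambda>(i, j). N j i))"
    then obtain t where t: "t \<in> carrier_vec l" "v = mat n l (\<lambda>(i,
        j). N j i) *\<^sub>v t" by (auto simp: matrix_range_def)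
    have v: "v \<in> carrier_vec n" unfolding t(2) by (rule carrier_vecI) simp
    have "mat r n (\<lambda>(i, j). M j i) *\<^sub>v v = 0\<^sub>v r"
    proof (rule eq_vecI)
      fix i assume i: "i < dim_vec (0\<^sub>v r :: 'a vec)"
      have "(\<Sum>k<n. v $ k * M k i) = (\<Sum>k<n. (\<Sum>j<l. t $ j * N j k) * M k i)"
        using t by (simp add: mv del: index_mult_mat_vec)
      then show "(mat r n (\<lambda>(i, j). M j i) *\<^sub>v v) $ i = 0\<^sub>v r $ i"
        using i v by (simp add: mv sum_mult_sum_swap relations_exact_zero[OF assms] del: index_mult_mat_vec)
    qed simp
    then show "v \<in> mat_kernel (mat r n (\<lambda>(i, j). M j i))" using v by (simp add: mat_kernel_def)
  qed
qed

text \<open>The module A/I is generated by the class of 1 in degree 0, so F_0 has rank one and the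
  list of degrees \<open>[0]\<close>.\<close>

lemma betti_sequence_of_resolution:
  fixes I :: "('v::finite, 'k::comm_ring_1) mpol set"
  assumes I: "ideal I mpol_ring"
    and I_eq: "I = {f. \<exists>v. f = (\<Sum>i<length d1. v i * G i)}"
    and ex1: "relations_exact 1 (length d1) (length d2) (\<lambda>i _. G i) C"
    and ex2: "relations_exact (length d1) (length d2) (length d3) C B"
    and ex3: "relations_exact (length d2) (length d3) 0 B (\<lambda>_ _. 0)"
    and hG: "\<And>i. i < length d1 \<Longrightarrow> homogeneous (d1 ! i) (G i) \<and> lookup (G i) 0 = 0"
    and hC: "\<And>j i. j < length d2 \<Longrightarrow> i < length d1 \<Longrightarrow>
        homogeneous (d2 ! j - d1 ! i) (C j i) \<and> lookup (C j i) 0 = 0"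
    and hB: "\<And>j i. j < length d3 \<Longrightarrow> i < length d2 \<Longrightarrow>
        homogeneous (d3 ! j - d2 ! i) (B j i) \<and> lookup (B j i) 0 = 0"
  shows "quotient_betti_sequence I (1, length d1, length d2, length d3)"
proof -
  let ?R = "mpol_ring :: ('v, 'k) mpol ring"
  let ?M = "quotient_module ?R I" and ?g = "\<lambda>_::nat. I +>\<^bsub>?R\<^esub> 1"
  let ?D1 = "mat 1 (length d1) (\<lambda>(i, j). G j)"
  let ?D2 = "mat (length d1) (length d2) (\<lambda>(i, j). C j i)"
  let ?D3 = "mat (length d2) (length d3) (\<lambda>(i, j). B j i)"
  interpret M: Module.module ?R ?M by (rule module_quotient_module[OF cring_mpol_ring I])
  have aug: "augmentation ?M ?g v = I +>\<^bsub>?R\<^esub> (v $ 0)" if "v \<in> carrier_vec 1" for v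
  proof -
    have "{..<dim_vec v} = {0}" using that by auto
    moreover have "(v $ 0) \<odot>\<^bsub>?M\<^esub> (I +>\<^bsub>?R\<^esub> 1) = I +>\<^bsub>?R\<^esub> (v $ 0)"
      by (simp add: quotient_module_def mpol_coset_mult[OF I])
    moreover have "I +>\<^bsub>?R\<^esub> f \<in> carrier ?M" for f
      by (simp add: quotient_module_def carrier_mpol_quotient)
    ultimately show ?thesis unfolding augmentation_def by simp
  qed
  have zero: "\<zero>\<^bsub>?M\<^esub> = I +>\<^bsub>?R\<^esub> 0" by (simp add: quotient_module_def zero_mpol_quotient)
  have "augmentation ?M ?g ` carrier_vec (length [0::int]) = carrier ?M"
  proof (intro equalityI subsetI)
    fix c assume "c \<in> carrier ?M"
    then obtain f where "c = I +>\<^bsub>?R\<^esub> f" by (auto simp: quotient_module_def carrier_mpol_quotient)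
    then have "c = augmentation ?M ?g (vec 1 (\<lambda>_. f))" by (simp add: aug)
    then show "c \<in> augmentation ?M ?g ` carrier_vec (length [0::int])" by auto
  next
    fix c assume "c \<in> augmentation ?M ?g ` carrier_vec (length [0::int])"
    then obtain f where "c = I +>\<^bsub>?R\<^esub> f" by (auto simp: aug)
    then show "c \<in> carrier ?M" by (simp add: quotient_module_def carrier_mpol_quotient)
  qed
  moreover have "{v \<in> carrier_vec (length [0::int]). augmentation ?M ?g v = \<zero>\<^bsub>?M\<^esub>} = matrix_range ?D1"
  proof (intro equalityI subsetI)
    fix v assume "v \<in> {v \<in> carrier_vec (length [0::int]). augmentation ?M ?g v = \<zero>\<^bsub>?M\<^esub>}"
    then have v: "v \<in> carrier_vec 1" and "v $ 0 \<in> I" by (auto simp: aug zero mpol_coset_eq_iff[OF I])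
    then obtain u where u: "v $ 0 = (\<Sum>i<length d1. u i * G i)" using I_eq by auto
    have "v = ?D1 *\<^sub>v vec (length d1) u"
      by (rule eq_vecI) (use v u in \<open>auto simp: scalar_prod_def row_def atLeast0LessThan mult.commute\<close>)
    then show "v \<in> matrix_range ?D1" by (auto simp: matrix_range_def)
  next
    fix v assume "v \<in> matrix_range ?D1"
    then obtain u where u: "u \<in> carrier_vec (length d1)" "v = ?D1 *\<^sub>v u" by (auto simp: matrix_range_def)
    have v: "v \<in> carrier_vec 1" unfolding u(2) by (rule carrier_vecI) simp
    have "v $ 0 = (\<Sum>i<length d1. u $ i * G i)"
      using u by (simp add: scalar_prod_def row_def atLeast0LessThan mult.commute)
    then have "v $ 0 \<in> I" unfolding I_eq by blast
    then show "v \<in> {v \<in> carrier_vec (length [0::int]). augmentation ?M ?g v = \<zero>\<^bsub>?M\<^esub>}"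
      using v by (simp add: aug zero mpol_coset_eq_iff[OF I])
  qed
  moreover have "mat_kernel ?D1 = matrix_range ?D2" "mat_kernel ?D2 = matrix_range ?D3"
    using mat_kernel_eq_matrix_range[OF ex1] mat_kernel_eq_matrix_range[OF ex2] by simp_all
  moreover have "mat_kernel ?D3 = {0\<^sub>v (length d3)}"
  proof -
    have "mat_kernel ?D3 = matrix_range (mat (length d3) 0 (\<lambda>(i, j). 0))"
      using mat_kernel_eq_matrix_range[OF ex3] by simp
    also have "\<dots> = {0\<^sub>v (length d3)}"
    proof -
      \<comment> \<open>A matrix without columns is applied only to the vector of dimension 0, so
        its range consists of the zero vector.\<close>
      have "matrix_range (mat (length d3) 0 (\<lambda>(i,
          j). 0)) = (\<lambda>_. 0\<^sub>v (length d3) :: ('v, 'k) mpol vec) ` (carrier_vec 0 :: ('v, 'k) mpol vec set)"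
        unfolding matrix_range_def by (intro image_cong) (auto simp: scalar_prod_def)
      then show ?thesis by (simp add: image_constant[of "0\<^sub>v 0"])
    qed
    finally show ?thesis .
  qed
  moreover have "homogeneous_matrix d1 [0] ?D1" "homogeneous_matrix d2 d1 ?D2" "homogeneous_matrix d3 d2 ?D3"
    using hG hC hB by (auto simp: homogeneous_matrix_def)
  moreover have "minimal_matrix ?D1" "minimal_matrix ?D2" "minimal_matrix ?D3"
    using hG hC hB by (auto simp: minimal_matrix_def)
  moreover have "\<forall>i<length [0::int]. ?g i \<in> quotient_grading I ([0] ! i)"
    using homogeneous_single[of 0 0 "1::'k"] by (auto simp: quotient_grading_def)
  ultimately have "minimal_graded_free_resolution ?M (quotient_grading I) [0] d1 d2 d3 ?g ?D1 ?D2 ?D3"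
    unfolding minimal_graded_free_resolution_def by blast
  then show ?thesis unfolding betti_sequence_def by (metis length_Cons list.size(3) One_nat_def)
qed

section \<open>The tangent cone ideal\<close>

text \<open>The exponent of t in the image of the monomial under the toric map.\<close>

definition weight :: "('v::finite \<Rightarrow> nat) \<Rightarrow> ('v \<Rightarrow>\<^sub>0 nat) \<Rightarrow> nat" where
  "weight n m = (\<Sum>i\<in>UNIV. lookup m i * n i)"

lemma weight_add: "weight n (s + t) = weight n s + weight n t"
  by (simp add: weight_def lookup_add distrib_right sum.distrib)

lemma weight_single: "weight n (single j k) = k * n j"
  by (simp add: weight_def lookup_single when_def if_distrib[of "\<lambda>x. x * _"] cong: if_cong)

lemma mdeg_single: "mdeg (single j k) = k"
  by (simp add: mdeg_def lookup_single when_def)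

lemma mdeg_le_weight: "(\<And>i. 0 < n i) \<Longrightarrow> mdeg m \<le> weight n m"
  unfolding weight_def mdeg_def by (intro sum_mono) (simp add: Suc_leI)

text \<open>The coefficient of t to the power \<open>k\<close> in the image of \<open>f\<close>
  under the toric map, as \<open>toric_ideal_iff\<close> makes precise.\<close>

definition weight_sum :: "('v::finite \<Rightarrow> nat) \<Rightarrow> nat \<Rightarrow> ('v,
    'k::comm_ring_1) mpol \<Rightarrow> 'k" where
  "weight_sum n k f = (\<Sum>m\<in>keys f. if weight n m = k then lookup f m else 0)"

lemma weight_sum_add: "weight_sum n k (f + g) = weight_sum n k f + weight_sum n k g"
  unfolding weight_sum_def by (rule setsum_keys_plus_distrib) simp_all

lemma weight_sum_diff: "weight_sum n k (f - g) = weight_sum n k f - weight_sum n k g"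
  using weight_sum_add[of n k "f - g" g] by simp

lemma weight_sum_0 [simp]: "weight_sum n k 0 = 0"
  by (simp add: weight_sum_def)

lemma weight_sum_single: "weight_sum n k (single m c) = (if weight n m = k then c else 0)"
  by (simp add: weight_sum_def)

lemma weight_sum_single_mult:
  "weight_sum n k (single m c * f) = (if weight n m \<le> k then c * weight_sum n (k - weight n m) f else 0)"
proof (induction f rule: poly_induct)
  case (single_add s a f)
  have "weight_sum n k (single (m + s) (c * a)) =
      (if weight n m \<le> k then c * weight_sum n (k - weight n m) (single s a) else 0)"
    by (auto simp: weight_sum_single weight_add)
  with single_add show ?case by (auto simp: distrib_left mult_single weight_sum_add)
qed simp

lemma prod_monom_power:
  "(\<Prod>i\<in>A. monom (1::'k::comm_ring_1) (n i) ^ e i) = monom 1 (\<Sum>i\<in>A. e i * n i)"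
  by (induction A rule: infinite_finite_induct) (simp_all add: monom_power mult_monom mult.commute)

lemma toric_ideal_iff: "f \<in> toric_ideal n \<longleftrightarrow> (\<forall>k. weight_sum n k f = 0)"
proof -
  have "coeff (toric_map n f) k = weight_sum n k f" for k
    by (simp add: toric_map_def weight_sum_def prod_monom_power smult_monom coeff_sum coeff_monom weight_def)
  then show ?thesis by (auto simp: toric_ideal_def poly_eq_iff)
qed

lemma ideal_toric_ideal: "ideal (toric_ideal n) mpol_ring"
  unfolding ideal_mpol_ring_iff
proof (intro conjI ballI allI)
  fix f g :: "('a, 'b) mpol" assume f: "f \<in> toric_ideal n"
  show "g * f \<in> toric_ideal n"
  proof (induction g rule: poly_induct)
    case (single_add m c g)
    then show ?case using f by (auto simp: distrib_right toric_ideal_iff weight_sum_add weight_sum_single_mult)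
  qed (simp add: toric_ideal_iff)
qed (auto simp: toric_ideal_iff weight_sum_add)

lemma homogeneous_component_eq: "homogeneous_component d f = degree_part (int d) f"
proof (rule poly_mapping_eqI)
  fix m
  have "lookup (homogeneous_component d f) m = (\<Sum>k\<in>{k \<in> keys f. mdeg k = d}. if k = m then lookup f k else 0)"
    by (simp add: homogeneous_component_def lookup_sum lookup_single when_def)
  also have "\<dots> = lookup (degree_part (int d) f) m"
    by (subst sum.delta) (auto simp: lookup_degree_part in_keys_iff)
  finally show "lookup (homogeneous_component d f) m = lookup (degree_part (int d) f) m" .
qed

text \<open>Unlike the set of initial forms, this set contains 0 and is closed under addition; its
  nonzero elements are the initial forms of degree \<open>d\<close>.\<close>

definition leading_forms :: "('v::finite \<Rightarrow> nat) \<Rightarrow> nat \<Rightarrow> ('v,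
    'k::comm_ring_1) mpol set" where
  "leading_forms n d = degree_part (int d) ` {f \<in> toric_ideal n. \<forall>m\<in>keys f. d \<le> mdeg m}"

lemma leading_forms_0: "0 \<in> leading_forms n d"
  unfolding leading_forms_def by (intro image_eqI[of _ _ 0]) (simp_all add: mpol_ideal_0[OF ideal_toric_ideal])

lemma leading_forms_add:
  assumes "f \<in> leading_forms n d" "g \<in> leading_forms n d" shows "f + g \<in> leading_forms n d"
proof -
  obtain F H where F: "f = degree_part (int d) F" "F \<in> toric_ideal n" "\<forall>m\<in>keys F. d \<le> mdeg m"
    and H: "g = degree_part (int d) H" "H \<in> toric_ideal n" "\<forall>m\<in>keys H. d \<le> mdeg m"
    using assms by (auto simp: leading_forms_def)
  then have "F + H \<in> toric_ideal n" "\<forall>m\<in>keys (F + H). d \<le> mdeg m"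
    using keys_add[of F H] by (auto intro: mpol_ideal_add[OF ideal_toric_ideal])
  then show ?thesis unfolding leading_forms_def F H by (intro image_eqI[of _ _ "F + H"]) (simp_all add: degree_part_add)
qed

lemma leading_forms_single_mult:
  assumes "f \<in> leading_forms n d" shows "single m c * f \<in> leading_forms n (mdeg m + d)"
proof -
  obtain F where F: "f = degree_part (int d) F" "F \<in> toric_ideal n" "\<forall>m\<in>keys F. d \<le> mdeg m"
    using assms by (auto simp: leading_forms_def)
  have "\<forall>k\<in>keys (single m c * F). mdeg m + d \<le> mdeg k"
  proof
    fix k assume "k \<in> keys (single m c * F)"
    then obtain a b where "k = a + b" "a \<in> keys (single m c)" "b \<in> keys F" using keys_mult[of "single m c" F] by blast
    then show "mdeg m + d \<le> mdeg k" using F by (auto simp: mdeg_add split: if_splits)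
  qed
  then show ?thesis unfolding leading_forms_def F
    by (intro image_eqI[of _ _ "single m c * F"])
      (simp_all add: degree_part_single_mult mpol_ideal_mult[OF ideal_toric_ideal F(2)])
qed

text \<open>An explicit description of the ideal generated by the initial forms, in which membership
  is tested one degree at a time.\<close>

definition tangent_cone_forms :: "('v::finite \<Rightarrow> nat) \<Rightarrow> ('v, 'k::comm_ring_1) mpol set" where
  "tangent_cone_forms n = {f. \<forall>d. degree_part (int d) f \<in> leading_forms n d}"

lemma ideal_tangent_cone_forms: "ideal (tangent_cone_forms n) mpol_ring"
  unfolding ideal_mpol_ring_iff
proof (intro conjI ballI allI)
  fix f g :: "('a, 'b) mpol" assume f: "f \<in> tangent_cone_forms n"
  show "g * f \<in> tangent_cone_forms n"
  proof (induction g rule: poly_induct)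
    case (single_add m c g)
    have "degree_part (int d) (single m c * f) \<in> leading_forms n d" for d
    proof (cases "mdeg m \<le> d")
      case True
      then have "degree_part (int d) (single m c * f) = single m c * degree_part (int (d - mdeg m)) f"
        by (simp add: degree_part_single_mult of_nat_diff)
      moreover have "degree_part (int (d - mdeg m)) f \<in> leading_forms n (d - mdeg m)"
        using f unfolding tangent_cone_forms_def by blast
      ultimately show ?thesis using True leading_forms_single_mult[of _ n "d - mdeg m" m c] by simp
    next
      case False
      then show ?thesis by (simp add: degree_part_single_mult degree_part_neg leading_forms_0)
    qed
    then show ?case using single_add by (auto simp: distrib_right tangent_cone_forms_def degree_part_add leading_forms_add)
  qed (simp add: tangent_cone_forms_def leading_forms_0)
qed (auto simp: tangent_cone_forms_def degree_part_add leading_forms_add leading_forms_0)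

lemma initial_form_leading_forms:
  assumes "f \<in> toric_ideal n" "f \<noteq> 0"
  shows "initial_form f \<in> leading_forms n (Min (mdeg ` keys f))"
  unfolding leading_forms_def initial_form_def homogeneous_component_eq
  using assms by (intro image_eqI[of _ _ f]) auto

lemma leading_forms_initial_form:
  assumes "f \<in> leading_forms n d" "f \<noteq> 0"
  shows "f \<in> initial_form ` (toric_ideal n - {0})"
proof -
  obtain F where F: "f = degree_part (int d) F" "F \<in> toric_ideal n" "\<forall>m\<in>keys F. d \<le> mdeg m"
    using assms by (auto simp: leading_forms_def)
  obtain m where "m \<in> keys f" using assms(2) by (metis keys_eq_empty equals0I)
  then have "m \<in> keys F" "mdeg m = d" by (auto simp: F in_keys_iff lookup_degree_part split: if_splits)
  then have "Min (mdeg ` keys F) = d" using F(3) by (intro Min_eqI) auto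
  then have "initial_form F = f" by (simp add: initial_form_def homogeneous_component_eq F)
  moreover have "F \<noteq> 0" using \<open>m \<in> keys F\<close> by auto
  ultimately show ?thesis using F(2) by blast
qed

lemma tangent_cone_ideal_eq: "tangent_cone_ideal n = tangent_cone_forms n"
proof
  interpret cring "mpol_ring :: ('a, 'b) mpol ring" by (rule cring_mpol_ring)
  have "initial_form f \<in> tangent_cone_forms n" if "f \<in> toric_ideal n - {0}" for f :: "('a, 'b) mpol"
    using initial_form_leading_forms[of f n] that degree_part_homogeneous[of "int (Min (mdeg ` keys f))" "initial_form f"]
    by (auto simp: tangent_cone_forms_def leading_forms_0) (simp add: initial_form_def homogeneous_component_eq leading_forms_0)
  then show "tangent_cone_ideal n \<subseteq> (tangent_cone_forms n :: ('a, 'b) mpol set)"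
    unfolding tangent_cone_ideal_def by (intro genideal_minimal ideal_tangent_cone_forms) blast
  have id: "ideal (tangent_cone_ideal n :: ('a, 'b) mpol set) mpol_ring"
    unfolding tangent_cone_ideal_def by (rule genideal_ideal) simp
  have sub: "initial_form ` (toric_ideal n - {0}) \<subseteq> (tangent_cone_ideal n :: ('a, 'b) mpol set)"
    unfolding tangent_cone_ideal_def by (rule genideal_self) simp
  show "tangent_cone_forms n \<subseteq> (tangent_cone_ideal n :: ('a, 'b) mpol set)"
  proof
    fix f :: "('a, 'b) mpol" assume f: "f \<in> tangent_cone_forms n"
    have "degree_part d f \<in> tangent_cone_ideal n" for d
    proof (cases "0 \<le> d \<and> degree_part d f \<noteq> 0")
      case True
      then obtain k where "d = int k" using nonneg_int_cases by blast
      then show ?thesis using f leading_forms_initial_form[of "degree_part d f" n k] True sub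
        by (auto simp: tangent_cone_forms_def)
    next
      case False
      then have "degree_part d f = 0" using degree_part_neg[of d f] by linarith
      then show ?thesis using mpol_ideal_0[OF id] by simp
    qed
    moreover obtain N where "(\<Sum>d\<in>{-N..N}. degree_part (d - 0) f) = f" using degree_part_decomposition[of 0 f] by blast
    ultimately show "f \<in> tangent_cone_ideal n" using mpol_ideal_sum[OF id,
        of "{-N..N}" "\<lambda>d. degree_part d f"] by simp
  qed
qed

lemma ideal_tangent_cone_ideal: "ideal (tangent_cone_ideal n) mpol_ring"
  unfolding tangent_cone_ideal_eq by (rule ideal_tangent_cone_forms)

lemma degree_part_tangent_cone_ideal: "f \<in> tangent_cone_ideal n \<Longrightarrow>
    degree_part d f \<in> tangent_cone_ideal n"
  unfolding tangent_cone_ideal_eq tangent_cone_forms_def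
  by (auto simp: degree_part_homogeneous[OF homogeneous_degree_part] leading_forms_0)

text \<open>Let the monomial be the part of degree \<open>mdeg M\<close> of some \<open>F\<close> in
  the toric ideal that has no terms of smaller degree. The coefficients of \<open>F\<close> in the
  weight of \<open>M\<close> sum to zero, so another monomial of this weight occurs in
  \<open>F\<close>. It cannot have degree \<open>mdeg M\<close>, where \<open>F\<close> has only the
  one term.\<close>

lemma single_in_tangent_cone_ideal:
  assumes "single M (1::'k::comm_ring_1) \<in> tangent_cone_ideal n"
  shows "\<exists>N. weight n N = weight n M \<and> mdeg M < mdeg N"
proof (rule ccontr)
  assume no: "\<not> ?thesis"
  have "degree_part (int (mdeg M)) (single M (1::'k)) \<in> leading_forms n (mdeg M)"
    using assms unfolding tangent_cone_ideal_eq tangent_cone_forms_def by blast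
  then have "single M (1::'k) \<in> leading_forms n (mdeg M)" by (simp add: degree_part_single)
  then obtain F where F: "single M (1::'k) = degree_part (int (mdeg M)) F" "F \<in> toric_ideal n" "\<forall>m\<in>keys F. mdeg M \<le> mdeg m"
    by (auto simp: leading_forms_def)
  have FM: "lookup F m = (if m = M then 1 else 0)" if "mdeg m = mdeg M" for m
    using arg_cong[OF F(1), of "\<lambda>f. lookup f m"] that by (auto simp: lookup_degree_part lookup_single when_def)
  have "weight_sum n (weight n M) F = (\<Sum>m\<in>keys F. if m = M then lookup F m else 0)"
    unfolding weight_sum_def
  proof (rule sum.cong)
    fix m assume m: "m \<in> keys F"
    have "m = M" if "weight n m = weight n M"
    proof -
      have "mdeg m = mdeg M" using no that F(3) m by (metis le_neq_implies_less)
      then show ?thesis using FM[of m] m by (auto simp: in_keys_iff split: if_splits)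
    qed
    then show "(if weight n m = weight n M then lookup F m else 0) = (if m = M then lookup F m else 0)" by auto
  qed simp
  also have "\<dots> = 1" using FM[of M] by (simp add: in_keys_iff)
  finally show False using F(2) by (simp add: toric_ideal_iff)
qed

lemma binomial_in_toric_ideal:
  "weight n M = weight n N \<Longrightarrow> single M 1 - single N (1::'k::comm_ring_1) \<in> toric_ideal n"
  by (simp add: toric_ideal_iff weight_sum_diff weight_sum_single)

text \<open>This is the part of degree \<open>mdeg M\<close> of a binomial in the toric ideal. It is
  0 for \<open>M = N\<close>, a case that \<open>leading_forms\<close> permits.\<close>

lemma binomial_leading_form:
  assumes "weight n M = weight n N" "mdeg M \<le> mdeg N"
  shows "single M 1 - (if mdeg M = mdeg N then single N (1::'k::comm_ring_1) else 0) \<in> tangent_cone_ideal n"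
proof -
  let ?f = "single M 1 - single N (1::'k)" and ?d = "int (mdeg M)"
  have "\<forall>m\<in>keys ?f. mdeg M \<le> mdeg m"
    using assms(2) keys_diff[of "single M (1::'k)" "single N 1"] by auto
  then have *: "degree_part ?d ?f \<in> leading_forms n (mdeg M)"
    unfolding leading_forms_def using binomial_in_toric_ideal[OF assms(1)] by blast
  have "degree_part d (degree_part ?d ?f) = (if d = ?d then degree_part ?d ?f else 0)" for d
    by (rule degree_part_homogeneous) simp
  with * have "degree_part ?d ?f \<in> tangent_cone_ideal n"
    unfolding tangent_cone_ideal_eq tangent_cone_forms_def by (auto simp: leading_forms_0)
  moreover have "degree_part ?d ?f = single M 1 - (if mdeg M = mdeg N then single N (1::'k) else 0)"
    by (auto simp: degree_part_diff degree_part_single)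
  ultimately show ?thesis by simp
qed

abbreviation indet :: "'v \<Rightarrow> ('v \<Rightarrow>\<^sub>0 nat) \<Rightarrow>\<^sub>0 'k::comm_ring_1" where
  "indet i \<equiv> single (single i 1) 1"

lemma split_var: "0 < lookup m i \<Longrightarrow>
    \<exists>k. m = single i 1 + k" for m :: "'v \<Rightarrow>\<^sub>0 nat"
proof -
  assume "0 < lookup m i"
  then have "m = single i 1 + (m - single i 1)"
    by (intro poly_mapping_eqI) (auto simp: lookup_add lookup_minus lookup_single when_def)
  then show ?thesis by blast
qed

text \<open>Among the monomials of this weight divisible by \<open>X_i\<close>, let \<open>L\<close>
  have maximal degree. If \<open>M\<close> has no larger degree, the binomial of \<open>M\<close>
  and \<open>L\<close> suffices. Otherwise \<open>L\<close> itself is a leading form; cancelling the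
  regular \<open>X_i\<close> and applying \<open>single_in_tangent_cone_ideal\<close> gives a
  monomial of larger degree, whose product with \<open>X_i\<close> contradicts the choice of
  \<open>L\<close>.\<close>

lemma nonminimal_in_tangent_cone_ideal:
  fixes n :: "'v::finite \<Rightarrow> nat"
  assumes pos: "\<And>i. 0 < n i"
    and nzd: "\<And>f :: ('v, 'k::comm_ring_1) mpol. indet i * f \<in> tangent_cone_ideal n \<Longrightarrow>
        f \<in> tangent_cone_ideal n"
    and N: "weight n N = weight n M" "0 < lookup N i"
  shows "\<exists>q. single M (1::'k) + indet i * q \<in> tangent_cone_ideal n"
proof -
  let ?S = "{N. weight n N = weight n M \<and> 0 < lookup N i}"
  \<comment> \<open>Since all generators are positive, the weight bounds the degree and a maximum
    exists.\<close>
  have "\<forall>K. K \<in> ?S \<longrightarrow> mdeg K < Suc (weight n M)" 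
    using mdeg_le_weight[of n, OF pos] by (metis (mono_tags, lifting) less_Suc_eq_le mem_Collect_eq)
  from ex_has_greatest_nat[OF _ this, of N] N
  obtain L where L: "L \<in> ?S" and max: "\<And>K. K \<in> ?S \<Longrightarrow> mdeg K \<le> mdeg L" by blast
  obtain K where K: "L = single i 1 + K" using L split_var[of L i] by auto
  show ?thesis
  proof (cases "mdeg M \<le> mdeg L")
    case True
    have "(if mdeg M = mdeg L then single L (1::'k) else 0) = indet i * (if mdeg M = mdeg L then single K 1 else 0)"
      by (simp add: K mult_single)
    then show ?thesis using binomial_leading_form[of n M L, where 'k='k] L True
      by (intro exI[of _ "- (if mdeg M = mdeg L then single K 1 else 0)"]) simp
  next
    case False
    then have "single L (1::'k) \<in> tangent_cone_ideal n"
      using binomial_leading_form[of n L M, where 'k='k] L by simp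
    then have "indet i * single K (1::'k) \<in> tangent_cone_ideal n" by (simp add: K mult_single)
    from single_in_tangent_cone_ideal[OF nzd[OF this]] obtain K' where K': "weight n K' = weight n K" "mdeg K < mdeg K'" by blast
    then have "single i 1 + K' \<in> ?S" using L by (simp add: K weight_add lookup_add)
    from max[OF this] show ?thesis using K'(2) by (simp add: K mdeg_add)
  qed
qed

text \<open>Terms of an initial form that lie in \<open>J\<close> or are divisible by
  \<open>X_i\<close> are harmless. For any other term, \<open>key\<close> forces all terms of the
  polynomial of the same weight to have the initial degree and to be congruent modulo
  \<open>J\<close>; their coefficients sum to zero.\<close>

lemma tangent_cone_ideal_subset:
  fixes J :: "('v::finite, 'k::comm_ring_1) mpol set"
  assumes J: "ideal J mpol_ring"
    and key: "\<And>M N. lookup M i = 0 \<Longrightarrow> single M 1 \<notin> J \<Longrightarrow>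
        weight n N = weight n M \<Longrightarrow> mdeg M \<le> mdeg N \<Longrightarrow>
      mdeg N = mdeg M \<and> lookup N i = 0 \<and> single N 1 \<notin> J \<and> single N 1 - single M 1 \<in> J"
    and f: "f \<in> tangent_cone_ideal n"
  shows "\<exists>g\<in>J. \<exists>q. f = g + indet i * q"
proof -
  define K where "K = {g + indet i * q | g q. g \<in> J}"
  have K: "ideal K mpol_ring"
    unfolding ideal_mpol_ring_iff
  proof (intro conjI ballI allI)
    show "0 \<in> K" using mpol_ideal_0[OF J] unfolding K_def by (auto intro!: exI[of _ "0::('v, 'k) mpol"])
  next
    fix a b assume "a \<in> K" "b \<in> K"
    then obtain g q g' q' where "a = g + indet i * q" "b = g' + indet i * q'" "g \<in> J" "g' \<in> J" by (auto simp: K_def)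
    then have "a + b = (g + g') + indet i * (q + q')" "g + g' \<in> J"
      using mpol_ideal_add[OF J] by (auto simp: algebra_simps)
    then show "a + b \<in> K" unfolding K_def by blast
  next
    fix a h assume "a \<in> K"
    then obtain g q where "a = g + indet i * q" "g \<in> J" by (auto simp: K_def)
    then have "h * a = h * g + indet i * (h * q)" "h * g \<in> J"
      using mpol_ideal_mult[OF J] by (auto simp: algebra_simps)
    then show "h * a \<in> K" unfolding K_def by blast
  qed
  have JK: "g \<in> K" if "g \<in> J" for g 
  proof -
    have "g = g + indet i * 0" by simp
    then show ?thesis unfolding K_def using that by blast
  qed
  have "initial_form F \<in> K" if F: "F \<in> toric_ideal n" "F \<noteq> 0" for F :: "('v, 'k) mpol"
  proof -
    define D where "D = Min (mdeg ` keys F)"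
    define p where "p = initial_form F"
    have p: "lookup p m = (if mdeg m = D then lookup F m else 0)" for m
      by (simp add: p_def initial_form_def homogeneous_component_eq lookup_degree_part D_def)
    have ge: "D \<le> mdeg m" if "m \<in> keys F" for m
      unfolding D_def using that by (intro Min_le) auto
    define A where "A = {M \<in> keys p. lookup M i = 0 \<and> single M (1::'k) \<notin> J}"
    have finA: "finite A" by (simp add: A_def)
    have sp: "single m c = single 0 c * single m (1::'k)" for m :: "'v \<Rightarrow>\<^sub>0 nat" and c by (simp add: mult_single)
    have other: "single m (lookup p m) \<in> K" if "m \<in> keys p - A" for m
    proof (cases "lookup m i = 0")
      case True
      then have "single m (1::'k) \<in> J" using that by (auto simp: A_def)
      then show ?thesis using JK mpol_ideal_mult[OF J] sp by metis
    next
      case False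
      then obtain k where k: "m = single i 1 + k" using split_var[of m i] by auto
      have "single m (lookup p m) = 0 + indet i * single k (lookup p m)" by (simp add: k mult_single)
      then show ?thesis unfolding K_def using mpol_ideal_0[OF J] by blast
    qed
    have per_weight: "(\<Sum>m\<in>{m\<in>A. weight n m = k}. single m (lookup p m)) \<in> J" if "k \<in> weight n ` A" for k
    proof -
      obtain M where M: "M \<in> A" "weight n M = k" using \<open>k \<in> weight n ` A\<close> by auto
      let ?A = "{m \<in> A. weight n m = k}"
      have M': "lookup M i = 0" "single M (1::'k) \<notin> J" "mdeg M = D"
        using M by (auto simp: A_def in_keys_iff p split: if_splits)
      have dJ: "single m 1 - single M (1::'k) \<in> J" if "m \<in> ?A" for m
        using key[OF M'(1,2), of m] that M M' by (auto simp: A_def in_keys_iff p split: if_splits)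
      \<comment> \<open>No term of \<open>F\<close> has degree below \<open>D\<close>, which is the
        degree of \<open>M\<close>. So \<open>key\<close> applies to every term of weight
        \<open>k\<close> and keeps it in the initial form and in \<open>A\<close>.\<close>
      have "{m \<in> keys F. weight n m = k} = ?A"
      proof (intro equalityI subsetI)
        fix m assume m: "m \<in> {m \<in> keys F. weight n m = k}"
        then show "m \<in> ?A" using key[OF M'(1,2), of m] ge[of m] M M' by (auto simp: A_def in_keys_iff p)
      qed (auto simp: A_def in_keys_iff p split: if_splits)
      then have "weight_sum n k F = (\<Sum>m\<in>?A. lookup F m)"
        unfolding weight_sum_def by (subst sum.inter_filter[symmetric]) simp_all
      moreover have "(\<Sum>m\<in>?A. lookup F m) = (\<Sum>m\<in>?A. lookup p m)"
        by (rule sum.cong) (auto simp: A_def in_keys_iff p split: if_splits)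
      ultimately have "(\<Sum>m\<in>?A. lookup p m) = 0" using F by (simp add: toric_ideal_iff)
      \<comment> \<open>Each monomial is replaced by its difference to \<open>M\<close>; the
        leftover multiple of \<open>M\<close> has the coefficient sum, which is zero.\<close>
      have "(\<Sum>m\<in>?A. single m (lookup p m)) = (\<Sum>m\<in>?A. single 0 (lookup p m) * (single m 1 - single M 1)) + single 0 (\<Sum>m\<in>?A. lookup p m) * single M 1"
      proof -
        have "single 0 (sum g B) = (\<Sum>b\<in>B. single (0::'v \<Rightarrow>\<^sub>0 nat) (g b))" for g :: "('v \<Rightarrow>\<^sub>0 nat) \<Rightarrow> 'k" and B
          by (induction B rule: infinite_finite_induct) (simp_all add: single_add)
        then show ?thesis by (simp add: right_diff_distrib sum_subtractf sum_distrib_right mult_single)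
      qed
      also have "\<dots> \<in> J" unfolding \<open>(\<Sum>m\<in>?A. lookup p m) = 0\<close>
        using dJ by (simp, intro mpol_ideal_sum[OF J] mpol_ideal_mult[OF J]) auto
      finally show ?thesis .
    qed
    have "(\<Sum>m\<in>A. single m (lookup p m)) = (\<Sum>k\<in>weight n ` A. \<Sum>m\<in>{m\<in>A. weight n m = k}. single m (lookup p m))"
      by (rule sum.image_gen[OF finA])
    also have "\<dots> \<in> K" by (intro mpol_ideal_sum[OF K] JK per_weight)
    finally have "(\<Sum>m\<in>A. single m (lookup p m)) + (\<Sum>m\<in>keys p - A. single m (lookup p m)) \<in> K"
      by (rule mpol_ideal_add[OF K _ mpol_ideal_sum[OF K other]])
    also have "(\<Sum>m\<in>A. single m (lookup p m)) + (\<Sum>m\<in>keys p - A. single m (lookup p m)) = p"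
      using sum.subset_diff[of A "keys p" "\<lambda>m. single m (lookup p m)"] sum_single_keys[of p]
      by (simp add: A_def add.commute)
    finally show ?thesis by (simp add: p_def)
  qed
  then have "initial_form ` (toric_ideal n - {0}) \<subseteq> K" by blast
  then have "tangent_cone_ideal n \<subseteq> K"
    unfolding tangent_cone_ideal_def by (rule ring.genideal_minimal[OF ring_from_type_algebra K])
  then show ?thesis using f unfolding K_def by blast
qed

section \<open>Cohen-Macaulay tangent cones\<close>

lemma
  fixes I :: "('v, 'k::comm_ring_1) mpol set"
  assumes I: "ideal I mpol_ring" and M: "ideal M mpol_ring" and IM: "I \<subseteq> M"
  shows mpol_coset_image_iff: "I +>\<^bsub>mpol_ring\<^esub> f \<in> (\<lambda>f. I +>\<^bsub>mpol_ring\<^esub> f) ` M \<longleftrightarrow> f \<in> M"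
    and ideal_mpol_coset_image: "ideal ((\<lambda>f. I +>\<^bsub>mpol_ring\<^esub> f) ` M) (mpol_ring Quot I)"
proof -
  let ?Q = "mpol_ring Quot I" and ?\<pi> = "\<lambda>f. I +>\<^bsub>mpol_ring\<^esub> f"
  show "?\<pi> f \<in> ?\<pi> ` M \<longleftrightarrow> f \<in> M" for f
  proof
    assume "?\<pi> f \<in> ?\<pi> ` M"
    then obtain g where g: "g \<in> M" "f - g \<in> I" by (auto simp: mpol_coset_eq_iff[OF I])
    then have "(f - g) + g \<in> M" using IM mpol_ideal_add[OF M] by blast
    then show "f \<in> M" by simp
  qed simp
  interpret Q: cring ?Q by (rule ideal.quotient_is_cring[OF I cring_mpol_ring])
  have inv: "\<ominus>\<^bsub>?Q\<^esub> ?\<pi> f = ?\<pi> (- f)" for f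
    by (rule Q.minus_equality)
      (simp_all add: mpol_coset_add[OF I] zero_mpol_quotient carrier_mpol_quotient)
  show "ideal (?\<pi> ` M) ?Q"
  proof (rule idealI)
    show "subgroup (?\<pi> ` M) (add_monoid ?Q)"
    proof (rule Q.add.subgroupI)
      show "?\<pi> ` M \<noteq> {}" using mpol_ideal_0[OF M] by blast
      show "\<ominus>\<^bsub>?Q\<^esub> c \<in> ?\<pi> ` M" if "c \<in> ?\<pi> ` M" for c
        using that inv mpol_ideal_uminus[OF M] by auto
      show "c \<oplus>\<^bsub>?Q\<^esub> d \<in> ?\<pi> ` M" if "c \<in> ?\<pi> ` M" "d \<in> ?\<pi> ` M" for c d
        using that mpol_ideal_add[OF M] by (auto simp: mpol_coset_add[OF I])
    qed (auto simp: carrier_mpol_quotient)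
    show "c \<otimes>\<^bsub>?Q\<^esub> d \<in> ?\<pi> ` M" if "d \<in> ?\<pi> ` M" "c \<in> carrier ?Q" for c d
      using that mpol_ideal_mult[OF M] by (auto simp: carrier_mpol_quotient mpol_coset_mult[OF I])
    show "d \<otimes>\<^bsub>?Q\<^esub> c \<in> ?\<pi> ` M" if "d \<in> ?\<pi> ` M" "c \<in> carrier ?Q" for c d
      using that mpol_ideal_mult[OF M] by (auto simp: carrier_mpol_quotient mpol_coset_mult[OF I] mult.commute)
  qed (rule Q.ring_axioms)
qed

lemma primeideal_mpol_coset_image:
  fixes I :: "('v, 'k::comm_ring_1) mpol set"
  assumes I: "ideal I mpol_ring" and M: "ideal M mpol_ring" and IM: "I \<subseteq> M"
    and 1: "1 \<notin> M" and prime: "\<And>f g. f * g \<in> M \<Longrightarrow> f \<in> M \<or> g \<in> M"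
  shows "primeideal ((\<lambda>f. I +>\<^bsub>mpol_ring\<^esub> f) ` M) (mpol_ring Quot I)"
proof (rule primeidealI)
  show "carrier (mpol_ring Quot I) \<noteq> (\<lambda>f. I +>\<^bsub>mpol_ring\<^esub> f) ` M"
    using 1 mpol_coset_image_iff[OF I M IM, of 1] by (auto simp: carrier_mpol_quotient)
  show "c \<in> (\<lambda>f. I +>\<^bsub>mpol_ring\<^esub> f) ` M \<or> d \<in> (\<lambda>f. I +>\<^bsub>mpol_ring\<^esub> f) ` M"
    if "c \<in> carrier (mpol_ring Quot I)" "d \<in> carrier (mpol_ring Quot I)"
      "c \<otimes>\<^bsub>mpol_ring Quot I\<^esub> d \<in> (\<lambda>f. I +>\<^bsub>mpol_ring\<^esub> f) ` M" for c d
  proof -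
    obtain f g where "c = I +>\<^bsub>mpol_ring\<^esub> f" "d = I +>\<^bsub>mpol_ring\<^esub> g"
      using \<open>c \<in> _\<close> \<open>d \<in> _\<close> unfolding carrier_mpol_quotient by blast
    then show ?thesis using \<open>c \<otimes>\<^bsub>_\<^esub> d \<in> _\<close> prime[of f g]
      by (simp add: mpol_coset_mult[OF I] mpol_coset_image_iff[OF I M IM])
  qed
qed (rule ideal_mpol_coset_image[OF I M IM], rule ideal.quotient_is_cring[OF I cring_mpol_ring])

lemma maximalideal_mpol_coset_image:
  fixes I :: "('v, 'k::comm_ring_1) mpol set"
  assumes I: "ideal I mpol_ring" and M: "ideal M mpol_ring" and IM: "I \<subseteq> M"
    and 1: "1 \<notin> M" and max: "\<And>f. f \<notin> M \<Longrightarrow> \<exists>g. 1 - g * f \<in> M"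
  shows "maximalideal ((\<lambda>f. I +>\<^bsub>mpol_ring\<^esub> f) ` M) (mpol_ring Quot I)"
proof (rule maximalidealI)
  let ?Q = "mpol_ring Quot I" and ?\<pi> = "\<lambda>f. I +>\<^bsub>mpol_ring\<^esub> f"
  show "carrier ?Q \<noteq> ?\<pi> ` M"
    using 1 mpol_coset_image_iff[OF I M IM, of 1] by (auto simp: carrier_mpol_quotient)
  show "J = ?\<pi> ` M \<or> J = carrier ?Q" if J: "ideal J ?Q" "?\<pi> ` M \<subseteq> J" "J \<subseteq> carrier ?Q" for J
  proof (cases "J \<subseteq> ?\<pi> ` M")
    case False
    then obtain f where f: "?\<pi> f \<in> J" "f \<notin> M" using J(3) unfolding carrier_mpol_quotient by blast
    then obtain g where "1 - g * f \<in> M" using max by blast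
    then have "?\<pi> (1 - g * f) \<in> J" using J(2) by blast
    moreover have "?\<pi> (g * f) \<in> J"
      using ideal.I_l_closed[OF J(1) f(1), of "?\<pi> g"] by (simp add: carrier_mpol_quotient mpol_coset_mult[OF I])
    ultimately have "?\<pi> ((1 - g * f) + g * f) \<in> J"
      using additive_subgroup.a_closed[OF ideal.axioms(1)[OF J(1)]] mpol_coset_add[OF I] by metis
    then have "?\<pi> 1 \<in> J" by simp
    then have "?\<pi> h \<in> J" for h
      using ideal.I_l_closed[OF J(1),
          of "?\<pi> 1" "?\<pi> h"] by (simp add: carrier_mpol_quotient mpol_coset_mult[OF I])
    then show ?thesis using J(3) by (auto simp: carrier_mpol_quotient)
  qed (use J in blast)
qed (rule ideal_mpol_coset_image[OF I M IM])

lemma single_neq_0: "single i (Suc 0) \<noteq> 0"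
  by (metis lookup_single_eq lookup_zero nat.distinct(1))

definition irrelevant_ideal :: "('v, 'k::comm_ring_1) mpol set" where
  "irrelevant_ideal = {f. lookup f 0 = 0}"

lemma lookup_mult_0: "lookup (f * g) 0 = lookup f 0 * lookup g 0" for f g :: "('v, 'k::comm_ring_1) mpol"
proof (induction f rule: poly_induct)
  case (single_add m c f)
  have "lookup (single m c * g) 0 = (c when m = 0) * lookup g 0"
  proof (cases "m = 0")
    case True then show ?thesis using lookup_single_mult[of 0 c g 0] by simp
  next
    case False
    then have "0 \<noteq> m + s" for s :: "'v \<Rightarrow>\<^sub>0 nat"
      by (metis add_eq_0_iff_both_eq_0 lookup_add lookup_zero poly_mapping_eqI)
    then show ?thesis using False by (simp add: lookup_single_mult_eq_0)
  qed
  then show ?case using single_add by (simp add: distrib_right lookup_add lookup_single)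
qed simp

lemma ideal_irrelevant_ideal: "ideal (irrelevant_ideal :: ('v, 'k::comm_ring_1) mpol set) mpol_ring"
  by (simp add: ideal_mpol_ring_iff irrelevant_ideal_def lookup_add lookup_mult_0)

text \<open>The restriction of a polynomial to the \<open>i\<close>-th coordinate axis.\<close>

definition axis_poly :: "'v \<Rightarrow> ('v, 'k::comm_ring_1) mpol \<Rightarrow> 'k poly" where
  "axis_poly i f = (\<Sum>m\<in>keys f. if m = single i (lookup m i) then Polynomial.monom (lookup f m) (lookup m i) else 0)"

lemma axis_poly_0 [simp]: "axis_poly i 0 = 0"
  by (simp add: axis_poly_def)

lemma axis_poly_add: "axis_poly i (f + g) = axis_poly i f + axis_poly i g"
  unfolding axis_poly_def by (rule setsum_keys_plus_distrib) (simp_all add: add_monom)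

lemma axis_poly_single: "axis_poly i (single m c) = (if m = single i (lookup m i) then Polynomial.monom c (lookup m i) else 0)"
  by (simp add: axis_poly_def)

lemma add_eq_single_iff:
  "s + t = single i (lookup (s + t) i) \<longleftrightarrow>
      s = single i (lookup s i) \<and> t = single i (lookup t i)" for s t :: "'v \<Rightarrow>\<^sub>0 nat"
proof -
  have "s = single i (lookup s i) \<longleftrightarrow>
      (\<forall>j. j \<noteq> i \<longrightarrow> lookup s j = 0)" for s :: "'v \<Rightarrow>\<^sub>0 nat"
    by (auto simp: poly_mapping_eq_iff fun_eq_iff lookup_single when_def)
  from this[of s] this[of t] this[of "s + t"] show ?thesis by (auto simp: lookup_add)
qed

lemma axis_poly_mult: "axis_poly i (f * g) = axis_poly i f * axis_poly i g"
proof (induction f rule: poly_induct)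
  case (single_add m c f)
  have "axis_poly i (single m c * g) = axis_poly i (single m c) * axis_poly i g"
  proof (induction g rule: poly_induct)
    case (single_add s a g)
    have "axis_poly i (single (m + s) (c * a)) = axis_poly i (single m c) * axis_poly i (single s a)"
      using add_eq_single_iff[of m s i] by (auto simp: axis_poly_single mult_monom lookup_add)
    then show ?case using single_add by (simp add: distrib_left axis_poly_add mult_single)
  qed simp
  then show ?case using single_add by (simp add: distrib_right axis_poly_add)
qed simp

lemma coeff_axis_poly: "coeff (axis_poly i f) k = lookup f (single i k)"
proof (induction f rule: poly_induct)
  case (single_add m c f)
  have "coeff (axis_poly i (single m c)) k = lookup (single m c) (single i k)"
    by (auto simp: axis_poly_single lookup_single when_def coeff_monom)
  then show ?case using single_add by (simp add: axis_poly_add lookup_add)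
qed simp

text \<open>If a power of \<open>X_i\<close> occurred in an initial form, every term of the
  polynomial would have at least its degree. Since \<open>n i\<close> is strictly smallest, another
  term of the same weight would have smaller degree. So the power would be the only term of its
  weight, with nonzero coefficient sum.\<close>

lemma tangent_cone_ideal_vanishes_on_axis:
  assumes pos: "0 < n i" and min: "\<And>j. j \<noteq> i \<Longrightarrow>
      n i < n j" and f: "f \<in> tangent_cone_ideal n"
  shows "axis_poly i f = 0"
proof -
  let ?P = "{f :: ('a, 'b) mpol. axis_poly i f = 0}"
  have P: "ideal ?P mpol_ring" by (simp add: ideal_mpol_ring_iff axis_poly_add axis_poly_mult)
  have "axis_poly i (initial_form F) = 0" if F: "F \<in> toric_ideal n" "F \<noteq> 0" for F :: "('a, 'b) mpol"
  proof (rule poly_eqI, rule ccontr)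
    fix k
    define D where "D = Min (mdeg ` keys F)"
    assume "coeff (axis_poly i (initial_form F)) k \<noteq> coeff 0 k"
    then have nz: "lookup F (single i k) \<noteq> 0" and k: "mdeg (single i k) = D"
      by (auto simp: coeff_axis_poly initial_form_def homogeneous_component_eq lookup_degree_part D_def split: if_splits)
    have "weight_sum n (weight n (single i k)) F = (\<Sum>m\<in>keys F. if m = single i k then lookup F m else 0)"
      unfolding weight_sum_def
    proof (rule sum.cong)
      fix m assume m: "m \<in> keys F"
      have "m = single i k" if w: "weight n m = weight n (single i k)"
      proof -
        \<comment> \<open>The weight is \<open>n i\<close> times the degree plus a nonnegative
          excess, which vanishes only on powers of \<open>X_i\<close>.\<close>
        have *: "weight n s = n i * mdeg s + (\<Sum>j\<in>UNIV. lookup s j * (n j - n i))" for s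
        proof -
          have "n i \<le> n j" for j using min[of j] by (cases "j = i") auto
          then have "lookup s j * n j = n i * lookup s j + lookup s j * (n j - n i)" for j
            by (metis add.commute le_add_diff_inverse mult.commute distrib_left)
          then show ?thesis by (simp add: weight_def mdeg_def sum.distrib sum_distrib_left)
        qed
        have "k \<le> mdeg m" unfolding k[unfolded mdeg_single] D_def using m by (intro Min_le) auto
        then have "n i * k \<le> n i * mdeg m" by simp
        moreover have "n i * mdeg m + (\<Sum>j\<in>UNIV. lookup m j * (n j - n i)) = n i * k"
          using w *[of m] by (simp add: weight_single mult.commute)
        ultimately have S: "(\<Sum>j\<in>UNIV. lookup m j * (n j - n i)) = 0" and "n i * mdeg m = n i * k" by linarith+
        have "lookup m j = 0" if "j \<noteq> i" for j using S min[OF that] by auto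
        then have mi: "m = single i (lookup m i)"
          by (auto simp: poly_mapping_eq_iff fun_eq_iff lookup_single when_def)
        then have "mdeg m = lookup m i" using mdeg_single by metis
        then show ?thesis using mi pos \<open>n i * mdeg m = n i * k\<close> by auto
      qed
      then show "(if weight n m = weight n (single i k) then lookup F m else 0) = (if m = single i k then lookup F m else 0)" by auto
    qed simp
    also have "\<dots> = lookup F (single i k)" using nz by (simp add: in_keys_iff)
    finally show False using F nz by (simp add: toric_ideal_iff)
  qed
  then have "initial_form ` (toric_ideal n - {0}) \<subseteq> ?P" by blast
  then have "tangent_cone_ideal n \<subseteq> ?P"
    unfolding tangent_cone_ideal_def by (rule ring.genideal_minimal[OF ring_from_type_algebra P])
  then show ?thesis using f by blast
qed

text \<open>The polynomials vanishing on the \<open>i\<close>-th axis form a prime ideal that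
  contains \<open>I\<close> and lies properly in the irrelevant ideal. So the latter has height at
  least one modulo \<open>I\<close>, by hypothesis also depth at least one, and \<open>h\<close>
  represents the first element of a regular sequence.\<close>

lemma cohen_macaulay_imp_regular_element:
  fixes I :: "('v, 'k::field) mpol set"
  assumes cm: "cohen_macaulay (mpol_ring Quot I)" and I: "ideal I mpol_ring"
    and axis: "\<And>f. f \<in> I \<Longrightarrow> axis_poly i f = 0"
  shows "\<exists>h. lookup h 0 = 0 \<and> (\<forall>f. h * f \<in> I \<longrightarrow> f \<in> I)"
proof -
  let ?Q = "mpol_ring Quot I" and ?\<pi> = "\<lambda>f. I +>\<^bsub>mpol_ring\<^esub> f"
  interpret Q: cring ?Q by (rule ideal.quotient_is_cring[OF I cring_mpol_ring])
  define P :: "('v, 'k) mpol set" where "P = {f. axis_poly i f = 0}"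
  define M :: "('v, 'k) mpol set" where "M = irrelevant_ideal"
  have P: "ideal P mpol_ring" by (simp add: P_def ideal_mpol_ring_iff axis_poly_add axis_poly_mult)
  have M: "ideal M mpol_ring" unfolding M_def by (rule ideal_irrelevant_ideal)
  have IP: "I \<subseteq> P" using axis by (auto simp: P_def)
  have PM: "P \<subseteq> M"
  proof
    fix f assume "f \<in> P"
    then show "f \<in> M" using coeff_axis_poly[of i f 0] by (simp add: P_def M_def irrelevant_ideal_def)
  qed
  have IM: "I \<subseteq> M" using IP PM by blast
  have maxM: "maximalideal (?\<pi> ` M) ?Q"
  proof (rule maximalideal_mpol_coset_image[OF I M IM])
    show "\<exists>g. 1 - g * f \<in> M" if "f \<notin> M" for f
      using that by (intro exI[of _ "single 0 (inverse (lookup f 0))"])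
        (simp add: M_def irrelevant_ideal_def lookup_minus lookup_mult_0)
  qed (simp add: M_def irrelevant_ideal_def)
  have primeP: "primeideal (?\<pi> ` P) ?Q"
  proof (rule primeideal_mpol_coset_image[OF I P IP])
    have "coeff (axis_poly i (1 :: ('v, 'k) mpol)) 0 \<noteq> 0" by (simp add: coeff_axis_poly)
    then show "1 \<notin> P" unfolding P_def by force
    show "f \<in> P \<or> g \<in> P" if "f * g \<in> P" for f g using that by (auto simp: P_def axis_poly_mult)
  qed
  have strict: "?\<pi> ` P \<subset> ?\<pi> ` M"
  proof -
    have "coeff (axis_poly i (indet i :: ('v, 'k) mpol)) 1 \<noteq> 0" by (simp add: coeff_axis_poly)
    then have "axis_poly i (indet i :: ('v, 'k) mpol) \<noteq> 0" by force
    then have "indet i \<notin> P" by (simp add: P_def)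
    moreover have "indet i \<in> M" by (simp add: M_def irrelevant_ideal_def lookup_single_not_eq[OF single_neq_0])
    ultimately have "?\<pi> (indet i) \<in> ?\<pi> ` M - ?\<pi> ` P" by (simp add: mpol_coset_image_iff[OF I P IP])
    then show ?thesis using PM by blast
  qed
  have "enat 1 \<le> height ?Q (?\<pi> ` M)"
    unfolding height_def
  proof (rule SUP_upper, rule CollectI,
      rule exI[of _ "\<lambda>j. if j = (0::nat) then ?\<pi> ` P else ?\<pi> ` M"], intro conjI allI impI)
    show "primeideal (if j = 0 then ?\<pi> ` P else ?\<pi> ` M) ?Q" for j :: nat
      using primeP Q.maximalideal_prime[OF maxM] by simp
  qed (use strict in auto)
  moreover have "depth ?Q (?\<pi> ` M) = height ?Q (?\<pi> ` M)"
    using cm maxM unfolding cohen_macaulay_def by blast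
  ultimately have "0 < depth ?Q (?\<pi> ` M)" by (simp add: Suc_ile_eq zero_enat_def)
  then obtain xs where xs: "regular_sequence ?Q xs" "set xs \<subseteq> ?\<pi> ` M" "0 < length xs"
    unfolding depth_def less_SUP_iff by (auto simp flip: enat_0)
  then have "xs ! 0 \<in> ?\<pi> ` M" using nth_mem by blast
  then obtain h where h: "h \<in> M" "xs ! 0 = ?\<pi> h" by blast
  \<comment> \<open>The first element of a regular sequence is a nonzerodivisor modulo the ideal
    generated by no elements, which is zero.\<close>
  have Idl: "Idl\<^bsub>?Q\<^esub> {} = {\<zero>\<^bsub>?Q\<^esub>}"
  proof
    show "Idl\<^bsub>?Q\<^esub> {} \<subseteq> {\<zero>\<^bsub>?Q\<^esub>}" by (intro Q.genideal_minimal Q.zeroideal) simp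
    show "{\<zero>\<^bsub>?Q\<^esub>} \<subseteq> Idl\<^bsub>?Q\<^esub> {}" using additive_subgroup.zero_closed[OF ideal.axioms(1)[OF Q.genideal_ideal]] by simp
  qed
  have "f \<in> I" if "h * f \<in> I" for f
  proof -
    have "xs ! 0 \<otimes>\<^bsub>?Q\<^esub> ?\<pi> f \<in> Idl\<^bsub>?Q\<^esub> (set (take 0 xs))"
      using that by (simp add: h mpol_coset_mult[OF I] Idl zero_mpol_quotient mpol_coset_eq_iff[OF I])
    moreover have "?\<pi> f \<in> carrier ?Q" by (simp add: carrier_mpol_quotient)
    ultimately have "?\<pi> f \<in> Idl\<^bsub>?Q\<^esub> (set (take 0 xs))"
      using xs(1,3) unfolding regular_sequence_def by blast
    then show ?thesis by (simp add: Idl zero_mpol_quotient mpol_coset_eq_iff[OF I])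
  qed
  then show ?thesis using h(1) by (auto simp: M_def irrelevant_ideal_def)
qed

text \<open>A socle argument. If \<open>f\<close> is not in \<open>I\<close>, there is a monomial
  without \<open>X_i\<close>, of maximal degree, whose product with \<open>f\<close> is outside
  \<open>I\<close>; it exists because powers of the other variables lie in \<open>I\<close>. Every
  variable multiplies this product into \<open>I\<close>, hence so does \<open>h\<close>, which has
  no constant term. This contradicts the regularity of \<open>h\<close>.\<close>

lemma regular_var:
  fixes I :: "('v::finite, 'k::comm_ring_1) mpol set"
  assumes I: "ideal I mpol_ring" and h: "lookup h 0 = 0" "\<And>f. h * f \<in> I \<Longrightarrow> f \<in> I"
    and nil: "\<And>j. j \<noteq> i \<Longrightarrow> single (single j (N j)) 1 \<in> I" and f: "indet i * f \<in> I"
  shows "f \<in> I"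
proof (rule ccontr)
  assume nf: "f \<notin> I"
  let ?S = "\<lambda>M. lookup M i = 0 \<and> single M 1 * f \<notin> I"
  have bound: "lookup M j \<le> N j" if M: "?S M" for M j
  proof (rule ccontr)
    assume lt: "\<not> lookup M j \<le> N j"
    then have "j \<noteq> i" using M by auto
    have "M = (M - single j (N j)) + single j (N j)"
      using lt by (intro poly_mapping_eqI) (auto simp: lookup_add lookup_minus lookup_single when_def)
    then have "single M 1 * f = (single (M - single j (N j)) 1 * f) * single (single j (N j)) 1"
      by (metis (no_types, lifting) mult.assoc mult.commute mult.right_neutral mult_single)
    then show False using M mpol_ideal_mult[OF I nil[OF \<open>j \<noteq> i\<close>]] by simp
  qed
  have "\<forall>M. ?S M \<longrightarrow> mdeg M < Suc (\<Sum>j\<in>UNIV. N j)"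
    unfolding mdeg_def using bound by (auto simp: less_Suc_eq_le intro!: sum_mono)
  moreover have "?S 0" using nf by simp
  ultimately obtain M where M: "?S M" and max: "\<And>L. ?S L \<Longrightarrow> mdeg L \<le> mdeg M"
    using ex_has_greatest_nat[of ?S 0 mdeg] by blast
  have var_mult: "indet j * (single M 1 * f) \<in> I" for j
  proof (cases "j = i")
    case True
    then show ?thesis using mpol_ideal_mult[OF I f, of "single M 1"] by (simp add: mult.left_commute)
  next
    case False
    have "mdeg (single j 1 + M) = Suc (mdeg M)"
      by (simp add: mdeg_add mdeg_single)
    then have "\<not> ?S (single j 1 + M)" using max[of "single j 1 + M"] by (metis Suc_n_not_le_n)
    then show ?thesis using False M by (simp add: lookup_add lookup_single mult_single flip: mult.assoc)
  qed
  have "single m c * (single M 1 * f) \<in> I" if "m \<noteq> 0" for m c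
  proof -
    have "\<exists>j. lookup m j \<noteq> 0" using that by (auto simp: poly_mapping_eq_iff fun_eq_iff)
    then obtain j where "lookup m j \<noteq> 0" ..
    then obtain k where "m = single j 1 + k" using split_var[of m j] by auto
    then have "single m c = single k c * indet j" by (simp add: mult_single add.commute)
    then have "single m c * (single M 1 * f) = single k c * (indet j * (single M 1 * f))"
      by (simp only: mult.assoc)
    then show ?thesis using mpol_ideal_mult[OF I var_mult] by simp
  qed
  then have "(\<Sum>m\<in>keys h. single m (lookup h m) * (single M 1 * f)) \<in> I"
    using h(1) by (intro mpol_ideal_sum[OF I]) (metis in_keys_iff)
  then have "h * (single M 1 * f) \<in> I" by (simp add: sum_single_keys flip: sum_distrib_right)
  from h(2)[OF this] show False using M by simp
qed

text \<open>For \<open>j\<close> other than \<open>i\<close>, the power of \<open>X_j\<close> with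
  exponent \<open>n i\<close> has the weight of the power of \<open>X_i\<close> with exponent
  \<open>n j\<close>. The latter has larger degree, so the former is a leading form, as
  \<open>regular_var\<close> demands.\<close>

lemma cohen_macaulay_imp_regular_var:
  fixes n :: "'v::finite \<Rightarrow> nat"
  assumes cm: "cohen_macaulay (mpol_ring Quot (tangent_cone_ideal n :: ('v, 'k::field) mpol set))"
    and pos: "0 < n i"
    and min: "\<And>j. j \<noteq> i \<Longrightarrow>
        n i < n j" and f: "indet i * f \<in> (tangent_cone_ideal n :: ('v, 'k) mpol set)"
  shows "f \<in> tangent_cone_ideal n"
proof -
  have "axis_poly i f = 0" if "f \<in> tangent_cone_ideal n" for f :: "('v, 'k) mpol"
    by (rule tangent_cone_ideal_vanishes_on_axis[OF pos min that])
  from cohen_macaulay_imp_regular_element[OF cm ideal_tangent_cone_ideal this]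
  obtain h :: "('v,
      'k) mpol" where h: "lookup h 0 = 0" "\<And>f. h * f \<in> tangent_cone_ideal n \<Longrightarrow>
      f \<in> tangent_cone_ideal n"
    by blast
  have "single (single j (n i)) 1 \<in> (tangent_cone_ideal n :: ('v, 'k) mpol set)" if "j \<noteq> i" for j
    using binomial_leading_form[of n "single j (n i)" "single i (n j)",
        where 'k='k] min[OF that] by (simp add: weight_single mdeg_single)
  from regular_var[OF ideal_tangent_cone_ideal h this f] show ?thesis .
qed

section \<open>Apery sets\<close>

text \<open>The integer coefficients of Bezout's identity become nonnegative by reduction modulo
  \<open>n i\<close>.\<close>

lemma exists_coprime_combination:
  fixes n :: "'v::finite \<Rightarrow> nat"
  assumes "Gcd (range n) = 1" "0 < n i"
  shows "\<exists>m. weight n m mod n i = r mod n i"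
proof -
  have *: "\<exists>u. (\<Sum>j\<in>A. u j * int (n j)) = int (Gcd (n ` A))" if "finite A" for A
    using that
  proof induction
    case (insert j A)
    then obtain u where u: "(\<Sum>j\<in>A. u j * int (n j)) = int (Gcd (n ` A))" by blast
    obtain a b where ab: "a * int (n j) + b * int (Gcd (n ` A)) = gcd (int (n j)) (int (Gcd (n ` A)))"
      using bezout_int by blast
    have "(\<Sum>k\<in>insert j A. (if k = j then a else b * u k) * int (n k)) = a * int (n j) + b * (\<Sum>k\<in>A. u k * int (n k))"
      using insert.hyps by (simp add: sum_distrib_left mult.assoc) (intro sum.cong, auto)
    also have "\<dots> = int (Gcd (n ` insert j A))" using ab u by (simp add: gcd_int_int_eq)
    finally show ?case by (intro exI[of _ "\<lambda>k. if k = j then a else b * u k"])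
  qed simp
  obtain u where u: "(\<Sum>j\<in>UNIV. u j * int (n j)) = 1" using *[of UNIV] assms(1) by auto
  define e where "e j = nat ((int r * u j) mod int (n i))" for j
  have e: "int (e j) = (int r * u j) mod int (n i)" for j using assms(2) by (simp add: e_def)
  have fin: "finite {j. e j \<noteq> 0}" by simp
  have "int (weight n (Poly_Mapping.Abs_poly_mapping e)) mod int (n i) = (\<Sum>j\<in>UNIV. (int r * u j) mod int (n i) * int (n j)) mod int (n i)"
    using fin by (simp add: weight_def e)
  also have "\<dots> = (\<Sum>j\<in>UNIV. int r * u j * int (n j)) mod int (n i)"
    by (subst mod_sum_eq[symmetric]) (simp add: mod_mult_left_eq, subst mod_sum_eq, simp)
  also have "(\<Sum>j\<in>UNIV. int r * u j * int (n j)) = int r * (\<Sum>j\<in>UNIV. u j * int (n j))"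
    by (simp add: sum_distrib_left mult.assoc)
  finally show ?thesis unfolding u by (intro exI[of _ "Poly_Mapping.Abs_poly_mapping e"]) (simp flip: of_nat_mod)
qed

text \<open>\<open>B\<close> is a set of representatives of the Apery set of the semigroup with respect to \<open>n i\<close>.\<close>

lemma apery_representatives:
  fixes n :: "'v::finite \<Rightarrow> nat"
  assumes gcd: "Gcd (range n) = 1" and pos: "0 < n i"
    and fin: "finite B" and card: "card B \<le> n i"
    and B: "\<And>M. (\<exists>N. weight n N = weight n M \<and> 0 < lookup N i) \<or> (\<exists>N\<in>B. weight n N = weight n M)"
  shows "inj_on (weight n) B"
    and "\<And>M N. M \<in> B \<Longrightarrow> weight n N = weight n M \<Longrightarrow> lookup N i = 0"
proof -
  have "\<exists>N\<in>B. weight n N mod n i = r \<and> (\<forall>M. weight n M mod n i = r \<longrightarrow> weight n N \<le> weight n M)" if r: "r < n i" for r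
  proof -
    let ?P = "\<lambda>k. \<exists>M. weight n M = k \<and> k mod n i = r"
    \<comment> \<open>The least element of the semigroup in its residue class. No factorization of
      it involves \<open>X_i\<close>, as removing \<open>X_i\<close> would give a smaller element of
      the class.\<close>
    define k where "k = (LEAST k. ?P k)"
    have "\<exists>k. ?P k" using exists_coprime_combination[OF gcd pos, of r] r by auto
    then have k: "?P k" unfolding k_def by (rule LeastI_ex)
    have least: "k \<le> weight n M" if "weight n M mod n i = r" for M
      unfolding k_def by (rule Least_le) (use that in auto)
    obtain M where M: "weight n M = k" using k by blast
    have "\<not> (\<exists>N. weight n N = weight n M \<and> 0 < lookup N i)"
    proof
      assume "\<exists>N. weight n N = weight n M \<and> 0 < lookup N i"
      then obtain N where N: "weight n N = weight n M" "0 < lookup N i" by blast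
      then obtain L where L: "N = single i 1 + L" using split_var[of N i] by blast
      then have "k = n i + weight n L" using N M by (simp add: weight_add weight_single)
      then show False using least[of L] k pos by (auto simp: mod_add_self1)
    qed
    then obtain N where "N \<in> B" "weight n N = k" using B[of M] M by auto
    then show ?thesis using k least by auto
  qed
  then obtain \<phi> where \<phi>: "\<And>r. r < n i \<Longrightarrow>
      \<phi> r \<in> B" "\<And>r. r < n i \<Longrightarrow> weight n (\<phi> r) mod n i = r"
    and least: "\<And>r M. r < n i \<Longrightarrow> weight n M mod n i = r \<Longrightarrow>
        weight n (\<phi> r) \<le> weight n M" by metis
  have inj: "inj_on \<phi> {..<n i}" using \<phi>(2) by (metis inj_onI lessThan_iff)
  have "\<phi> ` {..<n i} \<subseteq> B" using \<phi>(1) by auto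
  moreover have "card (\<phi> ` {..<n i}) = n i" using inj by (simp add: card_image)
  \<comment> \<open>The \<open>n i\<close> residue classes have distinct representatives in
    \<open>B\<close>, so the bound on \<open>card B\<close> leaves no room for others.\<close>
  ultimately have eq: "B = \<phi> ` {..<n i}" using card fin by (metis card_seteq)
  have unique: "M = \<phi> (weight n M mod n i)" if "M \<in> B" for M using that \<phi>(2) eq by auto
  show "inj_on (weight n) B" by (rule inj_onI) (metis unique)
  show "lookup N i = 0" if M: "M \<in> B" and N: "weight n N = weight n M" for M N
  proof (rule ccontr)
    assume "lookup N i \<noteq> 0"
    then obtain L where "N = single i 1 + L" using split_var[of N i] by auto
    then have L: "weight n M = n i + weight n L" using N by (simp add: weight_add weight_single)
    then have "weight n L mod n i = weight n M mod n i" by simp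
    from least[OF mod_less_divisor[OF pos] this] have "weight n M \<le> weight n L"
      unfolding unique[OF M, symmetric] .
    then show False using L pos by simp
  qed
qed

section \<open>From normal forms modulo a variable to Betti numbers\<close>

lemma ideal_generated:
  fixes G :: "('v, 'k::comm_ring_1) mpol list"
  shows "ideal {f. \<exists>v. f = (\<Sum>j<length G. v j * G ! j)} mpol_ring"
  unfolding ideal_mpol_ring_iff
proof (intro conjI ballI allI)
  show "0 \<in> {f. \<exists>v. f = (\<Sum>j<length G. v j * G ! j)}"
    by (auto intro!: exI[of _ "\<lambda>_. 0"])
next
  fix f g assume "f \<in> {f. \<exists>v. f = (\<Sum>j<length G. v j * G ! j)}" "g \<in> {f. \<exists>v. f = (\<Sum>j<length G. v j * G ! j)}"
  then obtain v w where "f = (\<Sum>j<length G. v j * G ! j)" "g = (\<Sum>j<length G. w j * G ! j)" by blast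
  then show "f + g \<in> {f. \<exists>v. f = (\<Sum>j<length G. v j * G ! j)}"
    by (auto intro!: exI[of _ "\<lambda>j. v j + w j"] simp: distrib_right sum.distrib)
next
  fix f g assume "f \<in> {f. \<exists>v. f = (\<Sum>j<length G. v j * G ! j)}"
  then obtain v where "f = (\<Sum>j<length G. v j * G ! j)" by blast
  then show "g * f \<in> {f. \<exists>v. f = (\<Sum>j<length G. v j * G ! j)}"
    by (auto intro!: exI[of _ "\<lambda>j. g * v j"] simp: sum_distrib_left mult.assoc)
qed

text \<open>The operator \<delta> discards the terms not divisible by \<open>X_i\<close> and divides
  the others by it. It is linear over polynomials free of \<open>X_i\<close>, so applying it to the
  equation moves the division into the coefficients.\<close>

lemma var_regular_generated:
  fixes G :: "('v, 'k::comm_ring_1) mpol list"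
  assumes Gi: "\<And>j m. j < length G \<Longrightarrow> m \<in> keys (G ! j) \<Longrightarrow> lookup m i = 0"
    and f: "indet i * f = (\<Sum>j<length G. v j * G ! j)"
  shows "\<exists>u. f = (\<Sum>j<length G. u j * G ! j)"
proof -
  let ?e = "single i 1 :: 'v \<Rightarrow>\<^sub>0 nat"
  define \<delta> :: "('v, 'k) mpol \<Rightarrow> ('v, 'k) mpol" where "\<delta> = Poly_Mapping.map_key ((+) ?e)"
  have inj: "inj ((+) ?e)" by simp
  have \<delta>: "lookup (\<delta> f) k = lookup f (?e + k)" for f k
    unfolding \<delta>_def map_key.rep_eq[OF inj] by simp
  have \<delta>_add: "\<delta> (f + g) = \<delta> f + \<delta> g" and \<delta>_0: "\<delta> 0 = 0" for f g
    by (rule poly_mapping_eqI, simp add: \<delta> lookup_add)+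
  have \<delta>_sum: "\<delta> (sum h A) = (\<Sum>x\<in>A. \<delta> (h x))" for h :: "'c \<Rightarrow> _" and A
    by (induction A rule: infinite_finite_induct) (simp_all add: \<delta>_add \<delta>_0)
  have \<delta>_single: "\<delta> (single m c * f) = single m c * \<delta> f" if "lookup m i = 0" for m c f
  proof (rule poly_mapping_eqI)
    fix k
    show "lookup (\<delta> (single m c * f)) k = lookup (single m c * \<delta> f) k"
    proof (cases "\<exists>s. k = m + s")
      case True
      then obtain s where k: "k = m + s" by blast
      then have "?e + k = m + (?e + s)" by (simp add: ac_simps)
      then show ?thesis unfolding \<delta> by (simp add: k lookup_single_mult \<delta> del: One_nat_def)
    next
      case False
      have "?e + k \<noteq> m + s" for s
      proof
        assume eq: "?e + k = m + s"
        have "0 < lookup s i" using arg_cong[OF eq, of "\<lambda>m. lookup m i"] that by (simp add: lookup_add)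
        then obtain t where "s = ?e + t" using split_var[of s i] by auto
        then have "k = m + t" using eq by (metis add.left_commute add_left_imp_eq)
        then show False using False by blast
      qed
      then show ?thesis using False by (simp add: \<delta> lookup_single_mult_eq_0 del: One_nat_def)
    qed
  qed
  have \<delta>_mult: "\<delta> (g * f) = g * \<delta> f" if "\<And>m. m \<in> keys g \<Longrightarrow>
      lookup m i = 0" for g f
  proof -
    have "\<delta> ((\<Sum>m\<in>keys g. single m (lookup g m)) * f) = (\<Sum>m\<in>keys g. single m (lookup g m)) * \<delta> f"
      using that by (simp add: sum_distrib_right \<delta>_sum \<delta>_single)
    then show ?thesis by (simp only: sum_single_keys)
  qed
  have "f = \<delta> (indet i * f)"
    by (rule poly_mapping_eqI) (simp add: \<delta> lookup_single_mult del: One_nat_def)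
  also have "\<dots> = (\<Sum>j<length G. \<delta> (G ! j * v j))" unfolding f by (simp add: \<delta>_sum mult.commute)
  also have "\<dots> = (\<Sum>j<length G. G ! j * \<delta> (v j))"
    using \<delta>_mult Gi by (intro sum.cong) auto
  also have "\<dots> = (\<Sum>j<length G. \<delta> (v j) * G ! j)" by (simp only: mult.commute)
  finally show ?thesis by (intro exI[of _ "\<lambda>j. \<delta> (v j)"])
qed

text \<open>All the combinatorics of a case enters through \<open>B\<close>: a monomial is congruent to a multiple of
  the \<open>i\<close>-th variable, or to an element of \<open>B\<close> of at least the same degree.\<close>

lemma betti_sequence_tangent_cone:
  fixes n :: "'v::finite \<Rightarrow> nat" and G :: "('v, 'k::field) mpol list"
  defines "J \<equiv> {f. \<exists>v. f = (\<Sum>j<length G. v j * G ! j)}"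
  assumes gcd: "Gcd (range n) = 1" and pos: "\<And>j. 0 < n j"
    and nzd: "\<And>f :: ('v, 'k) mpol. indet i * f \<in> tangent_cone_ideal n \<Longrightarrow>
        f \<in> tangent_cone_ideal n"
    and fin: "finite B" and card: "card B \<le> n i"
    and B: "\<And>M. lookup M i = 0 \<Longrightarrow> (\<exists>N. weight n N = weight n M \<and> 0 < lookup N i) \<or>
      (\<exists>N\<in>B. weight n N = weight n M \<and> mdeg M \<le> mdeg N \<and> (mdeg M = mdeg N \<longrightarrow> single M 1 - single N 1 \<in> J))"
    and B': "\<And>M. lookup M i = 0 \<Longrightarrow> single M 1 \<notin> J \<Longrightarrow>
      \<exists>N\<in>B. weight n N = weight n M \<and> mdeg M = mdeg N \<and> single M 1 - single N 1 \<in> J"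
    and G: "\<And>j. j < length G \<Longrightarrow> \<exists>q. G ! j + indet i * q \<in> tangent_cone_ideal n"
    and Gi: "\<And>j m. j < length G \<Longrightarrow> m \<in> keys (G ! j) \<Longrightarrow> lookup m i = 0"
    and res: "list_resolution G C D"
    and len: "length d1 = length G" "length d2 = length C" "length d3 = length D"
    and hG: "\<And>j. j < length G \<Longrightarrow> homogeneous (d1 ! j) (G ! j) \<and> lookup (G ! j) 0 = 0"
    and hC: "\<And>j k. j < length C \<Longrightarrow> k < length G \<Longrightarrow>
        homogeneous (d2 ! j - d1 ! k) (C ! j ! k) \<and> lookup (C ! j ! k) 0 = 0"
    and hD: "\<And>j k. j < length D \<Longrightarrow> k < length C \<Longrightarrow>
        homogeneous (d3 ! j - d2 ! k) (D ! j ! k) \<and> lookup (D ! j ! k) 0 = 0"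
  shows "quotient_betti_sequence (tangent_cone_ideal n :: ('v, 'k) mpol set) (1, length G, length C, length D)"
proof -
  let ?I = "tangent_cone_ideal n :: ('v, 'k) mpol set" and ?z = "indet i :: ('v, 'k) mpol"
  have J: "ideal J mpol_ring" unfolding J_def by (rule ideal_generated)
  have "(\<exists>N. weight n N = weight n M \<and> 0 < lookup N i) \<or> (\<exists>N\<in>B. weight n N = weight n M)" for M
    using B[of M] by (cases "lookup M i = 0") auto
  note apery = apery_representatives[OF gcd pos fin card this]
  \<comment> \<open>Both \<open>M\<close> and \<open>N\<close> lead to elements of \<open>B\<close>
    of the same weight, which coincide since \<open>weight n\<close> is injective on
    \<open>B\<close>. This element has the degree of \<open>M\<close> and at least the degree of
    \<open>N\<close>, so all degrees agree and the congruences modulo \<open>J\<close> become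
    available.\<close>
  have key: "mdeg N = mdeg M \<and> lookup N i = 0 \<and> single N 1 \<notin> J \<and> single N 1 - single M 1 \<in> J"
    if M: "lookup M i = 0" "single M 1 \<notin> J" and N: "weight n N = weight n M" "mdeg M \<le> mdeg N" for M N
  proof -
    obtain L where L: "L \<in> B" "weight n L = weight n M" "mdeg M = mdeg L" "single M 1 - single L 1 \<in> J"
      using B'[OF M] by blast
    have free: "lookup K i = 0" if "weight n K = weight n M" for K
      using apery(2)[OF L(1), of K] that L(2) by simp
    then have Ni: "lookup N i = 0" using N by blast
    then obtain L' where L': "L' \<in> B" "weight n L' = weight n N" "mdeg N \<le> mdeg L'"
        "mdeg N = mdeg L' \<Longrightarrow> single N 1 - single L' 1 \<in> J"
      using B[OF Ni] free N(1) by (metis less_numeral_extra(3))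
    have "L' = L" using inj_onD[OF apery(1), of L' L] L L' N(1) by simp
    then have deg: "mdeg N = mdeg M" and NL: "single N 1 - single L 1 \<in> J" using L' L(3) N(2) by auto
    have NM: "single N 1 - single M 1 \<in> J" using mpol_ideal_diff[OF J NL L(4)] by simp
    then have "single N 1 \<notin> J" using mpol_ideal_diff[OF J _ NM, of "single N 1"] M(2) by auto
    then show ?thesis using deg Ni NM by blast
  qed
  have IG: "\<exists>v q. f = (\<Sum>j<length G. v j * G ! j) + ?z * q" if "f \<in> ?I" for f
    using tangent_cone_ideal_subset[OF J key that] unfolding J_def by blast
  have z0: "lookup ?z 0 = 0" using single_neq_0[of i] by (simp add: lookup_single)
  have z: "f = 0" if "?z * f = 0" for f using single_mult_cancel[OF that] .
  have z1: "homogeneous 1 ?z" by (rule homogeneous_single) (simp add: mdeg_single)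
  have zJ: "\<exists>u. f = (\<Sum>j<length G. u j * G ! j)" if "?z * f = (\<Sum>j<length G. v j * G ! j)" for f v
    by (rule var_regular_generated[OF Gi that])
  have hG1: "homogeneous (d1 ! j) (G ! j)" if "j < length G" for j using hG[OF that] ..
  have hC1: "homogeneous (d2 ! j - d1 ! k) (C ! j ! k)" if "j < length C" "k < length G" for j k using hC[OF that] ..
  have hD1: "homogeneous (d3 ! j - d2 ! k) (D ! j ! k)" if "j < length D" "k < length C" for j k using hD[OF that] ..
  show ?thesis
  proof (rule resolution_lift[of ?I ?z G C D d1 d2 d3])
    fix G' C' D' P Q R
    assume 1: "\<And>j. j < length G \<Longrightarrow> homogeneous (d1 ! j) (G' j) \<and> G' j = G ! j + ?z * P j"
    and 2: "\<And>j k. j < length C \<Longrightarrow> k < length G \<Longrightarrow>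
        homogeneous (d2 ! j - d1 ! k) (C' j k) \<and> C' j k = C ! j ! k + ?z * Q j k"
    and 3: "\<And>j k. j < length D \<Longrightarrow> k < length C \<Longrightarrow>
        homogeneous (d3 ! j - d2 ! k) (D' j k) \<and> D' j k = D ! j ! k + ?z * R j k"
    and I: "?I = {f. \<exists>v. f = (\<Sum>j<length G. v j * G' j)}"
    and ex: "relations_exact 1 (length G) (length C) (\<lambda>j _. G' j) C'"
    "relations_exact (length G) (length C) (length D) C' D'"
    "relations_exact (length C) (length D) 0 D' (\<lambda>_ _. 0)"
  \<comment> \<open>Lifting changes entries by multiples of \<open>X_i\<close> only, so the constant
    coefficients remain 0 and minimality is kept.\<close>
  have G'0: "lookup (G' j) 0 = 0" if "j < length G" for j
    using 1[OF that] hG[OF that] z0 by (simp add: lookup_add lookup_mult_0 del: One_nat_def)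
  have C'0: "lookup (C' j k) 0 = 0" if "j < length C" "k < length G" for j k
    using 2[OF that] hC[OF that] z0 by (simp add: lookup_add lookup_mult_0 del: One_nat_def)
  have D'0: "lookup (D' j k) 0 = 0" if "j < length D" "k < length C" for j k
    using 3[OF that] hD[OF that] z0 by (simp add: lookup_add lookup_mult_0 del: One_nat_def)
    show ?thesis unfolding len[symmetric]
    by (rule betti_sequence_of_resolution[OF ideal_tangent_cone_ideal, where G = G' and C = C' and B = D'])
      (use I ex conjunct1[OF 1] conjunct1[OF 2] conjunct1[OF 3] G'0 C'0 D'0 len in simp_all)
  qed (fact ideal_tangent_cone_ideal degree_part_tangent_cone_ideal z z1 nzd res zJ hG1 hC1 hD1 G IG)+
qed

section \<open>Monomial reductions\<close>

text \<open>Divisibility of monomials, in terms of exponent vectors.\<close>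

definition adds :: "('v \<Rightarrow>\<^sub>0 nat) \<Rightarrow> ('v \<Rightarrow>\<^sub>0 nat) \<Rightarrow> bool" (infix \<open>adds\<close> 50) where
  "s adds t \<longleftrightarrow> (\<exists>k. t = s + k)"

lemma single_adds_in_ideal:
  fixes J :: "('v, 'k::comm_ring_1) mpol set"
  assumes "ideal J mpol_ring" "single u 1 \<in> J" "u adds m"
  shows "single m c \<in> J"
proof -
  obtain k where "m = u + k" using assms(3) by (auto simp: adds_def)
  then have "single m c = single k c * single u 1" by (simp add: mult_single add.commute)
  then show ?thesis using mpol_ideal_mult[OF assms(1,2)] by simp
qed

lemma colon_monomials:
  fixes r :: "('v, 'k::comm_ring_1) mpol"
  assumes H: "H = map (\<lambda>u. single u 1) U"
    and keys: "\<And>s. lookup r s \<noteq> 0 \<Longrightarrow> \<exists>u\<in>set U. u adds s"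
  shows "\<exists>p. r = (\<Sum>k<length H. p k * H ! k)"
proof -
  let ?Q = "{f. \<exists>p. f = (\<Sum>k<length H. p k * H ! k)}"
  have Q: "ideal ?Q mpol_ring" by (rule ideal_generated)
  have "(\<Sum>s\<in>keys r. single s (lookup r s)) \<in> ?Q"
  proof (rule mpol_ideal_sum[OF Q])
    fix s assume "s \<in> keys r"
    then obtain u where u: "u \<in> set U" "u adds s" using keys by (auto simp: in_keys_iff)
    then obtain k where k: "k < length U" "U ! k = u" by (auto simp: in_set_conv_nth)
    then have "single u 1 = (\<Sum>j<length H. (if j = k then 1 else 0) * H ! j)"
      by (simp add: H if_distrib[of "\<lambda>x. x * _"] cong: if_cong)
    then have "single u 1 \<in> ?Q" by (intro CollectI exI[of _ "\<lambda>j. if j = k then 1 else 0"])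
    then show "single s (lookup r s) \<in> ?Q" using u(2) by (rule single_adds_in_ideal[OF Q])
  qed
  then show ?thesis unfolding sum_single_keys by blast
qed

lemma lookup_mult_eq_0:
  fixes f g :: "('v, 'k::comm_ring_1) mpol"
  assumes "\<And>\<kappa>. \<kappa> \<in> keys g \<Longrightarrow> \<not> \<kappa> adds t"
  shows "lookup (f * g) t = 0"
proof -
  have "lookup ((\<Sum>m\<in>keys g. single m (lookup g m)) * f) t = 0"
    unfolding sum_distrib_right lookup_sum using assms
    by (intro sum.neutral ballI lookup_single_mult_eq_0) (auto simp: adds_def)
  then show ?thesis by (simp only: sum_single_keys mult.commute)
qed

text \<open>A multiple of a generator can contribute to a monomial only through a term of the
  generator that divides it. For monomial generators this membership test is exact, for binomials it
  is one-sided.\<close>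

lemma lookup_generated_eq_0:
  fixes G :: "('v, 'k::comm_ring_1) mpol list"
  assumes "\<And>g \<kappa>. g \<in> set G \<Longrightarrow> \<kappa> \<in> keys g \<Longrightarrow>
      \<not> \<kappa> adds t"
  shows "lookup (\<Sum>i<length G. v i * G ! i) t = 0"
  unfolding lookup_sum by (intro sum.neutral ballI lookup_mult_eq_0) (use assms nth_mem in blast)

lemma colon_monomial:
  fixes r :: "('v, 'k::comm_ring_1) mpol"
  assumes eq: "r * single m 1 = (\<Sum>i<length G. v i * G ! i)"
    and H: "H = map (\<lambda>u. single u 1) U"
    and div: "\<And>s. (\<exists>g\<in>set G. \<exists>\<kappa>\<in>keys g. \<kappa> adds s + m) \<Longrightarrow> \<exists>u\<in>set U. u adds s"
  shows "\<exists>p. r = (\<Sum>k<length H. p k * H ! k)"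
proof (rule colon_monomials[OF H], rule ccontr)
  fix s assume s: "lookup r s \<noteq> 0" and "\<not> (\<exists>u\<in>set U. u adds s)"
  then have "\<not> (\<exists>g\<in>set G. \<exists>\<kappa>\<in>keys g. \<kappa> adds s + m)" using div by blast
  then have "lookup (r * single m 1) (s + m) = 0" unfolding eq by (intro lookup_generated_eq_0) blast
  then show False using s lookup_single_mult[of m 1 r s] by (simp add: mult.commute add.commute)
qed

lemma monomial_regular:
  fixes r :: "('v, 'k::comm_ring_1) mpol"
  assumes "r * single u 1 = 0" shows "r = 0"
  using single_mult_cancel[of u r] assms by (simp add: mult.commute)

text \<open>The set \<open>E\<close> collects monomials whose weight has a factorization with
  \<open>X_i\<close>. A rule replaces a monomial by one of the same weight and no smaller degree,
  and \<open>lead\<close> is the resulting leading form. The measure \<open>\<mu>\<close> ends the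
  rewriting, and \<open>cover\<close> places the irreducible monomials in \<open>B\<close>;
  induction on \<open>\<mu>\<close> then yields what \<open>betti_sequence_tangent_cone\<close>
  requires of \<open>B\<close>.\<close>

lemma betti_sequence_by_rewriting:
  fixes n :: "'v::finite \<Rightarrow> nat" and G :: "('v, 'k::field) mpol list"
    and lead :: "('v \<Rightarrow>\<^sub>0 nat) \<Rightarrow> ('v \<Rightarrow>\<^sub>0 nat) \<Rightarrow> ('v, 'k) mpol"
  defines "J \<equiv> {f. \<exists>v. f = (\<Sum>j<length G. v j * G ! j)}"
    and "lead \<equiv> \<lambda>l r. single l 1 - (if mdeg l = mdeg r then single r 1 else 0)"
  assumes gcd: "Gcd (range n) = 1" and pos: "\<And>j. 0 < n j"
    and nzd: "\<And>f :: ('v, 'k) mpol. indet i * f \<in> tangent_cone_ideal n \<Longrightarrow>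
        f \<in> tangent_cone_ideal n"
    and fin: "finite B" and card: "card B \<le> n i"
    and E: "\<And>u. u \<in> E \<Longrightarrow> \<exists>v. weight n v = weight n u \<and> 0 < lookup v i"
    and rules: "\<And>l r. (l, r) \<in> rules \<Longrightarrow>
        weight n l = weight n r \<and> lookup r i = 0 \<and> mdeg l \<le> mdeg r"
    and decr: "\<And>l r s. (l, r) \<in> rules \<Longrightarrow> \<mu> (r + s) < (\<mu> (l + s) :: nat)"
    and cover: "\<And>M. lookup M i = 0 \<Longrightarrow> \<forall>u\<in>E. \<not> u adds M \<Longrightarrow>
        \<forall>(l, r)\<in>rules. \<not> l adds M \<Longrightarrow> M \<in> B"
    and EJ: "\<And>u. u \<in> E \<Longrightarrow> single u 1 \<in> J"
    and rJ: "\<And>l r. (l, r) \<in> rules \<Longrightarrow> lead l r \<in> J"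
    and G: "\<And>g. g \<in> set G \<Longrightarrow> (\<exists>u\<in>E. g = single u 1) \<or> (\<exists>(l,
        r)\<in>rules. g = lead l r)"
    and Gi: "\<And>g m. g \<in> set G \<Longrightarrow> m \<in> keys g \<Longrightarrow> lookup m i = 0"
    and res: "list_resolution G C D"
    and len: "length d1 = length G" "length d2 = length C" "length d3 = length D"
    and hG: "\<And>j. j < length G \<Longrightarrow> homogeneous (d1 ! j) (G ! j) \<and> lookup (G ! j) 0 = 0"
    and hC: "\<And>j k. j < length C \<Longrightarrow> k < length G \<Longrightarrow>
        homogeneous (d2 ! j - d1 ! k) (C ! j ! k) \<and> lookup (C ! j ! k) 0 = 0"
    and hD: "\<And>j k. j < length D \<Longrightarrow> k < length C \<Longrightarrow>
        homogeneous (d3 ! j - d2 ! k) (D ! j ! k) \<and> lookup (D ! j ! k) 0 = 0"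
  shows "quotient_betti_sequence (tangent_cone_ideal n :: ('v, 'k) mpol set) (1, length G, length C, length D)"
proof -
  have J: "ideal J mpol_ring" unfolding J_def by (rule ideal_generated)
  have ap: "\<exists>N. weight n N = weight n M \<and> 0 < lookup N i" if u: "u \<in> E" "u adds M" for u M
  proof -
    obtain v k where "weight n v = weight n u" "0 < lookup v i" "M = u + k" using E[OF u(1)] u(2) by (auto simp: adds_def)
    then show ?thesis by (intro exI[of _ "v + k"]) (simp add: weight_add lookup_add)
  qed
  have B: "(\<exists>N. weight n N = weight n M \<and> 0 < lookup N i) \<or>
      (\<exists>N\<in>B. weight n N = weight n M \<and> mdeg M \<le> mdeg N \<and> (mdeg M = mdeg N \<longrightarrow> single M 1 - single N 1 \<in> J))"
    if "lookup M i = 0" for M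
    using that
  proof (induction "\<mu> M" arbitrary: M rule: less_induct)
    case (less M)
    consider u where "u \<in> E" "u adds M" | l r where "(l, r) \<in> rules" "l adds M" | "M \<in> B"
      using cover[OF less(2)] by blast
    then show ?case
    proof cases
      case 1
      then show ?thesis using ap by blast
    next
      case 2
      then obtain s where s: "M = l + s" by (auto simp: adds_def)
      let ?M = "r + s"
      have w: "weight n ?M = weight n M" and deg: "mdeg M \<le> mdeg ?M" and free: "lookup ?M i = 0"
        using rules[OF 2(1)] less(2) by (auto simp: s weight_add mdeg_add lookup_add)
      have J1: "single M 1 - single ?M 1 \<in> J" if "mdeg M = mdeg ?M"
      proof -
        have "single s 1 * lead l r = single M 1 - single ?M 1"
          using that by (simp add: s lead_def right_diff_distrib mult_single add.commute mdeg_add)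
        then show ?thesis using mpol_ideal_mult[OF J rJ[OF 2(1)], of "single s 1"] by simp
      qed
      have "\<mu> ?M < \<mu> M" using decr[OF 2(1)] by (simp add: s)
      from less(1)[OF this free] show ?thesis
      proof
        assume "\<exists>N\<in>B. weight n N = weight n ?M \<and> mdeg ?M \<le> mdeg N \<and> (mdeg ?M = mdeg N \<longrightarrow> single ?M 1 - single N 1 \<in> J)"
        then obtain N where N: "N \<in> B" "weight n N = weight n M" "mdeg ?M \<le> mdeg N"
          "mdeg ?M = mdeg N \<Longrightarrow> single ?M 1 - single N 1 \<in> J" using w by auto
        \<comment> \<open>Degrees never drop along the rewriting, so equal degrees at both ends
          force equality at each step, where the difference lies in \<open>J\<close>.\<close>
        have "single M 1 - single N 1 \<in> J" if "mdeg M = mdeg N"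
        proof -
          have "mdeg M = mdeg ?M" "mdeg ?M = mdeg N" using that deg N(3) by linarith+
          then show ?thesis using mpol_ideal_add[OF J J1 N(4)] by simp
        qed
        then show ?thesis using N deg by (meson order_trans)
      qed (use w in auto)
    next
      case 3
      then show ?thesis using mpol_ideal_0[OF J] by auto
    qed
  qed
  have B': "\<exists>N\<in>B. weight n N = weight n M \<and> mdeg M = mdeg N \<and> single M 1 - single N 1 \<in> J"
    if "lookup M i = 0" "single M 1 \<notin> J" for M
    using that
  proof (induction "\<mu> M" arbitrary: M rule: less_induct)
    case (less M)
    have noE: "\<forall>u\<in>E. \<not> u adds M" using less(3) single_adds_in_ideal[OF J EJ] by blast
    consider l r where "(l, r) \<in> rules" "l adds M" | "M \<in> B"
      using cover[OF less(2) noE] by blast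
    then show ?case
    proof cases
      case 1
      then obtain s where s: "M = l + s" by (auto simp: adds_def)
      let ?M = "r + s"
      \<comment> \<open>A rule that raises the degree has the monomial \<open>l\<close> alone as its
        leading form, which would put \<open>M\<close> into \<open>J\<close>.\<close>
      have deg: "mdeg l = mdeg r"
      proof (rule ccontr)
        assume "mdeg l \<noteq> mdeg r"
        then have "single l 1 \<in> J" using rJ[OF 1(1)] by (simp add: lead_def)
        from single_adds_in_ideal[OF J this 1(2)] show False using less(3) by blast
      qed
      have "single s 1 * lead l r = single M 1 - single ?M 1"
        using deg by (simp add: s lead_def right_diff_distrib mult_single add.commute)
      then have J1: "single M 1 - single ?M 1 \<in> J"
        using mpol_ideal_mult[OF J rJ[OF 1(1)], of "single s 1"] by simp
      have free: "lookup ?M i = 0" using rules[OF 1(1)] less(2) by (auto simp: s lookup_add)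
      have nJ: "single ?M 1 \<notin> J" using mpol_ideal_add[OF J J1, of "single ?M 1"] less(3) by auto
      have "\<mu> ?M < \<mu> M" using decr[OF 1(1)] by (simp add: s)
      from less(1)[OF this free nJ] obtain N where N: "N \<in> B" "weight n N = weight n ?M" "mdeg ?M = mdeg N"
        "single ?M 1 - single N 1 \<in> J" by blast
      have "single M 1 - single N 1 \<in> J" using mpol_ideal_add[OF J J1 N(4)] by simp
      then show ?thesis using N rules[OF 1(1)] deg by (auto simp: s weight_add mdeg_add)
    next
      case 2
      then show ?thesis using mpol_ideal_0[OF J] by auto
    qed
  qed
  have GI: "\<exists>q. G ! j + indet i * q \<in> tangent_cone_ideal n" if "j < length G" for j
    using G[OF nth_mem[OF that]]
  proof
    assume "\<exists>u\<in>E. G ! j = single u 1"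
    then obtain u where u: "u \<in> E" "G ! j = single u 1" by blast
    obtain v where v: "weight n v = weight n u" "0 < lookup v i" using E[OF u(1)] by blast
    show ?thesis unfolding u(2) by (rule nonminimal_in_tangent_cone_ideal[OF pos nzd v])
  next
    assume "\<exists>(l, r)\<in>rules. G ! j = lead l r"
    then obtain l r where lr: "(l, r) \<in> rules" "G ! j = lead l r" by blast
    have "lead l r \<in> tangent_cone_ideal n"
      unfolding lead_def by (rule binomial_leading_form) (use rules[OF lr(1)] in auto)
    then show ?thesis by (intro exI[of _ 0]) (simp add: lr)
  qed
  show ?thesis
    by (rule betti_sequence_tangent_cone[OF gcd pos nzd fin card B[unfolded J_def] B'[unfolded J_def] GI Gi[OF nth_mem] res len hG hC hD])
qed

section \<open>Monomials in four variables\<close>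

definition expo :: "nat \<Rightarrow> nat \<Rightarrow> nat \<Rightarrow> nat \<Rightarrow> (4 \<Rightarrow>\<^sub>0 nat)" where
  "expo i j k l = single 1 i + single 2 j + single 3 k + single 4 l"

definition mon :: "nat \<Rightarrow> nat \<Rightarrow> nat \<Rightarrow> nat \<Rightarrow> (4,
    'k::comm_ring_1) mpol" where
  "mon i j k l = single (expo i j k l) 1"

lemma UNIV_4: "(UNIV :: 4 set) = {1, 2, 3, 4}"
  by (rule card_subset_eq[symmetric]) simp_all

lemma sum_UNIV_4: "sum f (UNIV :: 4 set) = f 1 + f 2 + f 3 + f 4"
proof -
  have "1 \<notin> {2, 3, 4 :: 4}" "2 \<notin> {3, 4 :: 4}" "3 \<notin> {4 :: 4}" by simp_all
  then show ?thesis unfolding UNIV_4 by (simp only: sum.insert finite_insert finite.emptyI sum.empty add.assoc add_0_right not_False_eq_True empty_iff simp_thms)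
qed

lemma lookup_expo [simp]:
  "lookup (expo i j k l) 1 = i" "lookup (expo i j k l) 2 = j"
  "lookup (expo i j k l) 3 = k" "lookup (expo i j k l) 4 = l"
  by (simp_all add: expo_def lookup_add lookup_single)

lemma expo_exhaust: "\<exists>i j k l. m = expo i j k l"
proof -
  have "lookup m i = lookup (expo (lookup m 1) (lookup m 2) (lookup m 3) (lookup m 4)) i" for i
    using UNIV_I[of i] unfolding UNIV_4 by auto
  then show ?thesis by (metis poly_mapping_eqI)
qed

lemma expo_eq_iff [simp]: "expo i j k l = expo i' j' k' l' \<longleftrightarrow>
    i = i' \<and> j = j' \<and> k = k' \<and> l = l'"
  by (metis lookup_expo)

lemma expo_add [simp]: "expo i j k l + expo i' j' k' l' = expo (i + i') (j + j') (k + k') (l + l')"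
  by (simp add: expo_def single_add ac_simps)

lemma expo_0: "expo 0 0 0 0 = 0"
  by (simp add: expo_def)

lemma expo_adds [simp]: "expo i j k l adds expo i' j' k' l' \<longleftrightarrow>
    i \<le> i' \<and> j \<le> j' \<and> k \<le> k' \<and> l \<le> l'"
proof
  assume "expo i j k l adds expo i' j' k' l'"
  then obtain m where m: "expo i' j' k' l' = expo i j k l + m" by (auto simp: adds_def)
  obtain a b c d where "m = expo a b c d" using expo_exhaust by blast
  then show "i \<le> i' \<and> j \<le> j' \<and> k \<le> k' \<and> l \<le> l'" using m by simp
next
  assume "i \<le> i' \<and> j \<le> j' \<and> k \<le> k' \<and> l \<le> l'"
  then have "expo i' j' k' l' = expo i j k l + expo (i' - i) (j' - j) (k' - k) (l' - l)" by simp
  then show "expo i j k l adds expo i' j' k' l'" unfolding adds_def by blast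
qed

lemma colon_mon:
  fixes r :: "(4, 'k::comm_ring_1) mpol"
  assumes eq: "r * mon a b c d = (\<Sum>i<length G. v i * G ! i)"
    and H: "H = map (\<lambda>u. single u 1) U"
    and div: "\<And>i j k l. (\<exists>g\<in>set G. \<exists>\<kappa>\<in>keys g. \<kappa> adds expo (i + a) (j + b) (k + c) (l + d)) \<Longrightarrow> \<exists>u\<in>set U. u adds expo i j k l"
  shows "\<exists>p. r = (\<Sum>k<length H. p k * H ! k)"
proof (rule colon_monomial[OF eq[unfolded mon_def] H])
  fix s assume *: "\<exists>g\<in>set G. \<exists>\<kappa>\<in>keys g. \<kappa> adds s + expo a b c d"
  obtain i j k l where "s = expo i j k l" using expo_exhaust by blast
  then show "\<exists>u\<in>set U. u adds s" using * div[of i j k l] by simp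
qed

lemma mdeg_expo [simp]: "mdeg (expo i j k l) = i + j + k + l"
  by (simp only: mdeg_def sum_UNIV_4 lookup_expo)

lemma weight_expo: "weight n (expo i j k l) = i * n 1 + j * n 2 + k * n 3 + l * n 4"
  by (simp only: weight_def sum_UNIV_4 lookup_expo)

lemma mon_mult [simp]: "mon i j k l * mon i' j' k' l' = mon (i + i') (j + j') (k + k') (l + l')"
  by (simp add: mon_def mult_single)

lemma keys_mon [simp]: "keys (mon i j k l) = {expo i j k l}"
  by (simp add: mon_def)

text \<open>The product of the given term of \<open>r\<close> with the first monomial cannot survive
  in the ideal generated by \<open>G\<close>, so another term of \<open>r\<close> times the second
  monomial must cancel it. This is the descent step for colon ideals of binomials.\<close>

lemma colon_binomial_step:
  fixes r :: "(4, 'k::comm_ring_1) mpol"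
  assumes eq: "r * (mon a b c d - mon a' b' c' d') = (\<Sum>i<length G. v i * G ! i)"
    and s: "lookup r (expo i j k l) \<noteq> 0"
    and nd: "\<forall>g\<in>set G. \<forall>\<kappa>\<in>keys g. \<not> \<kappa> adds expo (i + a) (j + b) (k + c) (l + d)"
  shows "\<exists>i' j' k' l'. i + a = i' + a' \<and> j + b = j' + b' \<and> k + c = k' + c' \<and> l + d = l' + d' \<and> lookup r (expo i' j' k' l') \<noteq> 0"
proof -
  let ?t = "expo a b c d + expo i j k l"
  have t: "?t = expo (i + a) (j + b) (k + c) (l + d)" by (simp add: add.commute)
  have "lookup (r * mon a b c d) ?t = lookup r (expo i j k l)"
    using lookup_single_mult[of "expo a b c d" 1 r "expo i j k l"] by (simp add: mon_def mult.commute del: expo_add)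
  moreover have "lookup (r * (mon a b c d - mon a' b' c' d')) ?t = 0"
    unfolding eq t by (rule lookup_generated_eq_0) (use nd in blast)
  ultimately have nz: "lookup (r * mon a' b' c' d') ?t \<noteq> 0" using s by (simp add: right_diff_distrib lookup_minus del: expo_add)
  have "expo a' b' c' d' adds ?t"
  proof (rule ccontr)
    assume "\<not> expo a' b' c' d' adds ?t"
    then show False using nz lookup_mult_eq_0[of "mon a' b' c' d'" ?t r] by (auto simp: mon_def)
  qed
  then obtain s' where "?t = expo a' b' c' d' + s'" by (auto simp: adds_def)
  moreover obtain i' j' k' l' where "s' = expo i' j' k' l'" using expo_exhaust by blast
  ultimately have s': "?t = expo a' b' c' d' + expo i' j' k' l'" by simp
  have "lookup (r * mon a' b' c' d') (expo a' b' c' d' + expo i' j' k' l') = lookup r (expo i' j' k' l')"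
    using lookup_single_mult[of "expo a' b' c' d'" 1 r "expo i' j' k' l'"] by (simp add: mon_def mult.commute del: expo_add)
  then have "lookup r (expo i' j' k' l') \<noteq> 0" using nz s' by simp
  then show ?thesis using s' by (auto simp: add.commute intro!: exI[of _ i'] exI[of _ j'] exI[of _ k'] exI[of _ l'])
qed

lemma homogeneous_mon [simp]: "homogeneous d (mon i j k l) \<longleftrightarrow> int (i + j + k + l) = d"
  by (simp add: homogeneous_def)

lemma homogeneous_uminus_iff [simp]: "homogeneous d (- f) \<longleftrightarrow>
    homogeneous d f" for f :: "('v::finite, 'k::ab_group_add) mpol"
  using homogeneous_uminus[of d f] homogeneous_uminus[of d "- f"] by auto

lemma lookup_mon_0 [simp]: "lookup (mon i j k l) 0 = (if i + j + k + l = 0 then 1 else 0)"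
  by (simp add: mon_def lookup_single when_def flip: expo_0)

lemma keys_mon_diff: "\<kappa> \<in> keys (mon i j k l - mon i' j' k' l') \<Longrightarrow>
    \<kappa> = expo i j k l \<or> \<kappa> = expo i' j' k' l'"
  using keys_diff[of "mon i j k l" "mon i' j' k' l'"] by auto

section \<open>Resolutions of the monomial and binomial ideals\<close>

lemma mon_regular: "r * mon a b c d = 0 \<Longrightarrow> r = 0" for r :: "(4, 'k::comm_ring_1) mpol"
  unfolding mon_def by (rule monomial_regular)

lemma mon_coprime:
  fixes r s :: "(4, 'k::comm_ring_1) mpol"
  assumes "r * mon a' b' c' d' = s * mon a b c d" "a = 0 \<or> a' = 0" "b = 0 \<or> b' = 0" "c = 0 \<or> c' = 0" "d = 0 \<or> d' = 0"
  shows "\<exists>t. r = t * mon a b c d"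
proof -
  have "r * mon a' b' c' d' = (\<Sum>i<length [mon a b c d]. s * [mon a b c d] ! i)" using assms by simp
  from colon_mon[OF this, of "[mon a b c d]" "[expo a b c d]"] assms show ?thesis
    by (auto simp: mon_def)
qed

lemma list_resolution_koszul_mon:
  fixes u v :: "(4, 'k::comm_ring_1) mpol"
  assumes "a = 0 \<or> a' = 0" "b = 0 \<or> b' = 0" "c = 0 \<or> c' = 0" "d = 0 \<or> d' = 0"
  shows "list_resolution [mon a b c d, mon a' b' c' d'] [[mon a' b' c' d' :: (4, 'k) mpol, - mon a b c d]] []"
  by (rule list_resolution_koszul) (erule mon_regular, erule mon_coprime[OF _ assms])

lemma list_resolution_mon: "list_resolution [mon a b c d :: (4, 'k::comm_ring_1) mpol] [] []"
  by (rule list_resolution_single) (rule mon_regular)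


lemmas eval_simps = sum.lessThan_Suc All_less_Suc

text \<open>The mapping cone with its result given by equations, so that explicit lists are checked
  by simplification rather than matched by unification.\<close>

lemma list_resolution_append:
  fixes m :: "'a::comm_ring_1"
  assumes "list_resolution G C B" and "list_resolution H R []"
    and "\<And>r v. r * m = (\<Sum>i<length G. v i * G ! i) \<Longrightarrow>
        \<exists>p. r = (\<Sum>k<length H. p k * H ! k)"
    and "length a = length H" "\<forall>x\<in>set a. length x = length G"
    and "length w = length R" "\<forall>x\<in>set w. length x = length C"
    and "\<forall>k<length H. H ! k * m = (\<Sum>i<length G. a ! k ! i * G ! i)"
    and "\<forall>l<length R. \<forall>i<length G.
        (\<Sum>k<length H. R ! l ! k * a ! k ! i) = (\<Sum>j<length C. w ! l ! j * C ! j ! i)"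
    and "G' = G @ [m]" "C' = map (\<lambda>c. c @ [0]) C @ map2 (\<lambda>x h. map uminus x @ [h]) a H"
    and "B' = map (\<lambda>b. b @ map (\<lambda>_. 0) H) B @ map2 (@) w R"
  shows "list_resolution G' C' B'"
  using list_resolution_mapping_cone[of G C B H R a w m] assms by simp

text \<open>For a monomial the colon ideal is read off from exponents; \<open>U\<close> lists those
  of its generators.\<close>

lemma list_resolution_append_mon:
  fixes G :: "(4, 'k::comm_ring_1) mpol list"
  assumes "list_resolution G C B" and "list_resolution H R []"
    and H: "H = map (\<lambda>(i, j, k, l). mon i j k l) U"
    and div: "\<And>i j k l. \<exists>g\<in>set G. \<exists>\<kappa>\<in>keys g. \<kappa> adds expo (i + a) (j + b) (k + c) (l + d) \<Longrightarrow>
        \<exists>(i', j', k', l')\<in>set U. i' \<le> i \<and> j' \<le> j \<and> k' \<le> k \<and> l' \<le> l"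
    and "length A = length H" "\<forall>x\<in>set A. length x = length G"
    and "length W = length R" "\<forall>x\<in>set W. length x = length C"
    and "\<forall>k<length H. H ! k * mon a b c d = (\<Sum>i<length G. A ! k ! i * G ! i)"
    and "\<forall>l<length R. \<forall>i<length G.
        (\<Sum>k<length H. R ! l ! k * A ! k ! i) = (\<Sum>j<length C. W ! l ! j * C ! j ! i)"
    and "G' = G @ [mon a b c d]" "C' = map (\<lambda>c. c @ [0]) C @ map2 (\<lambda>x h. map uminus x @ [h]) A H"
    and "B' = map (\<lambda>b. b @ map (\<lambda>_. 0) H) B @ map2 (@) W R"
  shows "list_resolution G' C' B'"
proof (rule list_resolution_append[OF assms(1,2) _ assms(5-)])
  fix r v assume eq: "r * mon a b c d = (\<Sum>i<length G. v i * G ! i)"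
  show "\<exists>p. r = (\<Sum>k<length H. p k * H ! k)"
  proof (rule colon_mon[OF eq, where U = "map (\<lambda>(i, j, k, l). expo i j k l) U"])
    show "H = map (\<lambda>u. single u 1) (map (\<lambda>(i, j, k, l). expo i j k l) U)"
      by (auto simp: H mon_def)
    show "\<exists>u\<in>set (map (\<lambda>(i, j, k, l). expo i j k l) U). u adds expo i j k l"
      if "\<exists>g\<in>set G. \<exists>\<kappa>\<in>keys g. \<kappa> adds expo (i + a) (j + b) (k + c) (l + d)" for i j k l
      using div[OF that] by force
  qed
qed

text \<open>The generators are f_4, f_1, f_3, f_5, f_2 at \<open>X_1 = 0\<close>, up to sign. Each
  list \<open>U\<close> describes the colon ideal of the preceding generators by the one being
  added.\<close>

lemma resolution_n1:
  fixes b c d :: nat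
  assumes "0 < b" "0 < c" "0 < d"
  shows "list_resolution ([mon 0 0 0 (Suc d), mon 0 0 1 d, mon 0 0 (Suc c) 0, mon 0 1 0 d,
      mon 0 (Suc b) 0 0] :: (4, 'k::comm_ring_1) mpol list)
      [[- mon 0 0 1 0, mon 0 0 0 1, 0, 0, 0], [0, - mon 0 0 c 0, mon 0 0 0 d, 0, 0], [- mon 0 1 0 0, 0, 0,
          mon 0 0 0 1, 0], [0, - mon 0 1 0 0, 0, mon 0 0 1 0, 0], [0, 0, 0, - mon 0 b 0 0, mon 0 0 0 d], [0,
          0, - mon 0 (Suc b) 0 0, 0, mon 0 0 (Suc c) 0]]
      [[- mon 0 1 0 0, 0, mon 0 0 1 0, - mon 0 0 0 1, 0, 0], [0, - mon 0 (Suc b) 0 0, 0, mon 0 b c 0,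
          mon 0 0 (Suc c) 0, - mon 0 0 0 d]]"
proof -
  have R2: "list_resolution ([mon 0 0 0 (Suc d), mon 0 0 1 d] :: (4, 'k) mpol list)
      [[- mon 0 0 1 0, mon 0 0 0 1]]
      []"
    by (rule list_resolution_append_mon[OF list_resolution_mon list_resolution_mon, where U = "[(0, 0, 0, 1)]"
        and A = "[[mon 0 0 1 0]]" and W = "[]"])
      (use assms in \<open>auto simp: eval_simps algebra_simps\<close>)
  have R3: "list_resolution ([mon 0 0 0 (Suc d), mon 0 0 1 d, mon 0 0 (Suc c) 0] :: (4, 'k) mpol list)
      [[- mon 0 0 1 0, mon 0 0 0 1, 0], [0, - mon 0 0 c 0, mon 0 0 0 d]]
      []"
    by (rule list_resolution_append_mon[OF R2 list_resolution_mon, where U = "[(0, 0, 0, d)]"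
        and A = "[[0, mon 0 0 c 0]]" and W = "[]"])
      (use assms in \<open>auto simp: eval_simps algebra_simps\<close>)
  have R4: "list_resolution ([mon 0 0 0 (Suc d), mon 0 0 1 d, mon 0 0 (Suc c) 0, mon 0 1 0 d] :: (4, 'k) mpol list)
      [[- mon 0 0 1 0, mon 0 0 0 1, 0, 0], [0, - mon 0 0 c 0, mon 0 0 0 d, 0], [- mon 0 1 0 0, 0, 0,
          mon 0 0 0 1], [0, - mon 0 1 0 0, 0, mon 0 0 1 0]]
      [[- mon 0 1 0 0, 0, mon 0 0 1 0, - mon 0 0 0 1]]"
    by (rule list_resolution_append_mon[OF R3 list_resolution_koszul_mon, where U = "[(0, 0, 0, 1), (0, 0, 1, 0)]"
        and A = "[[mon 0 1 0 0, 0, 0], [0, mon 0 1 0 0, 0]]" and W = "[[- mon 0 1 0 0, 0]]"])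
      (use assms in \<open>auto simp: eval_simps algebra_simps\<close>)
  show ?thesis
    by (rule list_resolution_append_mon[OF R4 list_resolution_koszul_mon, where U = "[(0, 0, 0, d), (0, 0, Suc c, 0)]"
        and A = "[[0, 0, 0, mon 0 b 0 0], [0, 0, mon 0 (Suc b) 0 0, 0]]" and W = "[[0, - mon 0 (Suc b) 0 0,
            0, mon 0 b c 0]]"])
      (use assms in \<open>auto simp: eval_simps algebra_simps\<close>)
qed

text \<open>These are f_3, f_2, f_5 at \<open>X_2 = 0\<close>, up to sign, the common start of the
  three cases for \<open>n 2\<close>.\<close>

lemma resolution_n2:
  fixes c e :: nat
  assumes "0 < c" "0 < e"
  shows "list_resolution ([mon 0 0 (Suc c) 0, mon e 0 0 1, mon (Suc e) 0 c 0] :: (4, 'k::comm_ring_1) mpol list)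
      [[- mon e 0 0 1, mon 0 0 (Suc c) 0, 0], [- mon (Suc e) 0 0 0, 0, mon 0 0 1 0], [0, - mon 1 0 c 0, mon 0 0 0 1]]
      [[- mon 1 0 0 0, mon 0 0 0 1, - mon 0 0 1 0]]"
proof -
  have R2: "list_resolution ([mon 0 0 (Suc c) 0, mon e 0 0 1] :: (4, 'k) mpol list)
      [[- mon e 0 0 1, mon 0 0 (Suc c) 0]]
      []"
    by (rule list_resolution_append_mon[OF list_resolution_mon list_resolution_mon, where U = "[(0, 0, Suc c, 0)]"
        and A = "[[mon e 0 0 1]]" and W = "[]"])
      (use assms in \<open>auto simp: eval_simps algebra_simps\<close>)
  show ?thesis
    by (rule list_resolution_append_mon[OF R2 list_resolution_koszul_mon, where U = "[(0, 0, 1, 0), (0, 0, 0, 1)]"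
        and A = "[[mon (Suc e) 0 0 0, 0], [0, mon 1 0 c 0]]" and W = "[[- mon 1 0 0 0]]"])
      (use assms in \<open>auto simp: eval_simps algebra_simps\<close>)
qed

text \<open>Added are f_4 at \<open>X_2 = 0\<close> and the power of \<open>X_1\<close> in f_1, the
  term of smaller degree when \<alpha>_1 < \<alpha>_4.\<close>

lemma resolution_n2_less:
  fixes c d e p :: nat
  assumes "0 < c" "0 < e" "0 < d" "0 < p"
  shows "list_resolution ([mon 0 0 (Suc c) 0, mon e 0 0 1, mon (Suc e) 0 c 0, mon 0 0 0 (Suc d),
      mon (Suc (e + p)) 0 0 0] :: (4, 'k::comm_ring_1) mpol list)
      [[- mon e 0 0 1, mon 0 0 (Suc c) 0, 0, 0, 0], [- mon (Suc e) 0 0 0, 0, mon 0 0 1 0, 0, 0], [0,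
          - mon 1 0 c 0, mon 0 0 0 1, 0, 0], [- mon 0 0 0 (Suc d), 0, 0, mon 0 0 (Suc c) 0, 0], [0,
          - mon 0 0 0 d, 0, mon e 0 0 0, 0], [0, 0, - mon p 0 0 0, 0, mon 0 0 c 0], [0, - mon (Suc p) 0 0 0,
          0, 0, mon 0 0 0 1]]
      [[- mon 1 0 0 0, mon 0 0 0 1, - mon 0 0 1 0, 0, 0, 0, 0], [- mon 0 0 0 d, 0, 0, mon e 0 0 0,
          - mon 0 0 (Suc c) 0, 0, 0], [0, 0, mon p 0 0 0, 0, 0, mon 0 0 0 1, - mon 0 0 c 0]]"
proof -
  have R2: "list_resolution ([mon 0 0 (Suc c) 0, mon e 0 0 1, mon (Suc e) 0 c 0, mon 0 0 0 (Suc d)] :: (4,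
      'k) mpol list)
      [[- mon e 0 0 1, mon 0 0 (Suc c) 0, 0, 0], [- mon (Suc e) 0 0 0, 0, mon 0 0 1 0, 0], [0, - mon 1 0 c 0,
          mon 0 0 0 1, 0], [- mon 0 0 0 (Suc d), 0, 0, mon 0 0 (Suc c) 0], [0, - mon 0 0 0 d, 0, mon e 0 0 0]]
      [[- mon 1 0 0 0, mon 0 0 0 1, - mon 0 0 1 0, 0, 0], [- mon 0 0 0 d, 0, 0, mon e 0 0 0, - mon 0 0 (Suc c) 0]]"
    by (rule list_resolution_append_mon[OF resolution_n2[OF assms(1,2)] list_resolution_koszul_mon,
        where U = "[(0, 0, Suc c, 0), (e, 0, 0, 0)]"
        and A = "[[mon 0 0 0 (Suc d), 0, 0], [0, mon 0 0 0 d, 0]]" and W = "[[- mon 0 0 0 d, 0, 0]]"])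
      (use assms in \<open>auto simp: eval_simps algebra_simps\<close>)
  show ?thesis
    by (rule list_resolution_append_mon[OF R2 list_resolution_koszul_mon, where U = "[(0, 0, c, 0), (0, 0, 0, 1)]"
        and A = "[[0, 0, mon p 0 0 0, 0], [0, mon (Suc p) 0 0 0, 0, 0]]" and W = "[[0, 0, mon p 0 0 0, 0, 0]]"])
      (use assms in \<open>auto simp: eval_simps algebra_simps\<close>)
qed

text \<open>For \<alpha>_1 = \<alpha>_4 the binomial f_1 is homogeneous; it is added last. In the
  cone, the Koszul relation between the powers of \<open>X_3\<close> and \<open>X_4\<close> becomes
  a combination of the other relations. This is the unit entry that
  \<open>list_resolution_prune\<close> cancels.\<close>

lemma resolution_n2_eq:
  fixes c e p :: nat
  assumes "0 < c" "0 < e" "0 < p"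
  shows "list_resolution ([mon 0 0 (Suc c) 0, mon e 0 0 1, mon (Suc e) 0 c 0, mon 0 0 0 (Suc (e + p)),
      mon (Suc (e + p)) 0 0 0 - mon 0 0 1 (e + p)] :: (4, 'k::comm_ring_1) mpol list)
      [[- mon e 0 0 1, mon 0 0 (Suc c) 0, 0, 0, 0], [- mon (Suc e) 0 0 0, 0, mon 0 0 1 0, 0, 0], [0,
          - mon 1 0 c 0, mon 0 0 0 1, 0, 0], [0, - mon (Suc p) 0 0 0, 0, mon 0 0 1 0, mon 0 0 0 1], [0,
          - mon 0 0 0 (e + p), 0, mon e 0 0 0, 0], [mon 0 0 0 (e + p), 0, - mon p 0 0 0, 0, mon 0 0 c 0]]
      [[- mon 1 0 0 0, mon 0 0 0 1, - mon 0 0 1 0, 0, 0, 0], [- mon 0 0 0 (e + p), 0, - mon (e + p) 0 0 0,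
          mon e 0 c 0, - mon 0 0 (Suc c) 0, - mon e 0 0 1]]"
proof -
  have R2: "list_resolution ([mon 0 0 (Suc c) 0, mon e 0 0 1, mon (Suc e) 0 c 0,
      mon 0 0 0 (Suc (e + p))] :: (4, 'k) mpol list)
      [[- mon e 0 0 1, mon 0 0 (Suc c) 0, 0, 0], [- mon (Suc e) 0 0 0, 0, mon 0 0 1 0, 0], [0, - mon 1 0 c 0,
          mon 0 0 0 1, 0], [- mon 0 0 0 (Suc (e + p)), 0, 0, mon 0 0 (Suc c) 0], [0, - mon 0 0 0 (e + p), 0,
          mon e 0 0 0]]
      [[- mon 1 0 0 0, mon 0 0 0 1, - mon 0 0 1 0, 0, 0], [- mon 0 0 0 (e + p), 0, 0, mon e 0 0 0,
          - mon 0 0 (Suc c) 0]]"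
    by (rule list_resolution_append_mon[OF resolution_n2[OF assms(1,2)] list_resolution_koszul_mon,
        where U = "[(0, 0, Suc c, 0), (e, 0, 0, 0)]"
        and A = "[[mon 0 0 0 (Suc (e + p)), 0, 0], [0, mon 0 0 0 (e + p), 0]]" and W = "[[- mon 0 0 0 (e + p), 0, 0]]"])
      (use assms in \<open>auto simp: eval_simps algebra_simps\<close>)
  have R3: "list_resolution ([mon 0 0 (Suc c) 0, mon e 0 0 1, mon (Suc e) 0 c 0, mon 0 0 0 (Suc (e + p)),
      mon (Suc (e + p)) 0 0 0 - mon 0 0 1 (e + p)] :: (4, 'k) mpol list)
      [[- mon e 0 0 1, mon 0 0 (Suc c) 0, 0, 0, 0], [- mon (Suc e) 0 0 0, 0, mon 0 0 1 0, 0, 0], [0,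
          - mon 1 0 c 0, mon 0 0 0 1, 0, 0], [- mon 0 0 0 (Suc (e + p)), 0, 0, mon 0 0 (Suc c) 0, 0], [0,
          - mon 0 0 0 (e + p), 0, mon e 0 0 0, 0], [mon 0 0 0 (e + p), 0, - mon p 0 0 0, 0, mon 0 0 c 0], [0,
          - mon (Suc p) 0 0 0, 0, mon 0 0 1 0, mon 0 0 0 1]]
      [[- mon 1 0 0 0, mon 0 0 0 1, - mon 0 0 1 0, 0, 0, 0, 0], [- mon 0 0 0 (e + p), 0, 0, mon e 0 0 0,
          - mon 0 0 (Suc c) 0, 0, 0], [0, 0, mon p 0 0 0, 1, 0, mon 0 0 0 1, - mon 0 0 c 0]]"
  proof (rule list_resolution_append[OF R2 list_resolution_koszul_mon,
      where m = "mon (Suc (e + p)) 0 0 0 - mon 0 0 1 (e + p)"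
        and a = "[[- mon 0 0 0 (e + p), 0, mon p 0 0 0, 0], [0, mon (Suc p) 0 0 0, 0,
            - mon 0 0 1 0]]" and w = "[[0, 0, mon p 0 0 0, 1, 0]]"])
    let ?G = "[mon 0 0 (Suc c) 0, mon e 0 0 1, mon (Suc e) 0 c 0, mon 0 0 0 (Suc (e + p))] :: (4,
        'k) mpol list" and ?H = "[mon 0 0 c 0, mon 0 0 0 1] :: (4, 'k) mpol list"
    show "\<exists>p. r = (\<Sum>k<length ?H. p k * ?H ! k)" if "r * (mon (Suc (e + p)) 0 0 0 - mon 0 0 1 (e + p)) = (\<Sum>i<length ?G. v i * ?G ! i)" for r v
    proof (rule colon_monomials[where U = "[expo 0 0 c 0, expo 0 0 0 1]"])
      note eq = that
      fix s assume s: "lookup r s \<noteq> 0"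
      obtain i j k l where ex: "s = expo i j k l" using expo_exhaust by blast
      show "\<exists>u\<in>set [expo 0 0 c 0, expo 0 0 0 1]. u adds s"
      proof (rule ccontr)
        assume "\<not> ?thesis"
        then have kl: "k < c" "l = 0" by (auto simp: ex)
        \<comment> \<open>Times the power of \<open>X_1\<close>, such a monomial is divisible by no
          generator. Cancelling it against the second monomial of the binomial would require a
          factor \<open>X_4\<close>, which it lacks.\<close>
        then have "\<forall>g\<in>set ?G. \<forall>\<kappa>\<in>keys g. \<not> \<kappa> adds expo (i + Suc (e + p)) (j + 0) (k + 0) (l + 0)"
          by auto
        from colon_binomial_step[OF eq s[unfolded ex] this] kl assms show False by auto
      qed
    qed (simp add: mon_def)
  qed (simp_all add: eval_simps algebra_simps)
  show ?thesis
    using list_resolution_prune[where C = "[[- mon e 0 0 1, mon 0 0 (Suc c) 0, 0, 0, 0],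
        [- mon (Suc e) 0 0 0, 0, mon 0 0 1 0, 0, 0], [0, - mon 1 0 c 0, mon 0 0 0 1, 0, 0],
        [- mon 0 0 0 (Suc (e + p)), 0, 0, mon 0 0 (Suc c) 0, 0], [0, - mon 0 0 0 (e + p), 0, mon e 0 0 0, 0],
        [mon 0 0 0 (e + p), 0, - mon p 0 0 0, 0, mon 0 0 c 0]]" and c = "[0, - mon (Suc p) 0 0 0, 0,
        mon 0 0 1 0, mon 0 0 0 1]" and B = "[[- mon 1 0 0 0, mon 0 0 0 1, - mon 0 0 1 0, 0, 0, 0, 0],
        [- mon 0 0 0 (e + p), 0, 0, mon e 0 0 0, - mon 0 0 (Suc c) 0, 0, 0]]" and b = "[0, 0, mon p 0 0 0, 1,
        0, mon 0 0 0 1, - mon 0 0 c 0]" and jj = 3 and G = "[mon 0 0 (Suc c) 0, mon e 0 0 1,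
        mon (Suc e) 0 c 0, mon 0 0 0 (Suc (e + p)), mon (Suc (e + p)) 0 0 0 - mon 0 0 1 (e + p)] :: (4,
        'k) mpol list"] R3
    by (simp add: eval_simps algebra_simps upt_rec numeral_eq_Suc)
qed

text \<open>For \<alpha>_1 > \<alpha>_4 the product of \<open>X_3\<close> and a power of
  \<open>X_4\<close> leads f_1. The sixth generator comes from \<open>X_1^e\<close> times f_1:
  replacing \<open>X_1^e X_4\<close> by a power of \<open>X_2\<close>, as f_2 permits, leaves only a
  power of \<open>X_1\<close> modulo \<open>X_2\<close>. Here \<open>d\<close> is \<alpha>_4 - 2,
  and positivity of \<open>d\<close> keeps the entry \<open>mon 0 0 0 d\<close> from being a
  unit.\<close>

lemma resolution_n2_greater:
  fixes c d e p :: nat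
  assumes "0 < c" "0 < e" "0 < d" "0 < p"
  shows "list_resolution ([mon 0 0 (Suc c) 0, mon e 0 0 1, mon (Suc e) 0 c 0, mon 0 0 1 (Suc d),
      mon 0 0 0 (Suc (Suc d)), mon (Suc (e + e + p)) 0 0 0] :: (4, 'k::comm_ring_1) mpol list)
      [[- mon e 0 0 1, mon 0 0 (Suc c) 0, 0, 0, 0, 0], [- mon (Suc e) 0 0 0, 0, mon 0 0 1 0, 0, 0, 0], [0,
          - mon 1 0 c 0, mon 0 0 0 1, 0, 0, 0], [- mon 0 0 0 (Suc d), 0, 0, mon 0 0 c 0, 0, 0], [0,
          - mon 0 0 1 d, 0, mon e 0 0 0, 0, 0], [0, 0, 0, - mon 0 0 0 1, mon 0 0 1 0, 0], [0,
          - mon 0 0 0 (Suc d), 0, 0, mon e 0 0 0, 0], [0, - mon (Suc (e + p)) 0 0 0, 0, 0, 0, mon 0 0 0 1],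
          [0, 0, - mon (e + p) 0 0 0, 0, 0, mon 0 0 c 0]]
      [[- mon 1 0 0 0, mon 0 0 0 1, - mon 0 0 1 0, 0, 0, 0, 0, 0, 0], [- mon 0 0 0 d, 0, 0, mon e 0 0 0,
          - mon 0 0 c 0, 0, 0, 0, 0], [0, 0, 0, 0, mon 0 0 0 1, mon e 0 0 0, - mon 0 0 1 0, 0, 0], [0, 0,
          - mon (e + p) 0 0 0, 0, 0, 0, 0, mon 0 0 c 0, - mon 0 0 0 1]]"
proof -
  have R2: "list_resolution ([mon 0 0 (Suc c) 0, mon e 0 0 1, mon (Suc e) 0 c 0, mon 0 0 1 (Suc d)] :: (4,
      'k) mpol list)
      [[- mon e 0 0 1, mon 0 0 (Suc c) 0, 0, 0], [- mon (Suc e) 0 0 0, 0, mon 0 0 1 0, 0], [0, - mon 1 0 c 0,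
          mon 0 0 0 1, 0], [- mon 0 0 0 (Suc d), 0, 0, mon 0 0 c 0], [0, - mon 0 0 1 d, 0, mon e 0 0 0]]
      [[- mon 1 0 0 0, mon 0 0 0 1, - mon 0 0 1 0, 0, 0], [- mon 0 0 0 d, 0, 0, mon e 0 0 0, - mon 0 0 c 0]]"
    by (rule list_resolution_append_mon[OF resolution_n2[OF assms(1,2)] list_resolution_koszul_mon,
        where U = "[(0, 0, c, 0), (e, 0, 0, 0)]"
        and A = "[[mon 0 0 0 (Suc d), 0, 0], [0, mon 0 0 1 d, 0]]" and W = "[[- mon 0 0 0 d, 0, 0]]"])
      (use assms in \<open>auto simp: eval_simps algebra_simps\<close>)
  have R3: "list_resolution ([mon 0 0 (Suc c) 0, mon e 0 0 1, mon (Suc e) 0 c 0, mon 0 0 1 (Suc d),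
      mon 0 0 0 (Suc (Suc d))] :: (4, 'k) mpol list)
      [[- mon e 0 0 1, mon 0 0 (Suc c) 0, 0, 0, 0], [- mon (Suc e) 0 0 0, 0, mon 0 0 1 0, 0, 0], [0,
          - mon 1 0 c 0, mon 0 0 0 1, 0, 0], [- mon 0 0 0 (Suc d), 0, 0, mon 0 0 c 0, 0], [0, - mon 0 0 1 d,
          0, mon e 0 0 0, 0], [0, 0, 0, - mon 0 0 0 1, mon 0 0 1 0], [0, - mon 0 0 0 (Suc d), 0, 0, mon e 0 0 0]]
      [[- mon 1 0 0 0, mon 0 0 0 1, - mon 0 0 1 0, 0, 0, 0, 0], [- mon 0 0 0 d, 0, 0, mon e 0 0 0,
          - mon 0 0 c 0, 0, 0], [0, 0, 0, 0, mon 0 0 0 1, mon e 0 0 0, - mon 0 0 1 0]]"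
    by (rule list_resolution_append_mon[OF R2 list_resolution_koszul_mon, where U = "[(0, 0, 1, 0), (e, 0, 0, 0)]"
        and A = "[[0, 0, 0, mon 0 0 0 1], [0, mon 0 0 0 (Suc d), 0, 0]]" and W = "[[0, 0, 0, 0, mon 0 0 0 1]]"])
      (use assms in \<open>auto simp: eval_simps algebra_simps\<close>)
  show ?thesis
    by (rule list_resolution_append_mon[OF R3 list_resolution_koszul_mon, where U = "[(0, 0, 0, 1), (0, 0, c, 0)]"
        and A = "[[0, mon (Suc (e + p)) 0 0 0, 0, 0, 0], [0, 0, mon (e + p) 0 0 0, 0, 0]]" and W = "[[0, 0,
            - mon (e + p) 0 0 0, 0, 0, 0, 0]]"])
      (use assms in \<open>auto simp: eval_simps algebra_simps\<close>)
qed

text \<open>These are f_4, f_5, f_3 at \<open>X_3 = 0\<close>, up to sign, the common start of both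
  cases for \<open>n 3\<close>.\<close>

lemma resolution_n3:
  fixes d p :: nat
  assumes "0 < d" "0 < p"
  shows "list_resolution ([mon 0 0 0 (Suc d), mon 0 1 0 d, mon p 1 0 0] :: (4, 'k::comm_ring_1) mpol list)
      [[- mon 0 1 0 0, mon 0 0 0 1, 0], [0, - mon p 0 0 0, mon 0 0 0 d]]
      []"
proof -
  have R2: "list_resolution ([mon 0 0 0 (Suc d), mon 0 1 0 d] :: (4, 'k) mpol list)
      [[- mon 0 1 0 0, mon 0 0 0 1]]
      []"
    by (rule list_resolution_append_mon[OF list_resolution_mon list_resolution_mon, where U = "[(0, 0, 0, 1)]"
        and A = "[[mon 0 1 0 0]]" and W = "[]"])
      (use assms in \<open>auto simp: eval_simps algebra_simps\<close>)
  show ?thesis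
    by (rule list_resolution_append_mon[OF R2 list_resolution_mon, where U = "[(0, 0, 0, d)]"
        and A = "[[0, mon p 0 0 0]]" and W = "[]"])
      (use assms in \<open>auto simp: eval_simps algebra_simps\<close>)
qed

text \<open>For \<alpha>_2 < \<alpha>_21 + 1 the power of \<open>X_2\<close> leads f_2. The
  generator \<open>mon (e + p) 0 0 1\<close> comes from \<open>X_1^p\<close> times f_2, because f_3
  turns \<open>X_1^p X_2\<close> into a power of \<open>X_3\<close>.\<close>

lemma resolution_n3_less:
  fixes b d e p :: nat
  assumes "0 < d" "0 < p" "0 < b" "0 < e"
  shows "list_resolution ([mon 0 0 0 (Suc d), mon 0 1 0 d, mon p 1 0 0, mon (e + p) 0 0 1,
      mon (Suc (e + p)) 0 0 0, mon 0 (Suc b) 0 0] :: (4, 'k::comm_ring_1) mpol list)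
      [[- mon 0 1 0 0, mon 0 0 0 1, 0, 0, 0, 0], [0, - mon p 0 0 0, mon 0 0 0 d, 0, 0, 0],
          [- mon (e + p) 0 0 0, 0, 0, mon 0 0 0 d, 0, 0], [0, 0, - mon e 0 0 1, mon 0 1 0 0, 0, 0], [0, 0, 0,
          - mon 1 0 0 0, mon 0 0 0 1, 0], [0, 0, - mon (Suc e) 0 0 0, 0, mon 0 1 0 0, 0], [0, - mon 0 b 0 0,
          0, 0, 0, mon 0 0 0 d], [0, 0, - mon 0 b 0 0, 0, 0, mon p 0 0 0]]
      [[- mon (e + p) 0 0 0, - mon e 0 0 1, mon 0 1 0 0, - mon 0 0 0 d, 0, 0, 0, 0], [0, 0, 0, mon 1 0 0 0,
          mon 0 1 0 0, - mon 0 0 0 1, 0, 0], [0, - mon 0 b 0 0, 0, 0, 0, 0, mon p 0 0 0, - mon 0 0 0 d]]"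
proof -
  have R2: "list_resolution ([mon 0 0 0 (Suc d), mon 0 1 0 d, mon p 1 0 0, mon (e + p) 0 0 1] :: (4, 'k) mpol list)
      [[- mon 0 1 0 0, mon 0 0 0 1, 0, 0], [0, - mon p 0 0 0, mon 0 0 0 d, 0], [- mon (e + p) 0 0 0, 0, 0,
          mon 0 0 0 d], [0, 0, - mon e 0 0 1, mon 0 1 0 0]]
      [[- mon (e + p) 0 0 0, - mon e 0 0 1, mon 0 1 0 0, - mon 0 0 0 d]]"
    by (rule list_resolution_append_mon[OF resolution_n3[OF assms(1,2)] list_resolution_koszul_mon,
        where U = "[(0, 0, 0, d), (0, 1, 0, 0)]"
        and A = "[[mon (e + p) 0 0 0, 0, 0], [0, 0, mon e 0 0 1]]" and W = "[[- mon (e + p) 0 0 0, - mon e 0 0 1]]"])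
      (use assms in \<open>auto simp: eval_simps algebra_simps\<close>)
  have R3: "list_resolution ([mon 0 0 0 (Suc d), mon 0 1 0 d, mon p 1 0 0, mon (e + p) 0 0 1,
      mon (Suc (e + p)) 0 0 0] :: (4, 'k) mpol list)
      [[- mon 0 1 0 0, mon 0 0 0 1, 0, 0, 0], [0, - mon p 0 0 0, mon 0 0 0 d, 0, 0], [- mon (e + p) 0 0 0, 0,
          0, mon 0 0 0 d, 0], [0, 0, - mon e 0 0 1, mon 0 1 0 0, 0], [0, 0, 0, - mon 1 0 0 0, mon 0 0 0 1],
          [0, 0, - mon (Suc e) 0 0 0, 0, mon 0 1 0 0]]
      [[- mon (e + p) 0 0 0, - mon e 0 0 1, mon 0 1 0 0, - mon 0 0 0 d, 0, 0], [0, 0, 0, mon 1 0 0 0,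
          mon 0 1 0 0, - mon 0 0 0 1]]"
    by (rule list_resolution_append_mon[OF R2 list_resolution_koszul_mon, where U = "[(0, 0, 0, 1), (0, 1, 0, 0)]"
        and A = "[[0, 0, 0, mon 1 0 0 0], [0, 0, mon (Suc e) 0 0 0, 0]]" and W = "[[0, 0, 0, mon 1 0 0 0]]"])
      (use assms in \<open>auto simp: eval_simps algebra_simps\<close>)
  show ?thesis
    by (rule list_resolution_append_mon[OF R3 list_resolution_koszul_mon, where U = "[(0, 0, 0, d), (p, 0, 0, 0)]"
        and A = "[[0, mon 0 b 0 0, 0, 0, 0], [0, 0, mon 0 b 0 0, 0, 0]]" and W = "[[0, - mon 0 b 0 0, 0, 0, 0, 0]]"])
      (use assms in \<open>auto simp: eval_simps algebra_simps\<close>)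
qed

text \<open>For \<alpha>_2 = \<alpha>_21 + 1 the binomial f_2 is homogeneous, and it makes the
  generator \<open>mon (e + p) 0 0 1\<close> of the other case redundant.\<close>

lemma resolution_n3_eq:
  fixes d e p :: nat
  assumes "0 < d" "0 < p" "0 < e"
  shows "list_resolution ([mon 0 0 0 (Suc d), mon 0 1 0 d, mon p 1 0 0, mon 0 (Suc e) 0 0 - mon e 0 0 1,
      mon (Suc (e + p)) 0 0 0] :: (4, 'k::comm_ring_1) mpol list)
      [[- mon 0 1 0 0, mon 0 0 0 1, 0, 0, 0], [0, - mon p 0 0 0, mon 0 0 0 d, 0, 0], [mon e 0 0 0,
          - mon 0 e 0 0, 0, mon 0 0 0 d, 0], [0, 0, mon e 0 0 1 - mon 0 (Suc e) 0 0, mon p 1 0 0, 0], [0, 0,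
          - mon 1 e 0 0, mon (Suc p) 0 0 0, mon 0 0 0 1], [0, 0, - mon (Suc e) 0 0 0, 0, mon 0 1 0 0]]
      [[mon (e + p) 0 0 0, mon e 0 0 1 - mon 0 (Suc e) 0 0, mon p 1 0 0, - mon 0 0 0 d, 0, 0], [0, 0, 0,
          - mon 1 0 0 0, mon 0 1 0 0, - mon 0 0 0 1]]"
proof -
  have R2: "list_resolution ([mon 0 0 0 (Suc d), mon 0 1 0 d, mon p 1 0 0,
      mon 0 (Suc e) 0 0 - mon e 0 0 1] :: (4, 'k) mpol list)
      [[- mon 0 1 0 0, mon 0 0 0 1, 0, 0], [0, - mon p 0 0 0, mon 0 0 0 d, 0], [mon e 0 0 0, - mon 0 e 0 0,
          0, mon 0 0 0 d], [0, 0, mon e 0 0 1 - mon 0 (Suc e) 0 0, mon p 1 0 0]]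
      [[mon (e + p) 0 0 0, mon e 0 0 1 - mon 0 (Suc e) 0 0, mon p 1 0 0, - mon 0 0 0 d]]"
  proof (rule list_resolution_append[OF resolution_n3[OF assms(1,2)] list_resolution_koszul_mon,
      where m = "mon 0 (Suc e) 0 0 - mon e 0 0 1"
        and a = "[[- mon e 0 0 0, mon 0 e 0 0, 0], [0, 0,
            mon 0 (Suc e) 0 0 - mon e 0 0 1]]" and w = "[[mon (e + p) 0 0 0, mon e 0 0 1 - mon 0 (Suc e) 0 0]]"])
    let ?G = "[mon 0 0 0 (Suc d), mon 0 1 0 d, mon p 1 0 0] :: (4, 'k) mpol list" and ?H = "[mon 0 0 0 d,
        mon p 1 0 0] :: (4, 'k) mpol list"
    show "\<exists>p. r = (\<Sum>k<length ?H. p k * ?H ! k)" if "r * (mon 0 (Suc e) 0 0 - mon e 0 0 1) = (\<Sum>i<length ?G. v i * ?G ! i)" for r v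
    proof (rule colon_monomials[where U = "[expo 0 0 0 d, expo p 1 0 0]"])
      note eq = that
      have neg: "r * (mon e 0 0 1 - mon 0 (Suc e) 0 0) = (\<Sum>i<length ?G. - v i * ?G ! i)"
        using arg_cong[OF eq, of uminus] by (simp add: sum_negf flip: mult_minus_right)
      \<comment> \<open>A monomial of \<open>r\<close> outside the colon ideal is cancelled against
        a partner. For \<open>j = 0\<close> the partner would require a missing factor
        \<open>X_2\<close>. Otherwise it is again outside and has a smaller exponent of
        \<open>X_1\<close>, as \<open>0 < e\<close>, so the descent ends in a contradiction.\<close>
      have key: "d \<le> l \<or> p \<le> i \<and> 0 < j" if "lookup r (expo i j k l) \<noteq> 0" for i j k l
        using that
      proof (induction i arbitrary: j k l rule: less_induct)
        case (less i)
        show ?case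
        proof (rule ccontr)
          assume not: "\<not> ?thesis"
          show False
          proof (cases "j = 0")
            case True
            with not have "\<forall>g\<in>set ?G. \<forall>\<kappa>\<in>keys g. \<not> \<kappa> adds expo (i + e) (j + 0) (k + 0) (l + 1)" by auto
            from colon_binomial_step[OF neg less(2) this] True show False by auto
          next
            case False
            with not have il: "i < p" "l < d" by auto
            then have "\<forall>g\<in>set ?G. \<forall>\<kappa>\<in>keys g. \<not> \<kappa> adds expo (i + 0) (j + Suc e) (k + 0) (l + 0)" by auto
            from colon_binomial_step[OF eq less(2) this] obtain i' j' k' l' where
              *: "i = i' + e" "l = Suc l'" "lookup r (expo i' j' k' l') \<noteq> 0" by auto
            from less(1)[of i' j' k' l'] * il assms show False by auto
          qed
        qed
      qed
      fix s assume s: "lookup r s \<noteq> 0"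
      obtain i j k l where ex: "s = expo i j k l" using expo_exhaust by blast
      show "\<exists>u\<in>set [expo 0 0 0 d, expo p 1 0 0]. u adds s"
        using key[OF s[unfolded ex]] by (auto simp: ex)
    qed (simp add: mon_def)
  qed (simp_all add: eval_simps algebra_simps)
  show ?thesis
    by (rule list_resolution_append_mon[OF R2 list_resolution_koszul_mon, where U = "[(0, 0, 0, 1), (0, 1, 0, 0)]"
        and A = "[[0, 0, mon 1 e 0 0, - mon (Suc p) 0 0 0], [0, 0, mon (Suc e) 0 0 0, 0]]" and W = "[[0, 0,
            0, - mon 1 0 0 0]]"])
      (use assms in \<open>auto simp: eval_simps algebra_simps dest!: keys_mon_diff\<close>)
qed

text \<open>These are f_2, f_3, f_4, f_5, f_1 at \<open>X_4 = 0\<close>, up to sign, with only the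
  power of \<open>X_3\<close> kept from f_3; it has the smaller degree when \<alpha>_3 < \<alpha>_1
  - \<alpha>_21.\<close>

lemma resolution_n4_less:
  fixes b c e p :: nat
  assumes "0 < b" "0 < c" "0 < e" "0 < p"
  shows "list_resolution ([mon 0 (Suc b) 0 0, mon 0 0 (Suc c) 0, mon 1 b c 0, mon (Suc e) 0 c 0,
      mon (Suc (e + p)) 0 0 0] :: (4, 'k::comm_ring_1) mpol list)
      [[- mon 0 0 (Suc c) 0, mon 0 (Suc b) 0 0, 0, 0, 0], [- mon 1 0 c 0, 0, mon 0 1 0 0, 0, 0], [0,
          - mon 1 b 0 0, mon 0 0 1 0, 0, 0], [0, 0, - mon e 0 0 0, mon 0 b 0 0, 0], [0, - mon (Suc e) 0 0 0,
          0, mon 0 0 1 0, 0], [- mon (Suc (e + p)) 0 0 0, 0, 0, 0, mon 0 (Suc b) 0 0], [0, 0, 0,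
          - mon p 0 0 0, mon 0 0 c 0]]
      [[- mon 1 0 0 0, mon 0 0 1 0, - mon 0 1 0 0, 0, 0, 0, 0], [0, 0, mon e 0 0 0, mon 0 0 1 0,
          - mon 0 b 0 0, 0, 0], [0, - mon (e + p) 0 0 0, 0, - mon p 1 0 0, 0, mon 0 0 c 0, - mon 0 (Suc b) 0 0]]"
proof -
  have R2: "list_resolution ([mon 0 (Suc b) 0 0, mon 0 0 (Suc c) 0] :: (4, 'k) mpol list)
      [[- mon 0 0 (Suc c) 0, mon 0 (Suc b) 0 0]]
      []"
    by (rule list_resolution_append_mon[OF list_resolution_mon list_resolution_mon, where U = "[(0, Suc b, 0, 0)]"
        and A = "[[mon 0 0 (Suc c) 0]]" and W = "[]"])
      (use assms in \<open>auto simp: eval_simps algebra_simps\<close>)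
  have R3: "list_resolution ([mon 0 (Suc b) 0 0, mon 0 0 (Suc c) 0, mon 1 b c 0] :: (4, 'k) mpol list)
      [[- mon 0 0 (Suc c) 0, mon 0 (Suc b) 0 0, 0], [- mon 1 0 c 0, 0, mon 0 1 0 0], [0, - mon 1 b 0 0, mon 0 0 1 0]]
      [[- mon 1 0 0 0, mon 0 0 1 0, - mon 0 1 0 0]]"
    by (rule list_resolution_append_mon[OF R2 list_resolution_koszul_mon, where U = "[(0, 1, 0, 0), (0, 0, 1, 0)]"
        and A = "[[mon 1 0 c 0, 0], [0, mon 1 b 0 0]]" and W = "[[- mon 1 0 0 0]]"])
      (use assms in \<open>auto simp: eval_simps algebra_simps\<close>)
  have R4: "list_resolution ([mon 0 (Suc b) 0 0, mon 0 0 (Suc c) 0, mon 1 b c 0, mon (Suc e) 0 c 0] :: (4,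
      'k) mpol list)
      [[- mon 0 0 (Suc c) 0, mon 0 (Suc b) 0 0, 0, 0], [- mon 1 0 c 0, 0, mon 0 1 0 0, 0], [0, - mon 1 b 0 0,
          mon 0 0 1 0, 0], [0, 0, - mon e 0 0 0, mon 0 b 0 0], [0, - mon (Suc e) 0 0 0, 0, mon 0 0 1 0]]
      [[- mon 1 0 0 0, mon 0 0 1 0, - mon 0 1 0 0, 0, 0], [0, 0, mon e 0 0 0, mon 0 0 1 0, - mon 0 b 0 0]]"
    by (rule list_resolution_append_mon[OF R3 list_resolution_koszul_mon, where U = "[(0, b, 0, 0), (0, 0, 1, 0)]"
        and A = "[[0, 0, mon e 0 0 0], [0, mon (Suc e) 0 0 0, 0]]" and W = "[[0, 0, mon e 0 0 0]]"])
      (use assms in \<open>auto simp: eval_simps algebra_simps\<close>)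
  show ?thesis
    by (rule list_resolution_append_mon[OF R4 list_resolution_koszul_mon, where U = "[(0, Suc b, 0, 0), (0, 0, c, 0)]"
        and A = "[[mon (Suc (e + p)) 0 0 0, 0, 0, 0], [0, 0, 0, mon p 0 0 0]]" and W = "[[0,
            - mon (e + p) 0 0 0, 0, - mon p 1 0 0, 0]]"])
      (use assms in \<open>auto simp: eval_simps algebra_simps\<close>)
qed

text \<open>For \<alpha>_3 = \<alpha>_1 - \<alpha>_21 the binomial f_3 is homogeneous and is added
  last. Its colon ideal has three generators, resolved in \<open>Q2\<close>, and the cone contains a
  unit.\<close>

lemma resolution_n4_eq:
  fixes b e p :: nat
  assumes "0 < b" "0 < e" "0 < p"
  shows "list_resolution ([mon 0 (Suc b) 0 0, mon 1 b p 0, mon (Suc e) 0 p 0, mon (Suc (e + p)) 0 0 0,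
      mon 0 0 (Suc p) 0 - mon p 1 0 0] :: (4, 'k::comm_ring_1) mpol list)
      [[- mon 1 0 p 0, mon 0 1 0 0, 0, 0, 0], [0, - mon e 0 0 0, mon 0 b 0 0, 0, 0], [0, 0, - mon p 0 0 0,
          mon 0 0 p 0, 0], [0, 0, - mon 0 0 1 0, mon 0 1 0 0, mon (Suc e) 0 0 0],
          [mon p 1 0 0 - mon 0 0 (Suc p) 0, 0, 0, 0, mon 0 (Suc b) 0 0], [mon (Suc p) 0 0 0, - mon 0 0 1 0,
          0, 0, mon 1 b 0 0]]
      [[mon (e + p) 0 0 0, mon p 1 0 0 - mon 0 0 (Suc p) 0, mon 0 (Suc b) 0 0, - mon 0 b p 0, 0,
          mon e 0 p 0], [mon 0 0 1 0, 0, 0, 0, - mon 1 0 0 0, mon 0 1 0 0]]"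
proof -
  have Q1: "list_resolution ([mon 0 (Suc b) 0 0, mon 1 b 0 0] :: (4, 'k) mpol list) [[- mon 1 0 0 0, mon 0 1 0 0]] []"
    by (rule list_resolution_append_mon[OF list_resolution_mon list_resolution_mon, where U = "[(0, 1, 0, 0)]"
        and A = "[[mon 1 0 0 0]]" and W = "[]"])
      (use assms in \<open>auto simp: eval_simps algebra_simps\<close>)
  have Q2: "list_resolution ([mon 0 (Suc b) 0 0, mon 1 b 0 0, mon (Suc e) 0 0 0] :: (4, 'k) mpol list)
      [[- mon 1 0 0 0, mon 0 1 0 0, 0], [0, mon e 0 0 0, - mon 0 b 0 0]] []"
  \<comment> \<open>The sign makes the unit entry of the later cone equal to 1, the form that
    \<open>list_resolution_prune\<close> expects.\<close>
  proof (rule list_resolution_append[OF Q1 list_resolution_single[of "- mon 0 b 0 0"], where m = "mon (Suc e) 0 0 0"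
        and a = "[[0, - mon e 0 0 0]]" and w = "[]"])
    let ?G = "[mon 0 (Suc b) 0 0, mon 1 b 0 0] :: (4, 'k) mpol list" and ?H = "[mon 0 b 0 0] :: (4, 'k) mpol list"
    show "\<exists>p. r = (\<Sum>k<length [- mon 0 b 0 0]. p k * [- mon 0 b 0 0] ! k)"
      if "r * mon (Suc e) 0 0 0 = (\<Sum>i<length ?G. v i * ?G ! i)" for r v
    proof -
      have "\<exists>p. r = (\<Sum>k<length ?H. p k * ?H ! k)"
        by (rule colon_mon[OF that, where U = "[expo 0 b 0 0]"]) (use assms in \<open>auto simp: mon_def\<close>)
      then obtain q where "r = q * mon 0 b 0 0" by auto
      then show ?thesis by (intro exI[of _ "\<lambda>_. - q"]) simp
    qed
    show "r = 0" if "r * - mon 0 b 0 0 = 0" for r :: "(4, 'k) mpol" using mon_regular[of r 0 b 0 0] that by simp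
  qed (simp_all add: eval_simps algebra_simps)
  have R2: "list_resolution ([mon 0 (Suc b) 0 0, mon 1 b p 0] :: (4, 'k) mpol list)
      [[- mon 1 0 p 0, mon 0 1 0 0]]
      []"
    by (rule list_resolution_append_mon[OF list_resolution_mon list_resolution_mon, where U = "[(0, 1, 0, 0)]"
        and A = "[[mon 1 0 p 0]]" and W = "[]"])
      (use assms in \<open>auto simp: eval_simps algebra_simps\<close>)
  have R3: "list_resolution ([mon 0 (Suc b) 0 0, mon 1 b p 0, mon (Suc e) 0 p 0] :: (4, 'k) mpol list)
      [[- mon 1 0 p 0, mon 0 1 0 0, 0], [0, - mon e 0 0 0, mon 0 b 0 0]]
      []"
    by (rule list_resolution_append_mon[OF R2 list_resolution_mon, where U = "[(0, b, 0, 0)]"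
        and A = "[[0, mon e 0 0 0]]" and W = "[]"])
      (use assms in \<open>auto simp: eval_simps algebra_simps\<close>)
  have R4: "list_resolution ([mon 0 (Suc b) 0 0, mon 1 b p 0, mon (Suc e) 0 p 0,
      mon (Suc (e + p)) 0 0 0] :: (4, 'k) mpol list)
      [[- mon 1 0 p 0, mon 0 1 0 0, 0, 0], [0, - mon e 0 0 0, mon 0 b 0 0, 0], [0, 0, - mon p 0 0 0,
          mon 0 0 p 0], [- mon (Suc (e + p)) 0 0 0, 0, 0, mon 0 (Suc b) 0 0]]
      [[mon (e + p) 0 0 0, mon p 1 0 0, mon 0 (Suc b) 0 0, - mon 0 0 p 0]]"
    by (rule list_resolution_append_mon[OF R3 list_resolution_koszul_mon, where U = "[(0, 0, p, 0), (0, Suc b, 0, 0)]"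
        and A = "[[0, 0, mon p 0 0 0], [mon (Suc (e + p)) 0 0 0, 0, 0]]" and W = "[[mon (e + p) 0 0 0, mon p 1 0 0]]"])
      (use assms in \<open>auto simp: eval_simps algebra_simps\<close>)
  have R5: "list_resolution ([mon 0 (Suc b) 0 0, mon 1 b p 0, mon (Suc e) 0 p 0, mon (Suc (e + p)) 0 0 0,
      mon 0 0 (Suc p) 0 - mon p 1 0 0] :: (4, 'k) mpol list)
      [[- mon 1 0 p 0, mon 0 1 0 0, 0, 0, 0], [0, - mon e 0 0 0, mon 0 b 0 0, 0, 0], [0, 0, - mon p 0 0 0,
          mon 0 0 p 0, 0], [- mon (Suc (e + p)) 0 0 0, 0, 0, mon 0 (Suc b) 0 0, 0],
          [mon p 1 0 0 - mon 0 0 (Suc p) 0, 0, 0, 0, mon 0 (Suc b) 0 0], [mon (Suc p) 0 0 0, - mon 0 0 1 0,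
          0, 0, mon 1 b 0 0], [0, 0, - mon 0 0 1 0, mon 0 1 0 0, mon (Suc e) 0 0 0]]
      [[mon (e + p) 0 0 0, mon p 1 0 0, mon 0 (Suc b) 0 0, - mon 0 0 p 0, 0, 0, 0], [mon 0 0 1 0, 0, 0, 0,
          - mon 1 0 0 0, mon 0 1 0 0, 0], [0, - mon 0 0 1 0, 0, 1, 0, mon e 0 0 0, - mon 0 b 0 0]]"
  proof (rule list_resolution_append[OF R4 Q2, where m = "mon 0 0 (Suc p) 0 - mon p 1 0 0"
        and a = "[[mon 0 0 (Suc p) 0 - mon p 1 0 0, 0, 0, 0], [- mon (Suc p) 0 0 0, mon 0 0 1 0, 0, 0], [0,
            0, mon 0 0 1 0, - mon 0 1 0 0]]" and w = "[[mon 0 0 1 0, 0, 0, 0], [0, - mon 0 0 1 0, 0, 1]]"])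
    let ?G = "[mon 0 (Suc b) 0 0, mon 1 b p 0, mon (Suc e) 0 p 0, mon (Suc (e + p)) 0 0 0] :: (4,
        'k) mpol list" and ?H = "[mon 0 (Suc b) 0 0, mon 1 b 0 0, mon (Suc e) 0 0 0] :: (4, 'k) mpol list"
    show "\<exists>p. r = (\<Sum>k<length ?H. p k * ?H ! k)" if "r * (mon 0 0 (Suc p) 0 - mon p 1 0 0) = (\<Sum>i<length ?G. v i * ?G ! i)" for r v
    proof (rule colon_monomials[where U = "[expo 0 (Suc b) 0 0, expo 1 b 0 0, expo (Suc e) 0 0 0]"])
      note eq = that
      \<comment> \<open>Descent on the exponent of \<open>X_1\<close>: a monomial outside the colon
        ideal is cancelled against one with smaller exponents of \<open>X_1\<close> and
        \<open>X_2\<close>. The claim holds for the latter and carries over to the former.\<close>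
      have key: "b < j \<or> 0 < i \<and> b \<le> j \<or> e < i" if "lookup r (expo i j k l) \<noteq> 0" for i j k l
        using that
      proof (induction i arbitrary: j k l rule: less_induct)
        case (less i)
        show ?case
        proof (rule ccontr)
          assume not: "\<not> ?thesis"
          then have "\<forall>g\<in>set ?G. \<forall>\<kappa>\<in>keys g. \<not> \<kappa> adds expo (i + 0) (j + 0) (k + Suc p) (l + 0)" by auto
          from colon_binomial_step[OF eq less(2) this] obtain i' j' k' l' where
            *: "i = i' + p" "j = Suc j'" "lookup r (expo i' j' k' l') \<noteq> 0" by auto
          from less(1)[of i' j' k' l'] * not assms show False by auto
        qed
      qed
      fix s assume s: "lookup r s \<noteq> 0"
      obtain i j k l where ex: "s = expo i j k l" using expo_exhaust by blast
      show "\<exists>u\<in>set [expo 0 (Suc b) 0 0, expo 1 b 0 0, expo (Suc e) 0 0 0]. u adds s"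
        using key[OF s[unfolded ex]] by (auto simp: ex)
    qed (simp add: mon_def)
  qed (simp_all add: eval_simps algebra_simps)
  show ?thesis
    using list_resolution_prune[where C = "[[- mon 1 0 p 0, mon 0 1 0 0, 0, 0, 0], [0, - mon e 0 0 0,
        mon 0 b 0 0, 0, 0], [0, 0, - mon p 0 0 0, mon 0 0 p 0, 0], [- mon (Suc (e + p)) 0 0 0, 0, 0,
        mon 0 (Suc b) 0 0, 0], [mon p 1 0 0 - mon 0 0 (Suc p) 0, 0, 0, 0, mon 0 (Suc b) 0 0],
        [mon (Suc p) 0 0 0, - mon 0 0 1 0, 0, 0, mon 1 b 0 0]]" and c = "[0, 0, - mon 0 0 1 0, mon 0 1 0 0,
        mon (Suc e) 0 0 0]" and B = "[[mon (e + p) 0 0 0, mon p 1 0 0, mon 0 (Suc b) 0 0, - mon 0 0 p 0, 0,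
        0, 0], [mon 0 0 1 0, 0, 0, 0, - mon 1 0 0 0, mon 0 1 0 0, 0]]" and b = "[0, - mon 0 0 1 0, 0, 1, 0,
        mon e 0 0 0, - mon 0 b 0 0]" and jj = 3 and G = "[mon 0 (Suc b) 0 0, mon 1 b p 0, mon (Suc e) 0 p 0,
        mon (Suc (e + p)) 0 0 0, mon 0 0 (Suc p) 0 - mon p 1 0 0] :: (4, 'k) mpol list"] R5
    by (simp add: eval_simps algebra_simps upt_rec numeral_eq_Suc)
qed

section \<open>Counting normal forms in boxes of exponents\<close>

definition expo_box :: "nat set \<Rightarrow> nat set \<Rightarrow> nat set \<Rightarrow> nat set \<Rightarrow> (4 \<Rightarrow>\<^sub>0 nat) set" where
  "expo_box A B C D = (\<lambda>(i, j, k, l). expo i j k l) ` (A \<times> B \<times> C \<times> D)"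

lemma expo_in_box [simp]: "expo i j k l \<in> expo_box A B C D \<longleftrightarrow>
    i \<in> A \<and> j \<in> B \<and> k \<in> C \<and> l \<in> D"
  by (auto simp: expo_box_def intro!: image_eqI[of _ _ "(i, j, k, l)"])

lemma finite_expo_box [simp]: "finite A \<Longrightarrow> finite B \<Longrightarrow>
    finite C \<Longrightarrow> finite D \<Longrightarrow> finite (expo_box A B C D)"
  by (simp add: expo_box_def)

lemma card_expo_box: "card (expo_box A B C D) = card A * card B * card C * card D"
proof -
  have "inj_on (\<lambda>(i, j, k, l). expo i j k l) (A \<times> B \<times> C \<times> D)" by (auto simp: inj_on_def)
  then show ?thesis by (simp add: expo_box_def card_image card_cartesian_product mult.assoc)
qed

lemma card_Union_set_le: "card (\<Union> (set Bs)) \<le> (\<Sum>B\<leftarrow>Bs. card B)"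
proof (induction Bs)
  case (Cons B Bs)
  then show ?case using card_Un_le[of B "\<Union> (set Bs)"] by simp
qed simp

lemma homogeneous_mon_diff:
  "int (i + j + k + l) = d \<Longrightarrow> int (i' + j' + k' + l') = d \<Longrightarrow>
      homogeneous d (mon i j k l - mon i' j' k' l')"
  by (intro homogeneous_diff) simp_all

text \<open>Here \<open>P\<close> pairs each monomial of \<open>E\<close> with a factorization
  through \<open>X_i\<close>, and the exponent of the variable \<open>t\<close> is the measure of
  the rewriting. The second alternative in \<open>PJ\<close> admits a monomial that lies in the
  ideal without being a generator, as happens in \<open>betti_n3_eq\<close>.\<close>

lemma betti_sequence_rewriting_4:
  fixes n :: "4 \<Rightarrow> nat" and G :: "(4, 'k::field) mpol list"
  assumes gcd: "Gcd (range n) = 1" and pos: "\<And>j. 0 < n j"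
    and nzd: "\<And>f :: (4, 'k) mpol. indet i * f \<in> tangent_cone_ideal n \<Longrightarrow>
        f \<in> tangent_cone_ideal n"
    and res: "list_resolution G C D"
    and P: "\<forall>(u, v)\<in>P. weight n v = weight n u \<and> 0 < lookup v i"
    and rules: "\<forall>(l,
        r)\<in>rules. weight n l = weight n r \<and> lookup r i = 0 \<and> lookup r t < lookup l t \<and> mdeg l \<le> mdeg r"
    and fin: "finite B" and card: "card B \<le> n i"
    and cover: "\<forall>x y z w. lookup (expo x y z w) i = 0 \<longrightarrow> (\<forall>(u,
        v)\<in>P. \<not> u adds expo x y z w) \<longrightarrow>
        (\<forall>(l, r)\<in>rules. \<not> l adds expo x y z w) \<longrightarrow> expo x y z w \<in> B"
    and PJ: "\<forall>(u,
        v)\<in>P. single u 1 \<in> set G \<or> (\<exists>v. single u 1 = (\<Sum>j<length G. v j * G ! j))"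
    and rG: "\<forall>(l, r)\<in>rules. single l 1 - (if mdeg l = mdeg r then single r 1 else 0) \<in> set G"
    and G: "\<forall>g\<in>set G. (\<exists>(u, v)\<in>P. g = single u 1) \<or> (\<exists>(l,
        r)\<in>rules. g = single l 1 - (if mdeg l = mdeg r then single r 1 else 0))"
    and Gi: "\<forall>g\<in>set G. \<forall>m\<in>keys g. lookup m i = 0"
    and len: "length dG = length G" "length dC = length C" "length dD = length D"
    and hG: "\<forall>j<length G. homogeneous (dG ! j) (G ! j) \<and> lookup (G ! j) 0 = 0"
    and hC: "\<forall>j<length C. \<forall>k<length G. homogeneous (dC ! j - dG ! k) (C ! j ! k) \<and> lookup (C ! j ! k) 0 = 0"
    and hD: "\<forall>j<length D. \<forall>k<length C. homogeneous (dD ! j - dC ! k) (D ! j ! k) \<and> lookup (D ! j ! k) 0 = 0"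
    and \<beta>: "\<beta> = (1, length G, length C, length D)"
  shows "quotient_betti_sequence (tangent_cone_ideal n :: (4, 'k) mpol set) \<beta>"
proof -
  have GJ: "g \<in> {f. \<exists>v. f = (\<Sum>j<length G. v j * G ! j)}" if g: "g \<in> set G" for g
  proof -
    obtain k where k: "k < length G" "G ! k = g" using g unfolding in_set_conv_nth by blast
    then have "g = (\<Sum>j<length G. (if j = k then 1 else 0) * G ! j)"
      by (simp add: if_distrib[of "\<lambda>x. x * _"] cong: if_cong)
    then show ?thesis by (intro CollectI exI[of _ "\<lambda>j. if j = k then 1 else 0"])
  qed
  show ?thesis unfolding \<beta>
  proof (rule betti_sequence_by_rewriting[OF gcd pos nzd fin card,
      where E = "fst ` P" and rules = rules and \<mu> = "\<lambda>m. lookup m t"])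
    show "\<exists>v. weight n v = weight n u \<and> 0 < lookup v i" if "u \<in> fst ` P" for u using that P by force
    show "weight n l = weight n r \<and> lookup r i = 0 \<and> mdeg l \<le> mdeg r" if "(l, r) \<in> rules" for l r
      using that rules by blast
    show "lookup (r + s) t < lookup (l + s) t" if "(l, r) \<in> rules" for l r s
      using that rules by (auto simp: lookup_add)
    show "M \<in> B" if "lookup M i = 0" "\<forall>u\<in>fst ` P. \<not> u adds M" "\<forall>(l,
        r)\<in>rules. \<not> l adds M" for M
    proof -
      obtain x y z w where "M = expo x y z w" using expo_exhaust by blast
      then show ?thesis using that cover by (auto simp: case_prod_unfold)
    qed
    show "single u 1 \<in> {f. \<exists>v. f = (\<Sum>j<length G. v j * G ! j)}" if "u \<in> fst ` P" for u
      using that PJ GJ by (auto simp: case_prod_unfold)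
    show "single l 1 - (if mdeg l = mdeg r then single r 1 else 0) \<in> {f. \<exists>v. f = (\<Sum>j<length G. v j * G ! j)}"
      if "(l, r) \<in> rules" for l r using that rG by (intro GJ) blast
    show "(\<exists>u\<in>fst ` P. g = single u 1) \<or> (\<exists>(l,
        r)\<in>rules. g = single l 1 - (if mdeg l = mdeg r then single r 1 else 0))"
      if "g \<in> set G" for g using G[rule_format, OF that] by (auto simp: case_prod_unfold)
    show "lookup m i = 0" if "g \<in> set G" "m \<in> keys g" for g m using that Gi by blast
  qed (use res len hG hC hD in auto)
qed

text \<open>Komeda's parameters, shifted to positive natural numbers:
  \<open>\<alpha>\<^sub>2 = b + 1\<close>, \<open>\<alpha>\<^sub>3 = c + 1\<close>,
      \<open>\<alpha>\<^sub>4 = d + 1\<close>, \<open>\<alpha>\<^sub>2\<^sub>1 = e\<close>,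
      \<open>\<alpha>\<^sub>1 = e + p + 1\<close>.\<close>

definition komeda_parameters :: "(4 \<Rightarrow> nat) \<Rightarrow> nat \<Rightarrow> nat \<Rightarrow> nat \<Rightarrow> nat \<Rightarrow> nat \<Rightarrow> bool" where
  "komeda_parameters n b c d e p \<longleftrightarrow>
      Gcd (range n) = 1 \<and> (\<forall>j. 0 < n j) \<and> 0 < b \<and> 0 < c \<and> 0 < d \<and> 0 < e \<and> 0 < p \<and>
     n 1 = Suc b * Suc c * d + 1 \<and>
     n 2 = e * Suc c * Suc d + p * c + Suc c \<and>
     n 3 + d = Suc (e + p) * Suc d + p * b * d \<and>
     n 4 = Suc (e + p) * Suc b * c + e * b + Suc b"

text \<open>The first five equations compare the weights of the two terms of f_1, ..., f_5, in this
  order.\<close>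

lemma komeda_relations:
  assumes "komeda_parameters n b c d e p"
  shows "Suc (e + p) * n 1 = n 3 + d * n 4" "Suc b * n 2 = e * n 1 + n 4" "Suc c * n 3 = p * n 1 + n 2"
    "Suc d * n 4 = n 1 + b * n 2 + c * n 3" "Suc e * n 1 + c * n 3 = n 2 + d * n 4"
    "n 1 = Suc b * Suc c * d + 1" "n 2 = e * Suc c * Suc d + p * c + Suc c"
    "n 3 = Suc (e + p) + (e + p) * d + p * b * d" "n 4 = Suc (e + p) * Suc b * c + e * b + Suc b"
proof -
  show *: "n 1 = Suc b * Suc c * d + 1" "n 2 = e * Suc c * Suc d + p * c + Suc c"
    "n 3 = Suc (e + p) + (e + p) * d + p * b * d" "n 4 = Suc (e + p) * Suc b * c + e * b + Suc b"
    using assms by (simp_all add: komeda_parameters_def)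
  show "Suc (e + p) * n 1 = n 3 + d * n 4" "Suc b * n 2 = e * n 1 + n 4" "Suc c * n 3 = p * n 1 + n 2"
    "Suc d * n 4 = n 1 + b * n 2 + c * n 3" "Suc e * n 1 + c * n 3 = n 2 + d * n 4"
    unfolding * by (simp_all add: algebra_simps)
qed

section \<open>The eight cases\<close>

text \<open>All five binomials become monomials at \<open>X_1 = 0\<close>, so there are no rules.
  The normal forms are (b + 1) (c + 1) d monomials with exponent of \<open>X_4\<close> below
  \<open>d\<close>, and the power \<open>X_4^d\<close>: in total \<open>n 1\<close>.\<close>

lemma betti_n1:
  fixes n :: "4 \<Rightarrow> nat"
  assumes par: "komeda_parameters n b c d e p"
    and nzd: "\<And>f :: (4, 'k::field) mpol. indet 1 * f \<in> tangent_cone_ideal n \<Longrightarrow>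
        f \<in> tangent_cone_ideal n"
  shows "quotient_betti_sequence (tangent_cone_ideal n :: (4, 'k) mpol set) (1, 5, 6, 2)"
proof -
  note rel = komeda_relations[OF par]
  have gcd: "Gcd (range n) = 1" and pos: "\<And>j. 0 < n j" and params: "0 < b" "0 < c" "0 < d" "0 < e" "0 < p"
    using par by (simp_all add: komeda_parameters_def)
  show ?thesis
    apply (rule betti_sequence_rewriting_4[OF gcd pos _ resolution_n1[OF params(1) params(2) params(3)], where i = 1
          and P = "{(expo 0 (Suc b) 0 0, expo e 0 0 1), (expo 0 0 (Suc c) 0, expo p 1 0 0),
              (expo 0 0 0 (Suc d), expo 1 b c 0), (expo 0 0 1 d, expo (Suc (e + p)) 0 0 0), (expo 0 1 0 d,
              expo (Suc e) 0 c 0)}"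
          and rules = "{}" and t = 1
          and B = "\<Union> (set [expo_box {0} {..b} {..c} {..<d}, expo_box {0} {0} {0} {d}])"
          and dG = "[int (Suc d), int (1 + d), int (Suc c), int (1 + d),
              int (Suc b)]" and dC = "[int (1 + d + 1), int (Suc c + d), int (1 + d + 1), int (1 + d + 1),
              int (Suc b + d), int (Suc b + Suc c)]"
          and dD = "[int (1 + d + 1 + 1), int (Suc b + d + Suc c)]"])
    subgoal by (rule nzd)
    subgoal using rel params by (simp add: weight_expo algebra_simps)
    subgoal using rel params by (simp add: weight_expo algebra_simps)
    subgoal by simp
    subgoal by (rule order_trans[OF card_Union_set_le]) (use rel params in \<open>simp add: card_expo_box algebra_simps\<close>)
    subgoal using params by (auto simp: not_le not_less_eq_eq)
    subgoal by (simp add: mon_def)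
    subgoal using params by (simp add: mon_def)
    subgoal using params by (simp add: mon_def)
    subgoal by (auto dest!: keys_mon_diff)
    by (use params in \<open>simp_all add: eval_simps homogeneous_mon_diff lookup_minus numeral_eq_Suc\<close>)
qed

text \<open>The pairs come from f_2, f_3, f_4, f_5 and the rule from f_1, which lowers the exponent
  of \<open>X_1\<close> and raises the degree. The boxes have (e + p + 1) c, e + 1 and e (c + 1) d
  elements: in total \<open>n 2\<close>.\<close>

lemma betti_n2_less:
  fixes n :: "4 \<Rightarrow> nat"
  assumes par: "komeda_parameters n b c d e p"
    and nzd: "\<And>f :: (4, 'k::field) mpol. indet 2 * f \<in> tangent_cone_ideal n \<Longrightarrow>
        f \<in> tangent_cone_ideal n"
    and less: "e + p < d"
  shows "quotient_betti_sequence (tangent_cone_ideal n :: (4, 'k) mpol set) (1, 5, 7, 3)"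
proof -
  note rel = komeda_relations[OF par]
  have gcd: "Gcd (range n) = 1" and pos: "\<And>j. 0 < n j" and params: "0 < b" "0 < c" "0 < d" "0 < e" "0 < p"
    using par by (simp_all add: komeda_parameters_def)
  show ?thesis
    apply (rule betti_sequence_rewriting_4[OF gcd pos _ resolution_n2_less[OF params(2) params(4) params(3) params(5)], where i = 2
          and P = "{(expo e 0 0 1, expo 0 (Suc b) 0 0), (expo 0 0 (Suc c) 0, expo p 1 0 0),
              (expo 0 0 0 (Suc d), expo 1 b c 0), (expo (Suc e) 0 c 0, expo 0 1 0 d)}"
          and rules = "{(expo (Suc (e + p)) 0 0 0, expo 0 0 1 d)}" and t = 1
          and B = "\<Union> (set [expo_box {..e + p} {0} {..<c} {0}, expo_box {..e} {0} {c} {0},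
              expo_box {..<e} {0} {..c} {1..d}])"
          and dG = "[int (Suc c), int (e + 1), int (Suc e + c), int (Suc d),
              int (Suc (e + p))]" and dC = "[int (e + 1 + Suc c), int (Suc e + c + 1), int (Suc e + c + 1),
              int (Suc d + Suc c), int (Suc d + e), int (Suc (e + p) + c), int (Suc (e + p) + 1)]"
          and dD = "[int (Suc e + c + 1 + 1), int (Suc d + Suc c + e), int (Suc (e + p) + c + 1)]"])
    subgoal by (rule nzd)
    subgoal using rel params by (simp add: weight_expo algebra_simps)
    subgoal using rel params less by (simp add: weight_expo algebra_simps)
    subgoal by simp
    subgoal by (rule order_trans[OF card_Union_set_le]) (use rel params in \<open>simp add: card_expo_box algebra_simps\<close>)
    subgoal using params by (auto simp: not_le not_less_eq_eq)
    subgoal by (simp add: mon_def)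
    subgoal using params less by (simp add: mon_def)
    subgoal using params less by (simp add: mon_def)
    subgoal by (auto dest!: keys_mon_diff)
    by (use params less in \<open>simp_all add: eval_simps homogeneous_mon_diff lookup_minus numeral_eq_Suc\<close>)
qed

text \<open>The normal forms are those of \<open>betti_n2_less\<close> with
  \<open>d = e + p\<close>. The rule now preserves the degree, so its leading form is the whole
  binomial.\<close>

lemma betti_n2_eq:
  fixes n :: "4 \<Rightarrow> nat"
  assumes par: "komeda_parameters n b c (e + p) e p"
    and nzd: "\<And>f :: (4, 'k::field) mpol. indet 2 * f \<in> tangent_cone_ideal n \<Longrightarrow>
        f \<in> tangent_cone_ideal n"
  shows "quotient_betti_sequence (tangent_cone_ideal n :: (4, 'k) mpol set) (1, 5, 6, 2)"
proof -
  note rel = komeda_relations[OF par]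
  have gcd: "Gcd (range n) = 1" and pos: "\<And>j. 0 < n j" and params: "0 < b" "0 < c" "0 < e + p" "0 < e" "0 < p"
    using par by (simp_all add: komeda_parameters_def)
  show ?thesis
    apply (rule betti_sequence_rewriting_4[OF gcd pos _ resolution_n2_eq[OF params(2) params(4) params(5)], where i = 2
          and P = "{(expo e 0 0 1, expo 0 (Suc b) 0 0), (expo 0 0 (Suc c) 0, expo p 1 0 0),
              (expo 0 0 0 (Suc (e + p)), expo 1 b c 0), (expo (Suc e) 0 c 0, expo 0 1 0 (e + p))}"
          and rules = "{(expo (Suc (e + p)) 0 0 0, expo 0 0 1 (e + p))}" and t = 1
          and B = "\<Union> (set [expo_box {..e + p} {0} {..<c} {0}, expo_box {..e} {0} {c} {0},
              expo_box {..<e} {0} {..c} {1..e + p}])"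
          and dG = "[int (Suc c), int (e + 1), int (Suc e + c), int (Suc (e + p)),
              int (Suc (e + p))]" and dC = "[int (e + 1 + Suc c), int (Suc e + c + 1), int (Suc e + c + 1),
              int (Suc (e + p) + 1), int (Suc (e + p) + e), int (Suc (e + p) + c)]"
          and dD = "[int (Suc e + c + 1 + 1), int (Suc (e + p) + Suc c + e)]"])
    subgoal by (rule nzd)
    subgoal using rel params by (simp add: weight_expo algebra_simps)
    subgoal using rel params by (simp add: weight_expo algebra_simps)
    subgoal by simp
    subgoal by (rule order_trans[OF card_Union_set_le]) (use rel params in \<open>simp add: card_expo_box algebra_simps\<close>)
    subgoal using params by (auto simp: not_le not_less_eq_eq)
    subgoal by (simp add: mon_def)
    subgoal using params by (simp add: mon_def)
    subgoal using params by (simp add: mon_def)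
    subgoal by (auto dest!: keys_mon_diff)
    by (use params in \<open>simp_all add: eval_simps homogeneous_mon_diff lookup_minus numeral_eq_Suc\<close>)
qed

text \<open>Now f_1 is read in the opposite direction, lowering the exponent of \<open>X_3\<close>.
  The sixth monomial bounds the powers of \<open>X_1\<close>, and the boxes have (2 e + p + 1) c, e
  + 1, e (c + 1) d and e elements: in total \<open>n 2\<close>.\<close>

lemma betti_n2_greater:
  fixes n :: "4 \<Rightarrow> nat"
  assumes par: "komeda_parameters n b c (Suc d) e p"
    and nzd: "\<And>f :: (4, 'k::field) mpol. indet 2 * f \<in> tangent_cone_ideal n \<Longrightarrow>
        f \<in> tangent_cone_ideal n"
    and less: "Suc d < e + p" "0 < d"
  shows "quotient_betti_sequence (tangent_cone_ideal n :: (4, 'k) mpol set) (1, 6, 9, 4)"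
proof -
  note rel = komeda_relations[OF par]
  have gcd: "Gcd (range n) = 1" and pos: "\<And>j. 0 < n j" and params: "0 < b" "0 < c" "0 < Suc d" "0 < e" "0 < p"
    using par by (simp_all add: komeda_parameters_def)
  show ?thesis
    apply (rule betti_sequence_rewriting_4[OF gcd pos _ resolution_n2_greater[OF params(2) params(4) less(2) params(5)], where i = 2
          and P = "{(expo e 0 0 1, expo 0 (Suc b) 0 0), (expo 0 0 (Suc c) 0, expo p 1 0 0),
              (expo 0 0 0 (Suc (Suc d)), expo 1 b c 0), (expo (Suc e) 0 c 0, expo 0 1 0 (Suc d)),
              (expo (Suc (e + e + p)) 0 0 0, expo 0 (Suc b) 1 d)}"
          and rules = "{(expo 0 0 1 (Suc d), expo (Suc (e + p)) 0 0 0)}" and t = 3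
          and B = "\<Union> (set [expo_box {..e + e + p} {0} {..<c} {0}, expo_box {..e} {0} {c} {0},
              expo_box {..<e} {0} {..c} {1..d}, expo_box {..<e} {0} {0} {Suc d}])"
          and dG = "[int (Suc c), int (e + 1), int (Suc e + c), int (1 + Suc d), int (Suc (Suc d)),
              int (Suc (e + e + p))]" and dC = "[int (e + 1 + Suc c), int (Suc e + c + 1),
              int (Suc e + c + 1), int (1 + Suc d + c), int (1 + Suc d + e), int (Suc (Suc d) + 1),
              int (Suc (Suc d) + e), int (Suc (e + e + p) + 1), int (Suc (e + e + p) + c)]"
          and dD = "[int (Suc e + c + 1 + 1), int (1 + Suc d + c + e), int (Suc (Suc d) + 1 + e),
              int (Suc (e + e + p) + 1 + c)]"])
    subgoal by (rule nzd)
    subgoal using rel params by (simp add: weight_expo algebra_simps)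
    subgoal using rel params less by (simp add: weight_expo algebra_simps)
    subgoal by simp
    subgoal by (rule order_trans[OF card_Union_set_le]) (use rel params in \<open>simp add: card_expo_box algebra_simps\<close>)
    subgoal using params by (auto simp: not_le not_less_eq_eq)
    subgoal by (simp add: mon_def)
    subgoal using params less by (simp add: mon_def)
    subgoal using params less by (simp add: mon_def)
    subgoal by (auto dest!: keys_mon_diff)
    by (use params less in \<open>simp_all add: eval_simps homogeneous_mon_diff lookup_minus numeral_eq_Suc\<close>)
qed

text \<open>The rule comes from f_2 and lowers the exponent of \<open>X_2\<close>. The boxes have (e
  + p) (d + 1), 1 and p b d elements: in total \<open>n 3\<close>.\<close>

lemma betti_n3_less:
  fixes n :: "4 \<Rightarrow> nat"
  assumes par: "komeda_parameters n b c d e p"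
    and nzd: "\<And>f :: (4, 'k::field) mpol. indet 3 * f \<in> tangent_cone_ideal n \<Longrightarrow>
        f \<in> tangent_cone_ideal n"
    and less: "b < e"
  shows "quotient_betti_sequence (tangent_cone_ideal n :: (4, 'k) mpol set) (1, 6, 8, 3)"
proof -
  note rel = komeda_relations[OF par]
  have gcd: "Gcd (range n) = 1" and pos: "\<And>j. 0 < n j" and params: "0 < b" "0 < c" "0 < d" "0 < e" "0 < p"
    using par by (simp_all add: komeda_parameters_def)
  show ?thesis
    apply (rule betti_sequence_rewriting_4[OF gcd pos _ resolution_n3_less[OF params(3) params(5) params(1) params(4)], where i = 3
          and P = "{(expo (Suc (e + p)) 0 0 0, expo 0 0 1 d), (expo p 1 0 0, expo 0 0 (Suc c) 0),
              (expo 0 0 0 (Suc d), expo 1 b c 0), (expo 0 1 0 d, expo (Suc e) 0 c 0), (expo (e + p) 0 0 1,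
              expo 0 b (Suc c) 0)}"
          and rules = "{(expo 0 (Suc b) 0 0, expo e 0 0 1)}" and t = 2
          and B = "\<Union> (set [expo_box {..<e + p} {0} {0} {..d}, expo_box {e + p} {0} {0} {0},
              expo_box {..<p} {1..b} {0} {..<d}])"
          and dG = "[int (Suc d), int (1 + d), int (p + 1), int (e + p + 1), int (Suc (e + p)),
              int (Suc b)]" and dC = "[int (1 + d + 1), int (p + 1 + d), int (e + p + 1 + d),
              int (e + p + 1 + 1), int (Suc (e + p) + 1), int (Suc (e + p) + 1), int (Suc b + d), int (Suc b + p)]"
          and dD = "[int (e + p + 1 + d + 1), int (Suc (e + p) + 1 + 1), int (Suc b + d + p)]"])
    subgoal by (rule nzd)
    subgoal using rel params by (simp add: weight_expo algebra_simps)
    subgoal using rel params less by (simp add: weight_expo algebra_simps)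
    subgoal by simp
    subgoal by (rule order_trans[OF card_Union_set_le]) (use rel params in \<open>simp add: card_expo_box algebra_simps\<close>)
    subgoal using params by (auto simp: not_le not_less_eq_eq)
    subgoal by (simp add: mon_def)
    subgoal using params less by (simp add: mon_def)
    subgoal using params less by (simp add: mon_def)
    subgoal by (auto dest!: keys_mon_diff)
    by (use params less in \<open>simp_all add: eval_simps homogeneous_mon_diff lookup_minus numeral_eq_Suc\<close>)
qed

lemma betti_n3_eq:
  fixes n :: "4 \<Rightarrow> nat"
  assumes par: "komeda_parameters n e c d e p"
    and nzd: "\<And>f :: (4, 'k::field) mpol. indet 3 * f \<in> tangent_cone_ideal n \<Longrightarrow>
        f \<in> tangent_cone_ideal n"
  shows "quotient_betti_sequence (tangent_cone_ideal n :: (4, 'k) mpol set) (1, 5, 6, 2)"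
proof -
  note rel = komeda_relations[OF par]
  have gcd: "Gcd (range n) = 1" and pos: "\<And>j. 0 < n j" and params: "0 < e" "0 < c" "0 < d" "0 < e" "0 < p"
    using par by (simp_all add: komeda_parameters_def)
  let ?G = "[mon 0 0 0 (Suc d), mon 0 1 0 d, mon p 1 0 0, mon 0 (Suc e) 0 0 - mon e 0 0 1,
      mon (Suc (e + p)) 0 0 0] :: (4, 'k) mpol list"
  \<comment> \<open>This is \<open>X_2^e\<close> times the generator \<open>mon p 1 0 0\<close>,
    minus \<open>X_1^p\<close> times f_2.\<close>
  have "single (expo (e + p) 0 0 1) 1 = (\<Sum>j<length ?G. [0, 0, mon 0 e 0 0, - mon p 0 0 0, 0] ! j * ?G ! j)"
    by (simp add: eval_simps algebra_simps) (simp add: mon_def)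
  then have redundant: "\<exists>v. single (expo (e + p) 0 0 1) 1 = (\<Sum>j<length ?G. v j * ?G ! j)"
    by (rule exI[of _ "\<lambda>j. [0, 0, mon 0 e 0 0, - mon p 0 0 0, 0] ! j"])
  show ?thesis
    apply (rule betti_sequence_rewriting_4[OF gcd pos _ resolution_n3_eq[OF params(3) params(5) params(1)], where i = 3
          and P = "{(expo (Suc (e + p)) 0 0 0, expo 0 0 1 d), (expo p 1 0 0, expo 0 0 (Suc c) 0),
              (expo 0 0 0 (Suc d), expo 1 e c 0), (expo 0 1 0 d, expo (Suc e) 0 c 0), (expo (e + p) 0 0 1,
              expo 0 e (Suc c) 0)}"
          and rules = "{(expo 0 (Suc e) 0 0, expo e 0 0 1)}" and t = 2
          and B = "\<Union> (set [expo_box {..<e + p} {0} {0} {..d}, expo_box {e + p} {0} {0} {0},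
              expo_box {..<p} {1..e} {0} {..<d}])"
          and dG = "[int (Suc d), int (1 + d), int (p + 1), int (Suc e),
              int (Suc (e + p))]" and dC = "[int (1 + d + 1), int (p + 1 + d), int (Suc e + d),
              int (Suc e + p + 1), int (Suc (e + p) + 1), int (Suc (e + p) + 1)]"
          and dD = "[int (Suc e + d + p + 1), int (Suc (e + p) + 1 + 1)]"])
    subgoal by (rule nzd)
    subgoal using rel params by (simp add: weight_expo algebra_simps)
    subgoal using rel params by (simp add: weight_expo algebra_simps)
    subgoal by simp
    subgoal by (rule order_trans[OF card_Union_set_le]) (use rel params in \<open>simp add: card_expo_box algebra_simps\<close>)
    subgoal using params by (auto simp: not_le not_less_eq_eq)
    subgoal using redundant by (simp add: mon_def)
    subgoal using params by (simp add: mon_def)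
    subgoal using params by (simp add: mon_def)
    subgoal by (auto dest!: keys_mon_diff)
    by (use params in \<open>simp_all add: eval_simps homogeneous_mon_diff lookup_minus numeral_eq_Suc\<close>)
qed

text \<open>The rule comes from f_3 and lowers the exponent of \<open>X_3\<close>. The boxes have (e
  + p + 1) (b + 1) c, b + 1 and e b elements: in total \<open>n 4\<close>.\<close>

lemma betti_n4_less:
  fixes n :: "4 \<Rightarrow> nat"
  assumes par: "komeda_parameters n b c d e p"
    and nzd: "\<And>f :: (4, 'k::field) mpol. indet 4 * f \<in> tangent_cone_ideal n \<Longrightarrow>
        f \<in> tangent_cone_ideal n"
    and less: "c < p"
  shows "quotient_betti_sequence (tangent_cone_ideal n :: (4, 'k) mpol set) (1, 5, 7, 3)"
proof -
  note rel = komeda_relations[OF par]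
  have gcd: "Gcd (range n) = 1" and pos: "\<And>j. 0 < n j" and params: "0 < b" "0 < c" "0 < d" "0 < e" "0 < p"
    using par by (simp_all add: komeda_parameters_def)
  show ?thesis
    apply (rule betti_sequence_rewriting_4[OF gcd pos _ resolution_n4_less[OF params(1) params(2) params(4) params(5)], where i = 4
          and P = "{(expo (Suc (e + p)) 0 0 0, expo 0 0 1 d), (expo 0 (Suc b) 0 0, expo e 0 0 1),
              (expo 1 b c 0, expo 0 0 0 (Suc d)), (expo (Suc e) 0 c 0, expo 0 1 0 d)}"
          and rules = "{(expo 0 0 (Suc c) 0, expo p 1 0 0)}" and t = 3
          and B = "\<Union> (set [expo_box {..e + p} {..b} {..<c} {0}, expo_box {0} {..b} {c} {0},
              expo_box {1..e} {..<b} {c} {0}])"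
          and dG = "[int (Suc b), int (Suc c), int (1 + b + c), int (Suc e + c),
              int (Suc (e + p))]" and dC = "[int (Suc c + Suc b), int (1 + b + c + 1), int (1 + b + c + 1),
              int (Suc e + c + b), int (Suc e + c + 1), int (Suc (e + p) + Suc b), int (Suc (e + p) + c)]"
          and dD = "[int (1 + b + c + 1 + 1), int (Suc e + c + b + 1), int (Suc (e + p) + Suc b + c)]"])
    subgoal by (rule nzd)
    subgoal using rel params by (simp add: weight_expo algebra_simps)
    subgoal using rel params less by (simp add: weight_expo algebra_simps)
    subgoal by simp
    subgoal by (rule order_trans[OF card_Union_set_le]) (use rel params in \<open>simp add: card_expo_box algebra_simps\<close>)
    subgoal using params by (auto simp: not_le not_less_eq_eq)
    subgoal by (simp add: mon_def)
    subgoal using params less by (simp add: mon_def)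
    subgoal using params less by (simp add: mon_def)
    subgoal by (auto dest!: keys_mon_diff)
    by (use params less in \<open>simp_all add: eval_simps homogeneous_mon_diff lookup_minus numeral_eq_Suc\<close>)
qed

lemma betti_n4_eq:
  fixes n :: "4 \<Rightarrow> nat"
  assumes par: "komeda_parameters n b p d e p"
    and nzd: "\<And>f :: (4, 'k::field) mpol. indet 4 * f \<in> tangent_cone_ideal n \<Longrightarrow>
        f \<in> tangent_cone_ideal n"
  shows "quotient_betti_sequence (tangent_cone_ideal n :: (4, 'k) mpol set) (1, 5, 6, 2)"
proof -
  note rel = komeda_relations[OF par]
  have gcd: "Gcd (range n) = 1" and pos: "\<And>j. 0 < n j" and params: "0 < b" "0 < p" "0 < d" "0 < e" "0 < p"
    using par by (simp_all add: komeda_parameters_def)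
  show ?thesis
    apply (rule betti_sequence_rewriting_4[OF gcd pos _ resolution_n4_eq[OF params(1) params(4) params(2)], where i = 4
          and P = "{(expo (Suc (e + p)) 0 0 0, expo 0 0 1 d), (expo 0 (Suc b) 0 0, expo e 0 0 1),
              (expo 1 b p 0, expo 0 0 0 (Suc d)), (expo (Suc e) 0 p 0, expo 0 1 0 d)}"
          and rules = "{(expo 0 0 (Suc p) 0, expo p 1 0 0)}" and t = 3
          and B = "\<Union> (set [expo_box {..e + p} {..b} {..<p} {0}, expo_box {0} {..b} {p} {0},
              expo_box {1..e} {..<b} {p} {0}])"
          and dG = "[int (Suc b), int (1 + b + p), int (Suc e + p), int (Suc (e + p)),
              int (Suc p)]" and dC = "[int (1 + b + p + 1), int (Suc e + p + b), int (Suc (e + p) + p),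
              int (Suc p + Suc e), int (Suc p + Suc b), int (Suc p + 1 + b)]"
          and dD = "[int (Suc (e + p) + p + Suc b), int (Suc p + Suc b + 1)]"])
    subgoal by (rule nzd)
    subgoal using rel params by (simp add: weight_expo algebra_simps)
    subgoal using rel params by (simp add: weight_expo algebra_simps)
    subgoal by simp
    subgoal by (rule order_trans[OF card_Union_set_le]) (use rel params in \<open>simp add: card_expo_box algebra_simps\<close>)
    subgoal using params by (auto simp: not_le not_less_eq_eq)
    subgoal by (simp add: mon_def)
    subgoal using params by (simp add: mon_def)
    subgoal using params by (simp add: mon_def)
    subgoal by (auto dest!: keys_mon_diff)
    by (use params in \<open>simp_all add: eval_simps homogeneous_mon_diff lookup_minus numeral_eq_Suc\<close>)
qed

section \<open>Minimal generators and assembly of the cases\<close>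

lemma minimal_generator_not_combination:
  assumes "minimally_generates_numerical_semigroup n"
  shows "n j \<noteq> (\<Sum>i\<in>UNIV - {j}. u i * n i)"
proof
  assume eq: "n j = (\<Sum>i\<in>UNIV - {j}. u i * n i)"
  have "semigroup_span (UNIV - {j}) n = semigroup_span UNIV n"
  proof (intro equalityI subsetI)
    fix x assume "x \<in> semigroup_span (UNIV - {j}) n"
    then obtain v where v: "x = (\<Sum>i\<in>UNIV - {j}. v i * n i)" by (auto simp: semigroup_span_def)
    have "x = (\<Sum>i\<in>UNIV. (if i = j then 0 else v i) * n i)"
      unfolding v by (rule sum.mono_neutral_cong_left) auto
    then show "x \<in> semigroup_span UNIV n"
      unfolding semigroup_span_def by (intro CollectI exI[of _ "\<lambda>i. if i = j then 0 else v i"]) simp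
  next
    fix x assume "x \<in> semigroup_span UNIV n"
    then obtain v where "x = (\<Sum>i\<in>UNIV. v i * n i)" by (auto simp: semigroup_span_def)
    then have "x = v j * n j + (\<Sum>i\<in>UNIV - {j}. v i * n i)" by (simp add: sum.remove[of UNIV j])
    then have "x = (\<Sum>i\<in>UNIV - {j}. (v j * u i + v i) * n i)"
      unfolding eq by (simp add: distrib_right sum.distrib sum_distrib_left mult.assoc)
    then show "x \<in> semigroup_span (UNIV - {j}) n"
      unfolding semigroup_span_def by (intro CollectI exI[of _ "\<lambda>i. v j * u i + v i"]) simp
  qed
  moreover have "UNIV - {j} \<noteq> UNIV" by blast
  then have "semigroup_span (UNIV - {j}) n \<noteq> semigroup_span UNIV n"
    using assms by (simp add: minimally_generates_numerical_semigroup_def)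
  ultimately show False by contradiction
qed

lemma multiplicity_strict:
  assumes min: "minimally_generates_numerical_semigroup n" and i: "n i = semigroup_multiplicity n" and "j \<noteq> i"
  shows "n i < n j"
proof -
  have "n i \<le> n j" unfolding i semigroup_multiplicity_def by (intro Min_le) auto
  moreover have "n j \<noteq> n i"
  proof
    assume "n j = n i"
    also have "n i = (\<Sum>k\<in>UNIV - {j}. (if k = i then 1 else 0) * n k)"
      using \<open>j \<noteq> i\<close> by (simp add: if_distrib[of "\<lambda>x. x * _"] cong: if_cong)
    finally show False
      using minimal_generator_not_combination[OF min, of j "\<lambda>k. if k = i then 1 else 0"] by contradiction
  qed
  ultimately show ?thesis by simp
qed

text \<open>Otherwise \<open>single_in_tangent_cone_ideal\<close> gives a monomial of weight
  \<open>n j\<close> and degree above 1. It cannot involve \<open>X_j\<close>, so it writes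
  \<open>n j\<close> as a combination of the other generators.\<close>

lemma var_notin_tangent_cone_ideal:
  assumes min: "minimally_generates_numerical_semigroup n"
  shows "indet j \<notin> (tangent_cone_ideal n :: ('v::finite, 'k::comm_ring_1) mpol set)"
proof
  assume "indet j \<in> (tangent_cone_ideal n :: ('v, 'k) mpol set)"
  from single_in_tangent_cone_ideal[OF this] obtain N where N: "weight n N = n j" "1 < mdeg N"
    by (auto simp: weight_single mdeg_single)
  have pos: "0 < n i" for i using min by (simp add: minimally_generates_numerical_semigroup_def)
  have "weight n N = lookup N j * n j + (\<Sum>i\<in>UNIV - {j}. lookup N i * n i)"
    unfolding weight_def by (simp add: sum.remove[of UNIV j])
  moreover have "lookup N j = 0"
  proof (rule ccontr)
    assume "lookup N j \<noteq> 0"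
    then obtain K where K: "N = single j 1 + K" using split_var[of N j] by auto
    then have "weight n K = 0" using N by (simp add: weight_add weight_single)
    then have "mdeg K = 0" using mdeg_le_weight[of n K] pos by simp
    then show False using N(2) K by (simp add: mdeg_add mdeg_single)
  qed
  ultimately show False using N(1) minimal_generator_not_combination[OF min, of j "lookup N"] by simp
qed

lemma komeda_parameters_exist:
  fixes \<alpha>\<^sub>1 \<alpha>\<^sub>2 \<alpha>\<^sub>3 \<alpha>\<^sub>4 \<alpha>\<^sub>2\<^sub>1 :: int
  assumes "pseudo_symmetric_4_generated n \<alpha>\<^sub>1 \<alpha>\<^sub>2 \<alpha>\<^sub>3 \<alpha>\<^sub>4 \<alpha>\<^sub>2\<^sub>1"
  obtains b c d e p where "komeda_parameters n b c d e p"
    "\<alpha>\<^sub>1 = int e + int p + 1" "\<alpha>\<^sub>2 = int b + 1" "\<alpha>\<^sub>3 = int c + 1" "\<alpha>\<^sub>4 = int d + 1" "\<alpha>\<^sub>2\<^sub>1 = int e"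
proof -
  note * = assms[unfolded pseudo_symmetric_4_generated_def minimally_generates_numerical_semigroup_def]
  define b c d e p where "b = nat (\<alpha>\<^sub>2 - 1)" "c = nat (\<alpha>\<^sub>3 - 1)" "d = nat (\<alpha>\<^sub>4 - 1)" "e = nat \<alpha>\<^sub>2\<^sub>1" "p = nat (\<alpha>\<^sub>1 - \<alpha>\<^sub>2\<^sub>1 - 1)"
  then have eq: "\<alpha>\<^sub>1 = int e + int p + 1" "\<alpha>\<^sub>2 = int b + 1" "\<alpha>\<^sub>3 = int c + 1" "\<alpha>\<^sub>4 = int d + 1" "\<alpha>\<^sub>2\<^sub>1 = int e"
    using * by simp_all
  have n: "int (n 1) = int (Suc b * Suc c * d + 1)" "int (n 2) = int (e * Suc c * Suc d + p * c + Suc c)"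
    "int (n 3 + d) = int (Suc (e + p) * Suc d + p * b * d)" "int (n 4) = int (Suc (e + p) * Suc b * c + e * b + Suc b)"
    using * unfolding eq by (simp_all add: algebra_simps)
  have "0 < b" "0 < c" "0 < d" "0 < e" "0 < p" using * unfolding eq by linarith+
  then have "komeda_parameters n b c d e p"
    using * n unfolding komeda_parameters_def of_nat_eq_iff by simp
  then show ?thesis using eq by (rule that)
qed

theorem theorem1p1:
  fixes n :: "4 \<Rightarrow> nat"
    and \<alpha>\<^sub>1 \<alpha>\<^sub>2 \<alpha>\<^sub>3 \<alpha>\<^sub>4 \<alpha>\<^sub>2\<^sub>1 :: int
    and I :: "(4, 'k::field) mpol set"
  assumes "pseudo_symmetric_4_generated n \<alpha>\<^sub>1 \<alpha>\<^sub>2 \<alpha>\<^sub>3 \<alpha>\<^sub>4 \<alpha>\<^sub>2\<^sub>1"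
    and "I = tangent_cone_ideal n"
    and "cohen_macaulay (mpol_ring Quot I)"
  shows
    "(n 1 = semigroup_multiplicity n \<longrightarrow> quotient_betti_sequence I (1, 5, 6, 2)) \<and>
     (n 2 = semigroup_multiplicity n \<and> \<alpha>\<^sub>1 = \<alpha>\<^sub>4 \<longrightarrow> quotient_betti_sequence I (1, 5, 6, 2)) \<and>
     (n 2 = semigroup_multiplicity n \<and> \<alpha>\<^sub>1 < \<alpha>\<^sub>4 \<longrightarrow> quotient_betti_sequence I (1, 5, 7, 3)) \<and>
     (n 2 = semigroup_multiplicity n \<and> \<alpha>\<^sub>1 > \<alpha>\<^sub>4 \<longrightarrow> quotient_betti_sequence I (1, 6, 9, 4)) \<and>
     (n 3 = semigroup_multiplicity n \<and> \<alpha>\<^sub>2 = \<alpha>\<^sub>2\<^sub>1 + 1 \<longrightarrow> quotient_betti_sequence I (1, 5, 6, 2)) \<and>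
     (n 3 = semigroup_multiplicity n \<and> \<alpha>\<^sub>2 < \<alpha>\<^sub>2\<^sub>1 + 1 \<longrightarrow> quotient_betti_sequence I (1, 6, 8, 3)) \<and>
     (n 4 = semigroup_multiplicity n \<and> \<alpha>\<^sub>3 = \<alpha>\<^sub>1 - \<alpha>\<^sub>2\<^sub>1 \<longrightarrow> quotient_betti_sequence I (1, 5, 6, 2)) \<and>
     (n 4 = semigroup_multiplicity n \<and> \<alpha>\<^sub>3 < \<alpha>\<^sub>1 - \<alpha>\<^sub>2\<^sub>1 \<longrightarrow> quotient_betti_sequence I (1, 5, 7, 3))"
proof -
  obtain b c d e p where par: "komeda_parameters n b c d e p"
    and \<alpha>: "\<alpha>\<^sub>1 = int e + int p + 1" "\<alpha>\<^sub>2 = int b + 1" "\<alpha>\<^sub>3 = int c + 1" "\<alpha>\<^sub>4 = int d + 1" "\<alpha>\<^sub>2\<^sub>1 = int e"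
    using komeda_parameters_exist[OF assms(1)] by blast
  note I = assms(2)
  have min: "minimally_generates_numerical_semigroup n"
    using assms(1) by (simp add: pseudo_symmetric_4_generated_def)
  have pos: "0 < n i" for i using par by (simp add: komeda_parameters_def)
  have nzd: "f \<in> tangent_cone_ideal n"
    if i: "n i = semigroup_multiplicity n" and f: "indet i * f \<in> tangent_cone_ideal n" for i and f :: "(4, 'k) mpol"
    using assms(3) pos multiplicity_strict[OF min i] f unfolding I by (rule cohen_macaulay_imp_regular_var)
  note par' = par[unfolded komeda_parameters_def]
  have 1: "quotient_betti_sequence I (1, 5, 6, 2)" if "n 1 = semigroup_multiplicity n"
    unfolding I using nzd[OF that] by (rule betti_n1[OF par])
  have 2: "quotient_betti_sequence I (1, 5, 6,
      2)" if m: "n 2 = semigroup_multiplicity n" and "\<alpha>\<^sub>1 = \<alpha>\<^sub>4"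
  proof -
    have "d = e + p" using that \<alpha> by simp
    with par have "komeda_parameters n b c (e + p) e p" by simp
    from betti_n2_eq[OF this nzd[OF m]] show ?thesis unfolding I .
  qed
  have 3: "quotient_betti_sequence I (1, 5, 7,
      3)" if m: "n 2 = semigroup_multiplicity n" and "\<alpha>\<^sub>1 < \<alpha>\<^sub>4"
  proof -
    have "e + p < d" using that \<alpha> by simp
    from betti_n2_less[OF par nzd[OF m] this] show ?thesis unfolding I .
  qed
  have 4: "quotient_betti_sequence I (1, 6, 9,
      4)" if m: "n 2 = semigroup_multiplicity n" and "\<alpha>\<^sub>1 > \<alpha>\<^sub>4"
  proof -
    \<comment> \<open>For \<alpha>_4 = 2 the product \<open>X_2 X_4\<close> would be the leading
      form of f_5 up to sign. Cancelling the regular \<open>X_2\<close> would put \<open>X_4\<close>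
      into the tangent cone ideal, against minimality of the generators. This gives the positive
      shifted parameter that \<open>betti_n2_greater\<close> requires.\<close>
    have "d \<noteq> 1"
    proof
      assume d: "d = 1"
      have "weight n (expo 0 1 0 1) = weight n (expo (Suc e) 0 c 0)"
        using komeda_relations(5)[OF par] by (simp add: weight_expo d)
      moreover have "mdeg (expo 0 1 0 1) < mdeg (expo (Suc e) 0 c 0)" using par' by simp
      ultimately have "single (expo 0 1 0 1) (1::'k) \<in> tangent_cone_ideal n"
        using binomial_leading_form[of n "expo 0 1 0 1" "expo (Suc e) 0 c 0", where 'k='k] by simp
      moreover have "single (expo 0 1 0 1) (1::'k) = indet 2 * indet 4"
        by (simp add: expo_def mult_single)
      ultimately have "indet 4 \<in> (tangent_cone_ideal n :: (4, 'k) mpol set)" using nzd[OF m] by simp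
      then show False using var_notin_tangent_cone_ideal[OF min] by blast
    qed
    then obtain d' where d': "d = Suc d'" "0 < d'" using par' by (metis Suc_pred neq0_conv One_nat_def)
    have less: "Suc d' < e + p" using that \<alpha> d' by simp
    from betti_n2_greater[OF par[unfolded d'(1)] nzd[OF m] this d'(2)] show ?thesis unfolding I .
  qed
  have 5: "quotient_betti_sequence I (1, 5, 6,
      2)" if m: "n 3 = semigroup_multiplicity n" and "\<alpha>\<^sub>2 = \<alpha>\<^sub>2\<^sub>1 + 1"
  proof -
    have "b = e" using that \<alpha> by simp
    with par have "komeda_parameters n e c d e p" by simp
    from betti_n3_eq[OF this nzd[OF m]] show ?thesis unfolding I .
  qed
  have 6: "quotient_betti_sequence I (1, 6, 8,
      3)" if m: "n 3 = semigroup_multiplicity n" and "\<alpha>\<^sub>2 < \<alpha>\<^sub>2\<^sub>1 + 1"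
  proof -
    have "b < e" using that \<alpha> by simp
    from betti_n3_less[OF par nzd[OF m] this] show ?thesis unfolding I .
  qed
  have 7: "quotient_betti_sequence I (1, 5, 6,
      2)" if m: "n 4 = semigroup_multiplicity n" and "\<alpha>\<^sub>3 = \<alpha>\<^sub>1 - \<alpha>\<^sub>2\<^sub>1"
  proof -
    have "c = p" using that \<alpha> by simp
    with par have "komeda_parameters n b p d e p" by simp
    from betti_n4_eq[OF this nzd[OF m]] show ?thesis unfolding I .
  qed
  have 8: "quotient_betti_sequence I (1, 5, 7,
      3)" if m: "n 4 = semigroup_multiplicity n" and "\<alpha>\<^sub>3 < \<alpha>\<^sub>1 - \<alpha>\<^sub>2\<^sub>1"
  proof -
    have "c < p" using that \<alpha> by simp
    from betti_n4_less[OF par nzd[OF m] this] show ?thesis unfolding I .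
  qed
  show ?thesis using 1 2 3 4 5 6 7 8 by blast
qed

end
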